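(* Let $k\in\{1,3\}$, $E\in\mathbb{C}$, and for complex $m_0,\dots,m_3$ let $M_{2\omega_k}^{(m_0,m_1,m_2,m_3)}(E)$ be the monodromy matrix for the shift of the period $x\to x+2\omega_k$ with respect to some basis of solutions of $H^{(m_0,m_1,m_2,m_3)}f(x)=Ef(x)$. Let $l_0',l_1',l_2',l_3'\in\mathbb{C}$, let $\alpha_i'\in\{-l_i',l_i'+1\}$ for each $i\in\{0,1,2,3\}$, and set $d=-\sum_{i=0}^3\alpha_i'/2$. Then $$\mathrm{tr}\,M_{2\omega_k}^{(l_0',l_1',l_2',l_3')}(E)=\mathrm{tr}\,M_{2\omega_k}^{(\alpha_0'+d,\alpha_1'+d,\alpha_2'+d,\alpha_3'+d)}(E).$$
   Context: $\wp(x)$ is the Weierstrass elliptic function with periods $(2\omega_1,2\omega_3)$; $\omega_0=0$, $\omega_2=-\omega_1-\omega_3$. For complex $m_0,\dots,m_3$, $$H^{(m_0,m_1,m_2,m_3)}=-\frac{d^2}{dx^2}+\sum_{i=0}^3m_i(m_i+1)\wp(x+\omega_i).$$ For a basis $(f_1,f_2)$ of solutions of $H^{(m_0,m_1,m_2,m_3)}f=Ef$ near a point $x$, the matrix $M_{2\omega_k}$ is defined by $(f_1(x+2\omega_k),f_2(x+2\omega_k))=(f_1(x),f_2(x))M_{2\omega_k}$, where $f_j(x+2\omega_k)$ is the analytic continuation of $f_j$ along the straight segment from $x$ to $x+2\omega_k$, with $x$ chosen so that this segment avoids $\mathbb{Z}\omega_1+\mathbb{Z}\omega_3$; the same $x$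 (path) is used for both equations. *)

theory Defs
  imports "HOL-Complex_Analysis.Complex_Analysis"
begin

text \<open>
  Throughout, \<open>\<omega>1\<close> and \<open>\<omega>3\<close> are half-periods: the period lattice is
  \<open>2\<omega>1 \<int> + 2\<omega>3 \<int>\<close>.
\<close>

definition int_span2 :: "complex \<Rightarrow> complex \<Rightarrow> complex set" where
  "int_span2 a b = {of_int m * a + of_int n * b |m n. True}"

text \<open>
  For \<open>\<real>\<close>-linearly independent \<open>\<omega>1\<close>, \<open>\<omega>3\<close> the series converges absolutely for every \<open>z\<close> off
  the lattice, so the unordered sum is the usual one. At lattice points the value is meaningless.
\<close>

definition weierstrass_p :: "complex \<Rightarrow> complex \<Rightarrow> complex \<Rightarrow> complex" where
  "weierstrass_p \<omega>1 \<omega>3 z =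
     1 / z^2 + (\<Sum>\<^sub>\<infinity>w \<in> int_span2 (2 * \<omega>1) (2 * \<omega>3) - {0}. 1 / (z - w)^2 - 1 / w^2)"

text \<open>Only the indices \<open>0,\<dots>,3\<close> are used.\<close>

definition half_period :: "complex \<Rightarrow> complex \<Rightarrow> nat \<Rightarrow> complex" where
  "half_period \<omega>1 \<omega>3 i =
     (if i = 0 then 0 else if i = 1 then \<omega>1 else if i = 2 then - \<omega>1 - \<omega>3 else \<omega>3)"

definition heun_op ::
  "complex \<Rightarrow> complex \<Rightarrow> (nat \<Rightarrow> complex) \<Rightarrow> (complex \<Rightarrow> complex) \<Rightarrow> complex \<Rightarrow> complex" where
  "heun_op \<omega>1 \<omega>3 m f x =
     - (deriv ^^ 2) f x
     + (\<Sum>i=0..3. m i * (m i + 1) * weierstrass_p \<omega>1 \<omega>3 (x + half_period \<omega>1 \<omega>3 i)) * f x"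

text \<open>
  Local solutions are germs: a function is used to represent its germ at \<open>x\<close>, and identities
  between germs are stated with \<open>\<forall>\<^sub>F z in nhds x\<close>.
\<close>

definition local_solution ::
  "complex \<Rightarrow> complex \<Rightarrow> (nat \<Rightarrow> complex) \<Rightarrow> complex \<Rightarrow> complex \<Rightarrow> (complex \<Rightarrow> complex) \<Rightarrow> bool" where
  "local_solution \<omega>1 \<omega>3 m E x f \<longleftrightarrow>
     f analytic_on {x} \<and> (\<forall>\<^sub>F z in nhds x. heun_op \<omega>1 \<omega>3 m f z = E * f z)"

definition solution_basis ::
  "complex \<Rightarrow> complex \<Rightarrow> (nat \<Rightarrow> complex) \<Rightarrow> complex \<Rightarrow> complex \<Rightarrow> (2 \<Rightarrow> complex \<Rightarrow> complex) \<Rightarrow> bool" where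
  "solution_basis \<omega>1 \<omega>3 m E x f \<longleftrightarrow>
     (\<forall>j. local_solution \<omega>1 \<omega>3 m E x (f j)) \<and>
     (\<forall>c. (\<forall>\<^sub>F z in nhds x. (\<Sum>j\<in>UNIV. c j * f j z) = 0) \<longrightarrow> (\<forall>j. c j = 0)) \<and>
     (\<forall>h. local_solution \<omega>1 \<omega>3 m E x h \<longrightarrow>
        (\<exists>c. \<forall>\<^sub>F z in nhds x. h z = (\<Sum>j\<in>UNIV. c j * f j z)))"

text \<open>
  The germ of \<open>g\<close> at the end of the path \<open>\<gamma>\<close> is the analytic continuation along \<open>\<gamma>\<close> of the germ
  of \<open>f\<close> at its start: \<open>F t\<close> represents the germ at \<open>\<gamma> t\<close>, and nearby germs of the family are
  direct continuations of each other.
\<close>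

definition analytic_continuation_along ::
  "(real \<Rightarrow> complex) \<Rightarrow> (complex \<Rightarrow> complex) \<Rightarrow> (complex \<Rightarrow> complex) \<Rightarrow> bool" where
  "analytic_continuation_along \<gamma> f g \<longleftrightarrow>
     (\<exists>F :: real \<Rightarrow> complex \<Rightarrow> complex.
        (\<forall>t\<in>{0..1}. F t analytic_on {\<gamma> t}) \<and>
        (\<forall>t\<in>{0..1}. \<forall>\<^sub>F s in at t within {0..1}. \<forall>\<^sub>F z in nhds (\<gamma> s). F s z = F t z) \<and>
        (\<forall>\<^sub>F z in nhds (\<gamma> 0). F 0 z = f z) \<and>
        (\<forall>\<^sub>F z in nhds (\<gamma> 1). F 1 z = g z))"

text \<open>
  \<open>M\<close> is the matrix of the shift by \<open>2 \<omega>\<^sub>k\<close> in the basis \<open>f\<close> of solutions near \<open>x\<close>. The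
  functions \<open>g j\<close> are the continuations of \<open>f j\<close> to a neighbourhood of \<open>x + 2 \<omega>\<^sub>k\<close>; as germs they
  are determined by \<open>f j\<close>, and thus \<open>M\<close> is determined by \<open>f\<close>.
\<close>

definition monodromy_matrix ::
  "complex \<Rightarrow> complex \<Rightarrow> (nat \<Rightarrow> complex) \<Rightarrow> complex \<Rightarrow> nat \<Rightarrow> complex \<Rightarrow>
   (2 \<Rightarrow> complex \<Rightarrow> complex) \<Rightarrow> complex^2^2 \<Rightarrow> bool" where
  "monodromy_matrix \<omega>1 \<omega>3 m E k x f M \<longleftrightarrow>
     solution_basis \<omega>1 \<omega>3 m E x f \<and>
     (\<exists>g :: 2 \<Rightarrow> complex \<Rightarrow> complex.
        (\<forall>j. analytic_continuation_along (linepath x (x + 2 * half_period \<omega>1 \<omega>3 k)) (f j) (g j)) \<and>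
        (\<forall>\<^sub>F z in nhds x. (\<chi> j. g j (z + 2 * half_period \<omega>1 \<omega>3 k)) = (\<chi> j. f j z) v* M))"

end

theory Submission
  imports Defs
begin

text \<open>
  Write \<open>\<beta>\<^sub>i = \<alpha>\<^sub>i + d\<close>. Since \<open>l\<^sub>i(l\<^sub>i + 1) = \<alpha>\<^sub>i(\<alpha>\<^sub>i - 1)\<close>, the two operators are intertwined by the kernel
  \<open>K(x,y) = \<Prod>\<^sub>i \<sigma>\<^sub>i(x)\<^bsup>\<alpha>\<^sub>i\<^esup> \<sigma>\<^sub>i(y)\<^bsup>-\<beta>\<^sub>i\<^esup> \<cdot> (\<sigma>(y - x) \<sigma>(x + y))\<^sup>d\<close>, that is, \<open>H\<^sub>x K = H\<^sub>y K\<close>.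
  Let \<open>c = 2\<omega>\<^sub>k\<close>. For \<open>d > 0\<close> the kernel vanishes at \<open>y = x\<close> and \<open>y = x + c\<close>, so that
  \<open>g(x) = \<integral> K(x,y) f(y) dy\<close>, taken from \<open>x\<close> to \<open>x + c\<close>, maps solutions to solutions; it commutes with
  the shift by \<open>c\<close>, because \<open>K(x + c, y + c) = K(x, y)\<close>. As \<open>f(x + c) + f(x - c) = t f(x)\<close> for all
  solutions, with \<open>t\<close> the trace of the monodromy matrix, a single \<open>f\<close> with \<open>g \<noteq> 0\<close> makes the two traces
  equal. For \<open>E \<rightarrow> \<infinity>\<close> along the ray on which solutions grow exponentially, the integral is dominated
  by its upper end, so \<open>g \<noteq> 0\<close> there. The traces are entire in \<open>E\<close> and, along the line
  \<open>\<alpha>\<^sub>i + (d - r)/2\<close>, in \<open>r\<close> (for which \<open>d\<close> becomes \<open>r\<close>); the identity theorem gives all \<open>E\<close> and all \<open>d\<close>.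
\<close>

section \<open>Lattices\<close>

text \<open>Two obstacles shape the proof. The kernel is multivalued, so all work is done on an open
  strip along the line x + R c that avoids the half-periods: its convexity provides branches of the
  logarithms, and its invariance under c makes the shift act on solutions. For y = z + c \<tau> the
  factor sigma(y - z)^d depends on \<tau> alone, and by the duplication formula sigma(z + y)^d
  becomes a product of powers of the sigma_i at the midpoint of z and y, which lies in the strip
  again. The second obstacle is that the boundary terms vanish only for Re d > 0, and that for a
  given E the transform might be zero. Both are met by analytic continuation of the two traces
  instead of the transform. The parameters are chosen so that the equation depends on them
  quadratically: r as above, and p with E = -(p / c)^2. A single convergence theorem for Picard
  series with a quadratic parameter then serves both continuations.\<close>

lemma int_span2_zero [simp, intro]: "0 \<in> int_span2 a b"
  unfolding int_span2_def by (rule CollectI, rule exI[of _ 0], rule exI[of _ 0]) auto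

lemma int_span2_add [intro]:
  assumes "u \<in> int_span2 a b" "v \<in> int_span2 a b"
  shows "u + v \<in> int_span2 a b"
proof -
  from assms obtain m n m' n' :: int
    where "u = of_int m * a + of_int n * b" "v = of_int m' * a + of_int n' * b"
    by (auto simp: int_span2_def)
  hence "u + v = of_int (m + m') * a + of_int (n + n') * b" by (simp add: algebra_simps)
  thus ?thesis unfolding int_span2_def by blast
qed

lemma int_span2_minus [intro]:
  assumes "u \<in> int_span2 a b"
  shows "- u \<in> int_span2 a b"
proof -
  from assms obtain m n :: int where "u = of_int m * a + of_int n * b"
    by (auto simp: int_span2_def)
  hence "- u = of_int (- m) * a + of_int (- n) * b" by (simp add: algebra_simps)
  thus ?thesis unfolding int_span2_def by blast
qed

lemma int_span2_diff [intro]: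
  "u \<in> int_span2 a b \<Longrightarrow> v \<in> int_span2 a b \<Longrightarrow> u - v \<in> int_span2 a b"
  using int_span2_add[of u a b "- v"] int_span2_minus[of v a b] by simp

lemma int_span2_minus_iff [simp]: "- u \<in> int_span2 a b \<longleftrightarrow> u \<in> int_span2 a b"
  using int_span2_minus[of u a b] int_span2_minus[of "- u" a b] by auto

lemma int_span2_add_iff:
  "v \<in> int_span2 a b \<Longrightarrow> u + v \<in> int_span2 a b \<longleftrightarrow> u \<in> int_span2 a b"
  using int_span2_add[of u a b v] int_span2_diff[of "u + v" a b v] by auto

lemma int_span2_diff_iff:
  "v \<in> int_span2 a b \<Longrightarrow> u - v \<in> int_span2 a b \<longleftrightarrow> u \<in> int_span2 a b"
  using int_span2_diff[of u a b v] int_span2_add[of "u - v" a b v] by auto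

lemma int_span2_gen1 [intro]: "a \<in> int_span2 a b"
  unfolding int_span2_def by (rule CollectI, rule exI[of _ 1], rule exI[of _ 0]) auto

lemma int_span2_gen2 [intro]: "b \<in> int_span2 a b"
  unfolding int_span2_def by (rule CollectI, rule exI[of _ 0], rule exI[of _ 1]) auto

lemma countable_int_span2: "countable (int_span2 a b)"
proof -
  have "int_span2 a b = (\<lambda>(m, n). of_int m * a + of_int n * b) ` UNIV"
    by (auto simp: int_span2_def)
  thus ?thesis by simp
qed

section \<open>Discreteness of lattices and convergence of lattice sums\<close>

lemma real_span_norm_lower:
  fixes a b :: complex
  assumes "Im (b / a) \<noteq> 0"
  obtains \<kappa> where "\<kappa> > 0" "\<And>m n :: real. \<kappa> * (\<bar>m\<bar> + \<bar>n\<bar>) \<le> norm (of_real m * a + of_real n * b)"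
proof -
  have a0: "a \<noteq> 0" using assms by auto
  define r where "r = b / a"
  define I where "I = \<bar>Im r\<bar>"
  have I: "I > 0" using assms by (simp add: I_def r_def)
  \<comment> \<open>For q = m + n r the imaginary part gives |n| \<le> |q| / I, and then |m| \<le>
    |q| + |n| |r|. \<open>K\<close> collects both estimates.\<close>
  define K where "K = 1 + (norm r + 1) / I"
  have K: "K > 0" using I by (auto simp: K_def intro!: add_pos_nonneg)
  show ?thesis
  proof (rule that[of "norm a / K"])
    show "norm a / K > 0" using a0 K by simp
    fix m n :: real
    define q where "q = of_real m + of_real n * r"
    have "\<bar>n\<bar> * I = \<bar>Im q\<bar>" by (simp add: q_def I_def abs_mult)
    also have "\<dots> \<le> norm q" by (rule abs_Im_le_cmod)
    finally have n: "\<bar>n\<bar> \<le> norm q / I" using I by (simp add: field_simps)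
    have "\<bar>m\<bar> = norm (q - of_real n * r)" by (simp add: q_def)
    also have "\<dots> \<le> norm q + \<bar>n\<bar> * norm r"
      by (metis norm_triangle_ineq4 norm_mult norm_of_real)
    also have "\<dots> \<le> norm q + norm q / I * norm r"
      using n by (intro add_left_mono mult_right_mono) auto
    finally have "\<bar>m\<bar> + \<bar>n\<bar> \<le> norm q + norm q / I * norm r + norm q / I" using n by simp
    also have "\<dots> = K * norm q" using I by (simp add: K_def field_simps)
    finally have "(\<bar>m\<bar> + \<bar>n\<bar>) / K \<le> norm q" using K by (simp add: field_simps)
    hence "norm a * ((\<bar>m\<bar> + \<bar>n\<bar>) / K) \<le> norm a * norm q" by (intro mult_left_mono) auto
    also have "norm a * norm q = norm (of_real m * a + of_real n * b)"
      using a0 by (simp add: q_def r_def norm_mult[symmetric] algebra_simps)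
    finally show "norm a / K * (\<bar>m\<bar> + \<bar>n\<bar>) \<le> norm (of_real m * a + of_real n * b)"
      by simp
  qed
qed

lemma real_span_cong:
  fixes a b :: complex and m n m' n' :: real
  assumes "Im (b / a) \<noteq> 0" "of_real m * a + of_real n * b = of_real m' * a + of_real n' * b"
  shows "m = m'" "n = n'"
proof -
  obtain \<kappa> where \<kappa>: "\<kappa> > 0" "\<And>m n :: real. \<kappa> * (\<bar>m\<bar> + \<bar>n\<bar>) \<le> norm (of_real m * a + of_real n * b)"
    using real_span_norm_lower[OF assms(1)] by blast
  have "of_real (m - m') * a + of_real (n - n') * b = 0"
    using assms(2) by (simp add: algebra_simps)
  with \<kappa>(2)[of "m - m'" "n - n'"] have "\<kappa> * (\<bar>m - m'\<bar> + \<bar>n - n'\<bar>) \<le> 0" by simp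
  hence "\<bar>m - m'\<bar> + \<bar>n - n'\<bar> \<le> 0" using \<kappa>(1) by (simp add: mult_le_0_iff)
  thus "m = m'" "n = n'" by auto
qed

lemma finite_int_span2_cball:
  assumes "Im (b / a) \<noteq> 0"
  shows "finite (int_span2 a b \<inter> cball z R)"
proof -
  obtain \<kappa> where \<kappa>: "\<kappa> > 0" "\<And>m n :: real. \<kappa> * (\<bar>m\<bar> + \<bar>n\<bar>) \<le> norm (of_real m * a + of_real n * b)"
    using real_span_norm_lower[OF assms(1)] by blast
  define N where "N = \<lceil>(norm z + R) / \<kappa>\<rceil>"
  have "int_span2 a b \<inter> cball z R \<subseteq> (\<lambda>(m, n). of_int m * a + of_int n * b) ` ({-N..N} \<times> {-N..N})"
  proof
    fix w assume "w \<in> int_span2 a b \<inter> cball z R"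
    then obtain m n :: int where w: "w = of_int m * a + of_int n * b" "dist z w \<le> R"
      by (auto simp: int_span2_def)
    have "norm w \<le> norm z + R"
      using w(2) norm_triangle_ineq2[of w z] by (simp add: dist_norm norm_minus_commute)
    with \<kappa>(2)[of "of_int m" "of_int n"] w(1) have "\<kappa> * (\<bar>of_int m\<bar> + \<bar>of_int n\<bar>) \<le> norm z + R"
      by simp
    hence "\<bar>of_int m\<bar> + \<bar>of_int n\<bar> \<le> (norm z + R) / \<kappa>" using \<kappa>(1) by (simp add: field_simps)
    also have "\<dots> \<le> of_int N" by (simp add: N_def)
    finally have "\<bar>m\<bar> + \<bar>n\<bar> \<le> N" by linarith
    hence "m \<in> {-N..N}" "n \<in> {-N..N}" by auto
    with w(1) show "w \<in> (\<lambda>(m, n). of_int m * a + of_int n * b) ` ({-N..N} \<times> {-N..N})" by auto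
  qed
  thus ?thesis by (rule finite_subset) auto
qed

lemma int_span2_isolated:
  assumes "Im (b / a) \<noteq> 0"
  obtains e where "e > 0" "int_span2 a b \<inter> ball z e \<subseteq> {z}"
proof -
  obtain d where d: "d > 0" "\<And>w. w \<in> int_span2 a b \<inter> cball z 1 \<Longrightarrow> w \<noteq> z \<Longrightarrow> d \<le> dist z w"
    using finite_set_avoid[OF finite_int_span2_cball[OF assms, of z 1], of z] by auto
  show ?thesis
  proof (rule that[of "min d 1"])
    show "int_span2 a b \<inter> ball z (min d 1) \<subseteq> {z}"
    proof
      fix w assume w: "w \<in> int_span2 a b \<inter> ball z (min d 1)"
      hence "w \<in> int_span2 a b \<inter> cball z 1" by auto
      with d(2)[of w] w show "w \<in> {z}" by auto
    qed
  qed (use d in auto)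
qed

lemma summable_on_int_powr:
  assumes "s > 1"
  shows "(\<lambda>n::int. (1 + \<bar>of_int n\<bar>) powr (- s) :: real) summable_on UNIV"
proof -
  have "summable (\<lambda>n. of_nat (Suc n) powr (- s) :: real)"
    using assms summable_real_powr_iff[of "- s"]
    by (subst summable_Suc_iff[of "\<lambda>n. of_nat n powr (- s) :: real"]) simp
  hence nat: "(\<lambda>n::nat. (1 + real n) powr (- s)) summable_on UNIV"
    by (intro norm_summable_imp_summable_on) (simp add: add.commute)
  have "(\<lambda>n::int. (1 + \<bar>of_int n\<bar>) powr (- s) :: real) summable_on (range int)"
    using nat by (subst summable_on_reindex) (auto simp: o_def)
  moreover have "(\<lambda>n::int. (1 + \<bar>of_int n\<bar>) powr (- s) :: real) summable_on (range (\<lambda>n. - int n))"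
    using nat by (subst summable_on_reindex) (auto simp: o_def inj_on_def)
  ultimately have "(\<lambda>n::int. (1 + \<bar>of_int n\<bar>) powr (- s) :: real) summable_on (range int \<union> range (\<lambda>n. - int n))"
    by (rule summable_on_union)
  moreover have "range int \<union> range (\<lambda>n. - int n) = UNIV"
  proof -
    have "k \<in> range int \<union> range (\<lambda>n. - int n)" for k
      by (cases k rule: int_cases2) auto
    thus ?thesis by blast
  qed
  ultimately show ?thesis by simp
qed

text \<open>Since 1 + |m| + |n| dominates both 1 + |m| and 1 + |n|, its cube dominates the product
  of their powers with exponent 3/2. As 3/2 > 1, the double sum is bounded by a product of two
  convergent sums.\<close>

lemma summable_on_int_span2_cubes:
  assumes "Im (b / a) \<noteq> 0"
  shows "(\<lambda>w. 1 / norm w ^ 3) summable_on (int_span2 a b - {0})"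
proof -
  obtain \<kappa> where \<kappa>: "\<kappa> > 0" "\<And>m n :: real. \<kappa> * (\<bar>m\<bar> + \<bar>n\<bar>) \<le> norm (of_real m * a + of_real n * b)"
    using real_span_norm_lower[OF assms(1)] by blast
  define u where "u = (\<lambda>n::int. (1 + \<bar>of_int n\<bar>) powr (- (3/2)) :: real)"
  define v where "v = (\<lambda>(m, n). of_int m * a + of_int n * b)"
  have u: "u summable_on UNIV" unfolding u_def by (rule summable_on_int_powr) simp
  have u0: "u n \<ge> 0" for n by (simp add: u_def)
  have "(\<lambda>p. norm (u (fst p) * u (snd p))) summable_on (UNIV \<times> UNIV)"
    unfolding Infinite_Sum.abs_summable_on_Sigma_iff
  proof (intro conjI ballI)
    show "(\<lambda>n. norm (u (fst (m, n)) * u (snd (m, n)))) summable_on UNIV" for m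
      using u u0 by (auto simp: abs_mult intro!: summable_on_cmult_right)
    have "(\<lambda>m. norm (\<Sum>\<^sub>\<infinity>n. norm (u (fst (m, n)) * u (snd (m, n))))) = (\<lambda>m. u m * (\<Sum>\<^sub>\<infinity>n. u n))"
      using u0 by (auto simp: abs_mult infsum_cmult_right' infsum_nonneg)
    thus "(\<lambda>m. norm (\<Sum>\<^sub>\<infinity>n. norm (u (fst (m, n)) * u (snd (m, n))))) summable_on UNIV"
      using u by (auto intro!: summable_on_cmult_left)
  qed
  hence uu: "(\<lambda>p. u (fst p) * u (snd p)) summable_on UNIV"
    using u0 by (simp add: abs_mult)
  have inj: "inj v"
  proof (rule injI)
    fix p q assume "v p = v q"
    hence "complex_of_real (of_int (fst p)) * a + complex_of_real (of_int (snd p)) * b =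
           complex_of_real (of_int (fst q)) * a + complex_of_real (of_int (snd q)) * b"
      by (simp add: v_def case_prod_unfold)
    from real_span_cong[OF assms this] show "p = q" by (simp add: prod_eq_iff)
  qed
  have "(\<lambda>p. 1 / norm (v p) ^ 3) summable_on (- {(0, 0)})"
  proof (rule summable_on_comparison_test)
    show "(\<lambda>p. (2 / \<kappa>) ^ 3 * (u (fst p) * u (snd p))) summable_on (- {(0, 0)})"
      by (intro summable_on_cmult_right summable_on_subset[OF uu]) auto
  next
    fix p :: "int \<times> int" assume p: "p \<in> - {(0, 0)}"
    obtain m n where mn: "p = (m, n)" by (cases p)
    define x where "x = 1 + \<bar>real_of_int m\<bar>"
    define y where "y = 1 + \<bar>real_of_int n\<bar>"
    define S where "S = 1 + \<bar>real_of_int m\<bar> + \<bar>real_of_int n\<bar>"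
    have "\<bar>m\<bar> + \<bar>n\<bar> \<ge> 1" using p mn by auto
    hence one: "\<bar>real_of_int m\<bar> + \<bar>real_of_int n\<bar> \<ge> 1" by linarith
    have "\<kappa> / 2 * S \<le> \<kappa> * (\<bar>real_of_int m\<bar> + \<bar>real_of_int n\<bar>)"
      using mult_left_mono[OF one, of \<kappa>] \<kappa>(1) by (simp add: S_def algebra_simps)
    also have "\<dots> \<le> norm (v p)" using \<kappa>(2)[of "of_int m" "of_int n"] by (simp add: v_def mn)
    finally have le: "\<kappa> / 2 * S \<le> norm (v p)" .
    have pos: "x > 0" "y > 0" "S > 0" by (auto simp: x_def y_def S_def)
    have "x powr (3/2) * y powr (3/2) \<le> S powr (3/2) * S powr (3/2)"
      using pos by (intro mult_mono powr_mono2) (auto simp: x_def y_def S_def)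
    also have "\<dots> = S powr 3" by (subst powr_add[symmetric]) simp
    also have "\<dots> = S ^ 3" using pos by simp
    finally have S3: "x powr (3/2) * y powr (3/2) \<le> S ^ 3" .
    have "1 / norm (v p) ^ 3 \<le> 1 / (\<kappa> / 2 * S) ^ 3"
      using le pos \<kappa>(1) less_le_trans[OF _ le, of 0]
      by (intro divide_left_mono power_mono mult_pos_pos zero_less_power) auto
    also have "\<dots> = (2 / \<kappa>) ^ 3 * (1 / S ^ 3)" using \<kappa>(1) by (simp add: power_mult_distrib power_divide)
    also have "\<dots> \<le> (2 / \<kappa>) ^ 3 * (1 / (x powr (3/2) * y powr (3/2)))"
      using S3 pos \<kappa>(1) by (intro mult_left_mono divide_left_mono) auto
    also have "\<dots> = (2 / \<kappa>) ^ 3 * (u (fst p) * u (snd p))"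
      by (simp add: u_def mn x_def y_def powr_minus field_simps)
    finally show "1 / norm (v p) ^ 3 \<le> (2 / \<kappa>) ^ 3 * (u (fst p) * u (snd p))" .
  qed auto
  moreover have "int_span2 a b - {0} = v ` (- {(0, 0)})"
  proof -
    have "int_span2 a b = range v" by (auto simp: int_span2_def v_def)
    moreover have "v (0, 0) = 0" by (simp add: v_def)
    ultimately show ?thesis using image_set_diff[OF inj, of UNIV "{(0, 0)}"]
      by (simp add: Compl_eq_Diff_UNIV)
  qed
  moreover have "inj_on v (- {(0, 0)})" using inj by (rule inj_on_subset) auto
  ultimately show ?thesis by (simp add: summable_on_reindex o_def)
qed

section \<open>The Weierstrass zeta function\<close>

lemma higher_deriv_sum:
  assumes "finite X" "\<And>w. w \<in> X \<Longrightarrow> f w holomorphic_on S" "open S" "z \<in> S"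
  shows "(deriv ^^ n) (\<lambda>z. \<Sum>w\<in>X. f w z) z = (\<Sum>w\<in>X. (deriv ^^ n) (f w) z)"
  using assms
proof (induction X rule: finite_induct)
  case (insert x X)
  have "(deriv ^^ n) (\<lambda>z. f x z + (\<Sum>w\<in>X. f w z)) z =
          (deriv ^^ n) (f x) z + (deriv ^^ n) (\<lambda>z. \<Sum>w\<in>X. f w z) z"
    using insert by (intro higher_deriv_add) (auto intro!: holomorphic_intros)
  thus ?case using insert by simp
qed auto

locale lattice =
  fixes \<omega>1 \<omega>3 :: complex
  assumes ratio: "Im (\<omega>3 / \<omega>1) \<noteq> 0"
begin

abbreviation L where "L \<equiv> int_span2 (2 * \<omega>1) (2 * \<omega>3)"
abbreviation H where "H \<equiv> int_span2 \<omega>1 \<omega>3"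

lemma ratio2: "Im ((2 * \<omega>3) / (2 * \<omega>1)) \<noteq> 0"
  using ratio by simp

definition zterm :: "complex \<Rightarrow> complex \<Rightarrow> complex" where
  "zterm z w = 1 / (z - w) + 1 / w + z / w\<^sup>2"

text \<open>The pole at 0 is split off, so this part is holomorphic at 0 too. Its translates
  describe zeta near every lattice point up to a constant, which gives the principal parts and, at
  the ends of the integration path, the regular part of the logarithmic derivative of the
  kernel.\<close>

definition zeta_reg :: "complex \<Rightarrow> complex" where
  "zeta_reg z = (\<Sum>\<^sub>\<infinity>w\<in>L - {0}. zterm z w)"

definition wzeta :: "complex \<Rightarrow> complex" where
  "wzeta z = 1 / z + zeta_reg z"

text \<open>The two counterterms cancel the expansion of 1 / (z - w) up to second order in 1 / w;
  what remains is of order |w|^(-3), hence summable over the lattice.\<close>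

lemma zterm_altdef: "w \<noteq> 0 \<Longrightarrow> z \<noteq> w \<Longrightarrow> zterm z w = z\<^sup>2 / (w\<^sup>2 * (z - w))"
  unfolding zterm_def by (simp add: divide_simps) (simp add: algebra_simps power2_eq_square)

lemma zterm_uniform_limit:
  assumes z0: "z0 \<notin> L - {0}"
  obtains r where "r > 0" "cball z0 r \<inter> (L - {0}) = {}"
    "uniform_limit (cball z0 r) (\<lambda>X z. \<Sum>w\<in>X. zterm z w) zeta_reg (finite_subsets_at_top (L - {0}))"
proof -
  obtain e where e: "e > 0" "L \<inter> ball z0 e \<subseteq> {z0}"
    using int_span2_isolated[OF ratio2] by blast
  define r where "r = e / 2"
  define R where "R = norm z0 + r"
  have r: "r > 0" "cball z0 r \<subseteq> ball z0 e" using e by (auto simp: r_def)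
  have far: "norm (z - w) \<ge> r" if "z \<in> cball z0 r" "w \<in> L - {0}" for z w
  proof -
    have "w \<noteq> z0" using that z0 by auto
    hence "w \<notin> ball z0 e" using e that by auto
    hence "2 * r \<le> norm (z0 - w)" by (simp add: r_def dist_norm)
    also have "\<dots> \<le> norm (z - w) + norm (z0 - z)"
      using norm_triangle_ineq[of "z - w" "z0 - z"] by simp
    also have "norm (z0 - z) \<le> r" using that by (simp add: dist_norm)
    finally show ?thesis by simp
  qed
  \<comment> \<open>The first summand of the constant majorises the terms with |w| \<le> 2 R, where
    only |z - w| \<ge> r is known; the second one the remaining terms, where |z - w| \<ge> |w| /
    2.\<close>
  define M where "M = (\<lambda>w::complex. (2 * R ^ 3 / r + 2 * R\<^sup>2) * (1 / norm w ^ 3))"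
  have "norm (zterm z w) \<le> M w" if z: "z \<in> cball z0 r" and w: "w \<in> L - {0}" for z w
  proof -
    have w0: "w \<noteq> 0" "norm w > 0" using w by auto
    have R: "norm z \<le> R" "R > 0"
      using z r norm_triangle_ineq2[of z z0]
      by (auto simp: R_def dist_norm norm_minus_commute intro: add_nonneg_pos)
    have zw: "norm (z - w) \<ge> r" using far[OF z w] .
    hence "z \<noteq> w" using r by auto
    hence "norm (zterm z w) = (norm z)\<^sup>2 / ((norm w)\<^sup>2 * norm (z - w))"
      using w0 by (simp add: zterm_altdef norm_divide norm_mult norm_power)
    also have "\<dots> \<le> R\<^sup>2 / ((norm w)\<^sup>2 * norm (z - w))"
      using R by (intro divide_right_mono power_mono) auto
    also have "\<dots> \<le> M w"
    proof (cases "norm w \<le> 2 * R")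
      case True
      have "R\<^sup>2 / ((norm w)\<^sup>2 * norm (z - w)) \<le> R\<^sup>2 / ((norm w)\<^sup>2 * r)"
        using zw w0 r R by (intro divide_left_mono mult_left_mono mult_pos_pos) auto
      also have "\<dots> = R\<^sup>2 * norm w / (r * norm w ^ 3)"
        using w0 r by (simp add: field_simps power2_eq_square power3_eq_cube)
      also have "\<dots> \<le> R\<^sup>2 * (2 * R) / (r * norm w ^ 3)"
        using True r by (intro divide_right_mono mult_left_mono) auto
      also have "\<dots> = 2 * R ^ 3 / r * (1 / norm w ^ 3)"
        by (simp add: power2_eq_square power3_eq_cube)
      also have "\<dots> \<le> M w"
        unfolding M_def using R by (intro mult_right_mono) auto
      finally show ?thesis .
    next
      case False
      have "norm w / 2 \<le> norm (z - w)"
        using False R norm_triangle_ineq2[of w z] by (simp add: norm_minus_commute)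
      hence "R\<^sup>2 / ((norm w)\<^sup>2 * norm (z - w)) \<le> R\<^sup>2 / ((norm w)\<^sup>2 * (norm w / 2))"
        using w0 by (intro divide_left_mono mult_left_mono mult_pos_pos) auto
      also have "\<dots> = 2 * R\<^sup>2 * (1 / norm w ^ 3)"
        using w0 by (simp add: power2_eq_square power3_eq_cube)
      also have "\<dots> \<le> M w"
        unfolding M_def using R r by (intro mult_right_mono) auto
      finally show ?thesis .
    qed
    finally show ?thesis .
  qed
  moreover have "M summable_on (L - {0})"
    unfolding M_def by (intro summable_on_cmult_right summable_on_int_span2_cubes ratio2)
  ultimately have "uniform_limit (cball z0 r) (\<lambda>X z. \<Sum>w\<in>X. zterm z w) zeta_reg (finite_subsets_at_top (L - {0}))"
    unfolding zeta_reg_def by (intro Weierstrass_m_test_general) auto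
  moreover have "cball z0 r \<inter> (L - {0}) = {}"
    using far r by fastforce
  ultimately show ?thesis using r by (intro that[of r])
qed

lemma zterm_holomorphic: "w \<notin> S \<Longrightarrow> (\<lambda>z. zterm z w) holomorphic_on S"
  unfolding zterm_def by (cases "w = 0") (auto intro!: holomorphic_intros)

lemma zeta_reg_holomorphic: "zeta_reg holomorphic_on (- (L - {0}))"
proof -
  have "zeta_reg field_differentiable (at z0)" if z0: "z0 \<notin> L - {0}" for z0
  proof -
    obtain r where r: "r > 0" "cball z0 r \<inter> (L - {0}) = {}"
      "uniform_limit (cball z0 r) (\<lambda>X z. \<Sum>w\<in>X. zterm z w) zeta_reg (finite_subsets_at_top (L - {0}))"
      using zterm_uniform_limit[OF z0] by blast
    have "\<forall>\<^sub>F X in finite_subsets_at_top (L - {0}).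
            continuous_on (cball z0 r) (\<lambda>z. \<Sum>w\<in>X. zterm z w) \<and>
            (\<lambda>z. \<Sum>w\<in>X. zterm z w) holomorphic_on ball z0 r"
    proof (rule eventually_finite_subsets_at_top_weakI)
      fix X assume X: "X \<subseteq> L - {0}"
      have "(\<lambda>z. \<Sum>w\<in>X. zterm z w) holomorphic_on cball z0 r"
        using r(2) X by (intro holomorphic_intros zterm_holomorphic) auto
      thus "continuous_on (cball z0 r) (\<lambda>z. \<Sum>w\<in>X. zterm z w) \<and>
            (\<lambda>z. \<Sum>w\<in>X. zterm z w) holomorphic_on ball z0 r"
        by (auto intro: holomorphic_on_imp_continuous_on holomorphic_on_subset)
    qed
    hence "zeta_reg holomorphic_on ball z0 r"
      using holomorphic_uniform_limit[OF _ r(3)] by auto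
    thus ?thesis using r(1) by (auto intro: holomorphic_on_imp_differentiable_at)
  qed
  thus ?thesis by (auto simp: holomorphic_on_def intro: field_differentiable_at_within)
qed

lemma zeta_reg_higher_deriv_has_sum:
  assumes "z \<notin> L - {0}"
  shows "((\<lambda>w. (deriv ^^ m) (\<lambda>z. zterm z w) z) has_sum (deriv ^^ m) zeta_reg z) (L - {0})"
proof -
  obtain r where r: "r > 0" "cball z r \<inter> (L - {0}) = {}"
      "uniform_limit (cball z r) (\<lambda>X z. \<Sum>w\<in>X. zterm z w) zeta_reg (finite_subsets_at_top (L - {0}))"
    using zterm_uniform_limit[OF assms] by blast
  have hol: "(\<lambda>z. zterm z w) holomorphic_on ball z r" if "w \<in> L - {0}" for w
    using r(2) that by (intro zterm_holomorphic) force
  have "((\<lambda>X. (deriv ^^ m) (\<lambda>z. \<Sum>w\<in>X. zterm z w) z) \<longlongrightarrow> (deriv ^^ m) zeta_reg z)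
          (finite_subsets_at_top (L - {0}))"
  proof (rule higher_deriv_complex_uniform_limit)
    show "uniform_limit (ball z r) (\<lambda>X z. \<Sum>w\<in>X. zterm z w) zeta_reg (finite_subsets_at_top (L - {0}))"
      using r(3) by (rule uniform_limit_on_subset) auto
    show "\<forall>\<^sub>F X in finite_subsets_at_top (L - {0}). (\<lambda>z. \<Sum>w\<in>X. zterm z w) holomorphic_on ball z r"
      using hol by (intro eventually_finite_subsets_at_top_weakI holomorphic_intros) auto
  qed (use r in auto)
  moreover have "\<forall>\<^sub>F X in finite_subsets_at_top (L - {0}).
      (deriv ^^ m) (\<lambda>z. \<Sum>w\<in>X. zterm z w) z = (\<Sum>w\<in>X. (deriv ^^ m) (\<lambda>z. zterm z w) z)"
    using hol r(1)
    by (intro eventually_finite_subsets_at_top_weakI higher_deriv_sum[of _ _ "ball z r"]) auto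
  ultimately show ?thesis
    unfolding has_sum_def by (rule Lim_transform_eventually)
qed

lemma zterm_deriv:
  assumes "w \<noteq> 0" "z \<noteq> w"
  shows "((\<lambda>z. zterm z w) has_field_derivative (1 / w\<^sup>2 - 1 / (z - w)\<^sup>2)) (at z)"
  unfolding zterm_def using assms
  by (auto intro!: derivative_eq_intros simp: power2_eq_square)

lemma DERIV_inverse_square:
  fixes z w :: complex
  assumes "z \<noteq> w"
  shows "((\<lambda>z. 1 / (z - w)\<^sup>2) has_field_derivative - 2 / (z - w) ^ 3) (at z)"
proof -
  have nz: "z - w \<noteq> 0" using assms by simp
  have "((\<lambda>z. 1 / (z - w)\<^sup>2) has_field_derivative (- (2 * (z - w))) / ((z - w)\<^sup>2 * (z - w)\<^sup>2)) (at z)"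
    using nz by (auto intro!: derivative_eq_intros)
  also have "(- (2 * (z - w))) / ((z - w)\<^sup>2 * (z - w)\<^sup>2) = - 2 / (z - w) ^ 3"
  proof -
    have "(- (2 * u)) / (u\<^sup>2 * u\<^sup>2) = - 2 / u ^ 3" if "u \<noteq> 0" for u :: complex
      using that by (simp add: divide_simps power2_eq_square power3_eq_cube)
    from this[OF nz] show ?thesis .
  qed
  finally show ?thesis .
qed

lemma zterm_deriv2:
  assumes "w \<noteq> 0" "z \<noteq> w"
  shows "(deriv ^^ 2) (\<lambda>z. zterm z w) z = 2 / (z - w) ^ 3"
proof -
  have "deriv (deriv (\<lambda>z. zterm z w)) z = deriv (\<lambda>z. 1 / w\<^sup>2 - 1 / (z - w)\<^sup>2) z"
  proof (rule deriv_cong_ev)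
    have "\<forall>\<^sub>F x in nhds z. x \<in> - {w}"
      using assms by (intro eventually_nhds_in_open) auto
    thus "\<forall>\<^sub>F x in nhds z. deriv (\<lambda>z. zterm z w) x = 1 / w\<^sup>2 - 1 / (x - w)\<^sup>2"
      by eventually_elim (use assms in \<open>auto intro!: DERIV_imp_deriv zterm_deriv\<close>)
  qed simp
  also have "\<dots> = 2 / (z - w) ^ 3"
  proof (rule DERIV_imp_deriv)
    have "((\<lambda>z. 1 / w\<^sup>2 - 1 / (z - w)\<^sup>2) has_field_derivative 0 - (- 2 / (z - w) ^ 3)) (at z)"
      by (intro derivative_intros DERIV_inverse_square assms)
    thus "((\<lambda>z. 1 / w\<^sup>2 - 1 / (z - w)\<^sup>2) has_field_derivative 2 / (z - w) ^ 3) (at z)" by simp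
  qed
  finally show ?thesis by (simp add: numeral_2_eq_2)
qed

abbreviation wp :: "complex \<Rightarrow> complex" where "wp \<equiv> weierstrass_p \<omega>1 \<omega>3"

lemma open_compl_L0: "open (- (L - {0}))"
proof -
  have "\<exists>e>0. ball z e \<subseteq> - (L - {0})" if "z \<notin> L - {0}" for z
  proof -
    obtain e where "e > 0" "L \<inter> ball z e \<subseteq> {z}"
      using int_span2_isolated[OF ratio2] by blast
    thus ?thesis using that by (intro exI[of _ e]) auto
  qed
  thus ?thesis by (auto simp: open_contains_ball)
qed

text \<open>Differentiating term by term produces, up to sign, exactly the series in the definition
  of \<open>weierstrass_p\<close>. Analyticity of the p-function is thereby inherited from
  zeta.\<close>

lemma zeta_reg_deriv:
  assumes "z \<in> - (L - {0})"
  shows "(zeta_reg has_field_derivative - (\<Sum>\<^sub>\<infinity>w\<in>L - {0}. 1 / (z - w)\<^sup>2 - 1 / w\<^sup>2)) (at z)"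
proof -
  have "((\<lambda>w. (deriv ^^ 1) (\<lambda>z. zterm z w) z) has_sum (deriv ^^ 1) zeta_reg z) (L - {0})"
    using assms by (intro zeta_reg_higher_deriv_has_sum) auto
  also have "?this \<longleftrightarrow> ((\<lambda>w. - (1 / (z - w)\<^sup>2 - 1 / w\<^sup>2)) has_sum (deriv ^^ 1) zeta_reg z) (L - {0})"
  proof (rule has_sum_cong)
    fix w assume "w \<in> L - {0}"
    with assms have "w \<noteq> 0" "z \<noteq> w" by auto
    from DERIV_imp_deriv[OF zterm_deriv[OF this]]
    show "(deriv ^^ 1) (\<lambda>z. zterm z w) z = - (1 / (z - w)\<^sup>2 - 1 / w\<^sup>2)" by simp
  qed
  finally have "deriv zeta_reg z = (\<Sum>\<^sub>\<infinity>w\<in>L - {0}. - (1 / (z - w)\<^sup>2 - 1 / w\<^sup>2))"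
    using infsumI by fastforce
  also have "\<dots> = - (\<Sum>\<^sub>\<infinity>w\<in>L - {0}. 1 / (z - w)\<^sup>2 - 1 / w\<^sup>2)" by (rule infsum_uminus)
  finally show ?thesis
    using holomorphic_derivI[OF zeta_reg_holomorphic open_compl_L0 assms] by simp
qed

lemma wzeta_deriv [derivative_intros]:
  assumes "z \<notin> L"
  shows "(wzeta has_field_derivative - wp z) (at z)"
proof -
  have "z \<noteq> 0" using assms by auto
  thus ?thesis unfolding wzeta_def weierstrass_p_def using assms
    by (auto intro!: derivative_eq_intros zeta_reg_deriv simp: power2_eq_square)
qed

lemma open_compl_L: "open (- L)"
proof -
  have "- L = - (L - {0}) - {0}" by auto
  thus ?thesis using open_delete[OF open_compl_L0, of 0] by (simp only:)
qed

section \<open>Parity, periods and quasi-periods\<close>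

lemma zeta_reg_odd: "zeta_reg (- z) = - zeta_reg z"
proof -
  have "zeta_reg (- z) = (\<Sum>\<^sub>\<infinity>w\<in>L - {0}. - zterm z w)"
    unfolding zeta_reg_def
  proof (rule infsum_reindex_bij_witness[of _ uminus uminus])
    fix w :: complex
    have "1 / (- z - w) = - (1 / (z + w))"
      by (subst minus_divide_right) simp
    thus "- zterm z (- w) = zterm (- z) w"
      by (simp add: zterm_def)
  qed auto
  thus ?thesis by (simp add: zeta_reg_def infsum_uminus)
qed

lemma wzeta_odd: "wzeta (- z) = - wzeta z"
  by (simp add: wzeta_def zeta_reg_odd)

lemma wp_even:
  assumes "z \<notin> L"
  shows "wp (- z) = wp z"
proof -
  have "((\<lambda>z. - wzeta (- z)) has_field_derivative - wp (- z)) (at z)"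
    using assms by (auto intro!: derivative_eq_intros DERIV_chain'[OF _ wzeta_deriv])
  hence "(wzeta has_field_derivative - wp (- z)) (at z)" by (simp add: wzeta_odd)
  from DERIV_unique[OF this wzeta_deriv[OF assms]] show ?thesis by simp
qed

lemma wp_holomorphic: "wp holomorphic_on - L"
proof -
  have "deriv wzeta holomorphic_on - L"
    by (intro holomorphic_deriv open_compl_L)
       (auto simp: holomorphic_on_open[OF open_compl_L] intro: wzeta_deriv)
  hence "(\<lambda>z. - deriv wzeta z) holomorphic_on - L" by (rule holomorphic_on_minus)
  thus ?thesis
    by (rule holomorphic_transform) (auto simp: DERIV_imp_deriv[OF wzeta_deriv])
qed

text \<open>After two differentiations the counterterms are gone and the lattice point 0 is a term
  like any other. The sum over all of L can be reindexed by a translation, which is the source of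
  all periodicity.\<close>

lemma wzeta_deriv2_has_sum:
  assumes "z \<notin> L"
  shows "((\<lambda>w. 2 / (z - w) ^ 3) has_sum (- deriv wp z)) L"
proof -
  have z0: "z \<noteq> 0" using assms by auto
  have "((\<lambda>w. (deriv ^^ 2) (\<lambda>z. zterm z w) z) has_sum (deriv ^^ 2) zeta_reg z) (L - {0})"
    using assms by (intro zeta_reg_higher_deriv_has_sum) auto
  also have "?this \<longleftrightarrow> ((\<lambda>w. 2 / (z - w) ^ 3) has_sum (deriv ^^ 2) zeta_reg z) (L - {0})"
    using assms by (intro has_sum_cong zterm_deriv2) auto
  finally have "((\<lambda>w. 2 / (z - w) ^ 3) has_sum (2 / (z - 0) ^ 3 + (deriv ^^ 2) zeta_reg z)) (insert 0 (L - {0}))"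
    by (intro has_sum_insert) auto
  moreover have "insert 0 (L - {0}) = L" by auto
  moreover have "2 / (z - 0) ^ 3 + (deriv ^^ 2) zeta_reg z = - deriv wp z"
  proof -
    have "\<forall>\<^sub>F x in nhds z. x \<in> - L"
      using assms by (intro eventually_nhds_in_open open_compl_L) auto
    hence "\<forall>\<^sub>F x in nhds z. wp x = 1 / x\<^sup>2 - deriv zeta_reg x"
      by eventually_elim (auto simp: weierstrass_p_def DERIV_imp_deriv[OF zeta_reg_deriv])
    hence "deriv wp z = deriv (\<lambda>x. 1 / x\<^sup>2 - deriv zeta_reg x) z"
      by (rule deriv_cong_ev) simp
    also have "\<dots> = - 2 / z ^ 3 - deriv (deriv zeta_reg) z"
    proof (rule DERIV_imp_deriv)
      have "(deriv zeta_reg has_field_derivative deriv (deriv zeta_reg) z) (at z)"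
        using assms zeta_reg_holomorphic open_compl_L0
        by (intro holomorphic_derivI[of _ "- (L - {0})"] holomorphic_deriv) auto
      thus "((\<lambda>x. 1 / x\<^sup>2 - deriv zeta_reg x) has_field_derivative - 2 / z ^ 3 - deriv (deriv zeta_reg) z) (at z)"
        using DERIV_diff[OF DERIV_inverse_square[of z 0]] z0 by simp
    qed
    finally show ?thesis by (simp add: numeral_2_eq_2)
  qed
  ultimately show ?thesis by simp
qed

lemma deriv_wp_periodic:
  assumes "a \<in> L" "z \<notin> L"
  shows "deriv wp (z + a) = deriv wp z"
proof -
  have za: "z + a \<notin> L" using assms by (simp add: int_span2_add_iff)
  have "((\<lambda>w. 2 / (z - w) ^ 3) has_sum (- deriv wp z)) L \<longleftrightarrow>
        ((\<lambda>w. 2 / (z + a - w) ^ 3) has_sum (- deriv wp z)) L"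
    using assms(1)
    by (intro has_sum_reindex_bij_witness[of _ "\<lambda>w. w - a" "\<lambda>w. w + a"]) auto
  with wzeta_deriv2_has_sum[OF assms(2)] wzeta_deriv2_has_sum[OF za]
  show ?thesis by (metis has_sum_unique neg_equal_iff_equal)
qed

lemma connected_compl_L: "connected (- L)"
  using connected_open_diff_countable[of "UNIV :: complex set" L] countable_int_span2
  by (simp add: Compl_eq_Diff_UNIV connected_UNIV)

lemma const_on_compl_L:
  assumes "\<And>z. z \<notin> L \<Longrightarrow> (f has_field_derivative 0) (at z)" "u \<notin> L" "v \<notin> L"
  shows "f u = f v"
proof -
  have "f constant_on - L"
    using assms(1) by (intro has_field_derivative_0_imp_constant_on connected_compl_L open_compl_L) auto
  thus ?thesis using assms(2,3) by (auto simp: constant_on_def)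
qed

lemma gens_not_in_L: "\<omega>1 \<notin> L" "\<omega>3 \<notin> L"
proof -
  show "\<omega>1 \<notin> L"
  proof
    assume "\<omega>1 \<in> L"
    then obtain m n :: int where "\<omega>1 = of_int m * (2 * \<omega>1) + of_int n * (2 * \<omega>3)"
      by (auto simp: int_span2_def)
    hence "of_real 1 * \<omega>1 + of_real 0 * \<omega>3 =
           of_real (2 * of_int m) * \<omega>1 + of_real (2 * of_int n) * \<omega>3"
      by (simp add: algebra_simps)
    from real_span_cong(1)[OF ratio this] have "1 = 2 * m" by linarith
    thus False by presburger
  qed
  show "\<omega>3 \<notin> L"
  proof
    assume "\<omega>3 \<in> L"
    then obtain m n :: int where "\<omega>3 = of_int m * (2 * \<omega>1) + of_int n * (2 * \<omega>3)"
      by (auto simp: int_span2_def)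
    hence "of_real 0 * \<omega>1 + of_real 1 * \<omega>3 =
           of_real (2 * of_int m) * \<omega>1 + of_real (2 * of_int n) * \<omega>3"
      by (simp add: algebra_simps)
    from real_span_cong(2)[OF ratio this] have "1 = 2 * n" by linarith
    thus False by presburger
  qed
qed

text \<open>Periodicity of the derivative leaves a constant difference. At z = -b it is wp b - wp
  (-b), which vanishes by evenness, provided that b itself is not a pole.\<close>

lemma wp_add_double:
  assumes "b \<notin> L" "2 * b \<in> L" "z \<notin> L"
  shows "wp (z + 2 * b) = wp z"
proof -
  have "wp (z + 2 * b) - wp z = wp (- b + 2 * b) - wp (- b)"
  proof (rule const_on_compl_L[of "\<lambda>z. wp (z + 2 * b) - wp z"])
    fix z assume z: "z \<notin> L"
    hence z': "z + 2 * b \<notin> L" using assms by (simp add: int_span2_add_iff)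
    have "((\<lambda>z. wp (z + 2 * b) - wp z) has_field_derivative (deriv wp (z + 2 * b) * (1 + 0) - deriv wp z)) (at z)"
      using z z' wp_holomorphic open_compl_L
      by (intro derivative_intros DERIV_chain2[of wp] holomorphic_derivI[of _ "- L"]) auto
    thus "((\<lambda>z. wp (z + 2 * b) - wp z) has_field_derivative 0) (at z)"
      using deriv_wp_periodic[OF assms(2) z] by simp
  qed (use assms in auto)
  also have "\<dots> = 0" using wp_even[OF assms(1)] by simp
  finally show ?thesis by simp
qed

lemma wp_periodic:
  assumes "a \<in> L" "z \<notin> L"
  shows "wp (z + a) = wp z"
proof -
  have "wp (z + of_int m * (2 * b)) = wp z" if "b \<notin> L" "2 * b \<in> L" "z \<notin> L" for b m z
    using that(3)
  proof (induction m arbitrary: z rule: int_induct[where k = 0])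
    case (step1 i)
    have "z + 2 * b \<notin> L" using step1 that by (simp add: int_span2_add_iff)
    from step1(2)[OF this] wp_add_double[OF that(1,2) step1(3)] show ?case
      by (simp add: algebra_simps)
  next
    case (step2 i)
    have "z - 2 * b \<notin> L" using step2 that by (simp add: int_span2_diff_iff)
    from step2(2)[OF this] wp_add_double[OF that(1,2) this] show ?case
      by (simp add: algebra_simps)
  qed auto
  note per = this
  obtain m n :: int where a: "a = of_int m * (2 * \<omega>1) + of_int n * (2 * \<omega>3)"
    using assms by (auto simp: int_span2_def)
  have n: "of_int n * (2 * \<omega>3) \<in> L"
    unfolding int_span2_def by (rule CollectI, rule exI[of _ 0], rule exI[of _ n]) simp
  have "wp (z + of_int n * (2 * \<omega>3) + of_int m * (2 * \<omega>1)) = wp (z + of_int n * (2 * \<omega>3))"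
    using assms n gens_not_in_L by (intro per) (auto simp: int_span2_add_iff)
  also have "\<dots> = wp z" using assms gens_not_in_L by (intro per) auto
  finally show ?thesis by (simp add: a algebra_simps)
qed

text \<open>The quasi-period of zeta belonging to the lattice vector a. The base point \<omega>1
  serves as a point known to lie off the lattice; by \<open>wzeta_add\<close> every other such point
  gives the same value.\<close>

definition eta :: "complex \<Rightarrow> complex" where
  "eta a = wzeta (\<omega>1 + a) - wzeta \<omega>1"

lemma wzeta_add:
  assumes "a \<in> L" "z \<notin> L"
  shows "wzeta (z + a) = wzeta z + eta a"
proof -
  have "wzeta (z + a) - wzeta z = wzeta (\<omega>1 + a) - wzeta \<omega>1"
  proof (rule const_on_compl_L[of "\<lambda>z. wzeta (z + a) - wzeta z"])
    fix z assume z: "z \<notin> L"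
    hence z': "z + a \<notin> L" using assms by (simp add: int_span2_add_iff)
    have "((\<lambda>z. wzeta (z + a) - wzeta z) has_field_derivative (- wp (z + a) * (1 + 0) - (- wp z))) (at z)"
      using z z' by (intro derivative_intros DERIV_chain2[of wzeta]) auto
    thus "((\<lambda>z. wzeta (z + a) - wzeta z) has_field_derivative 0) (at z)"
      using wp_periodic[OF assms(1) z] by simp
  qed (use assms gens_not_in_L in auto)
  thus ?thesis by (simp add: eta_def algebra_simps)
qed

lemma eta_add:
  assumes "a \<in> L" "b \<in> L"
  shows "eta (a + b) = eta a + eta b"
proof -
  have "wzeta (\<omega>1 + (a + b)) = wzeta \<omega>1 + eta (a + b)"
    using assms gens_not_in_L by (intro wzeta_add) auto
  moreover have "wzeta (\<omega>1 + a + b) = wzeta \<omega>1 + eta a + eta b"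
    using assms gens_not_in_L by (simp add: wzeta_add int_span2_add_iff)
  ultimately show ?thesis by (simp add: add.assoc)
qed

lemma zeta_reg_isCont: "z \<notin> L - {0} \<Longrightarrow> isCont zeta_reg z"
  using zeta_reg_deriv DERIV_isCont by blast

lemma wzeta_residue:
  assumes "a \<in> L"
  shows "((\<lambda>z. wzeta z - 1 / (z - a)) \<longlongrightarrow> eta a + zeta_reg 0) (at a)"
proof -
  have "((\<lambda>z. eta a + zeta_reg (z - a)) \<longlongrightarrow> eta a + zeta_reg 0) (at a)"
  proof (intro tendsto_intros)
    have "isCont (\<lambda>z. zeta_reg (z - a)) a"
      by (rule isCont_o2[of _ _ zeta_reg]) (auto intro: zeta_reg_isCont)
    thus "((\<lambda>z. zeta_reg (z - a)) \<longlongrightarrow> zeta_reg 0) (at a)" by (simp add: isCont_def)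
  qed
  moreover have "\<forall>\<^sub>F z in at a. eta a + zeta_reg (z - a) = wzeta z - 1 / (z - a)"
  proof -
    obtain e where e: "e > 0" "L \<inter> ball a e \<subseteq> {a}" using int_span2_isolated[OF ratio2] by blast
    have "\<forall>\<^sub>F z in at a. z \<in> ball a e - {a}" using e by (intro eventually_at_in_open) auto
    thus ?thesis
    proof eventually_elim
      case (elim z)
      hence "z \<notin> L" using e by auto
      hence "z - a \<notin> L" using assms by (simp add: int_span2_diff_iff)
      from wzeta_add[OF assms this] show ?case by (simp add: wzeta_def)
    qed
  qed
  ultimately show ?thesis by (rule Lim_transform_eventually)
qed

end

context lattice
begin

section \<open>Elliptic functions\<close>

lemma real_coordinates:
  obtains s t :: real where "z = of_real s * (2 * \<omega>1) + of_real t * (2 * \<omega>3)"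
proof -
  define r where "r = \<omega>3 / \<omega>1"
  define w where "w = z / (2 * \<omega>1)"
  have nz: "\<omega>1 \<noteq> 0" using ratio by auto
  define t where "t = Im w / Im r"
  define s where "s = Re w - t * Re r"
  have "Im r \<noteq> 0" using ratio by (simp add: r_def)
  hence "w = of_real s + of_real t * r"
    by (simp add: complex_eq_iff s_def t_def)
  hence "w * (2 * \<omega>1) = of_real s * (2 * \<omega>1) + of_real t * (r * (2 * \<omega>1))"
    by (simp add: algebra_simps)
  moreover have "w * (2 * \<omega>1) = z" "r * (2 * \<omega>1) = 2 * \<omega>3" using nz by (simp_all add: w_def r_def)
  ultimately show ?thesis using that by metis
qed

lemma reduce_to_cell:
  obtains s t :: real and a where "s \<in> {0..1}" "t \<in> {0..1}" "a \<in> L"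
    "z = of_real s * (2 * \<omega>1) + of_real t * (2 * \<omega>3) + a"
proof -
  obtain s t :: real where st: "z = of_real s * (2 * \<omega>1) + of_real t * (2 * \<omega>3)"
    using real_coordinates .
  define a where "a = of_int \<lfloor>s\<rfloor> * (2 * \<omega>1) + of_int \<lfloor>t\<rfloor> * (2 * \<omega>3)"
  have "a \<in> L" unfolding a_def int_span2_def by blast
  moreover have "z = of_real (frac s) * (2 * \<omega>1) + of_real (frac t) * (2 * \<omega>3) + a"
    by (simp add: st a_def frac_def algebra_simps)
  moreover have "frac s \<in> {0..1}" "frac t \<in> {0..1}"
    using frac_lt_1[of s] frac_lt_1[of t] by auto
  ultimately show ?thesis using that by blast
qed

text \<open>Liouville's theorem: \<open>lim\<close> makes all singularities removable, and a bound
  on one closed cell spreads by translation. The exceptional set \<open>P\<close> is left general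
  because in the kernel identity it also contains the points congruent to y and -y.\<close>

lemma elliptic_const:
  assumes isol: "\<And>z. \<exists>e>0. P \<inter> ball z e \<subseteq> {z}"
    and hol: "f holomorphic_on - P"
    and perP: "\<And>z a. z \<notin> P \<Longrightarrow> a \<in> L \<Longrightarrow> z + a \<notin> P"
    and per: "\<And>z a. z \<notin> P \<Longrightarrow> a \<in> L \<Longrightarrow> f (z + a) = f z"
    and lim: "\<And>p. p \<in> P \<Longrightarrow> ((\<lambda>z. (z - p) * f z) \<longlongrightarrow> 0) (at p)"
    and uv: "u \<notin> P" "v \<notin> P"
  shows "f u = f v"
proof -
  have openP: "open (- P)"
  proof (rule openI)
    fix z assume "z \<in> - P"
    thus "\<exists>e>0. ball z e \<subseteq> - P" using isol[of z] by auto
  qed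
  define g where "g = (\<lambda>z. if z \<in> P then Lim (at z) f else f z)"
  have g_off: "g z = f z" if "z \<notin> P" for z using that by (simp add: g_def)
  have near: "\<forall>\<^sub>F z in at p. z \<notin> P" for p
  proof -
    obtain e where e: "e > 0" "P \<inter> ball p e \<subseteq> {p}" using isol by blast
    have "\<forall>\<^sub>F z in at p. z \<in> ball p e - {p}" using e by (intro eventually_at_in_open) auto
    thus ?thesis by eventually_elim (use e in auto)
  qed
  have g_diff: "g field_differentiable (at p)" for p
  proof (cases "p \<in> P")
    case False
    have "g holomorphic_on - P" using hol by (rule holomorphic_transform) (simp add: g_def)
    thus ?thesis using False openP by (auto intro: holomorphic_on_imp_differentiable_at)
  next
    case True
    obtain e where e: "e > 0" "P \<inter> ball p e \<subseteq> {p}" using isol by blast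
    have "f holomorphic_on (ball p e - {p})"
      using hol by (rule holomorphic_on_subset) (use e in auto)
    then obtain h where h: "h holomorphic_on ball p e" "\<And>z. z \<in> ball p e - {p} \<Longrightarrow> h z = f z"
      using holomorphic_on_extend_lim[of f "ball p e" p] lim[OF True] e(1) by auto
    have "isCont h p"
      using h(1) e(1) holomorphic_on_imp_continuous_on continuous_on_interior
      by (metis centre_in_ball interior_ball)
    hence "(h \<longlongrightarrow> h p) (at p)" by (simp add: isCont_def)
    moreover have "\<forall>\<^sub>F z in at p. h z = f z"
    proof -
      have "\<forall>\<^sub>F z in at p. z \<in> ball p e - {p}" using e by (intro eventually_at_in_open) auto
      thus ?thesis by eventually_elim (use h in auto)
    qed
    ultimately have "(f \<longlongrightarrow> h p) (at p)" by (rule Lim_transform_eventually)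
    hence "Lim (at p) f = h p" by (intro tendsto_Lim) auto
    hence "g z = h z" if "z \<in> ball p e" for z
      using h(2)[of z] that e True by (cases "z = p") (auto simp: g_def)
    hence "g holomorphic_on ball p e" using h(1) by (metis holomorphic_transform)
    thus ?thesis using e(1) by (auto intro: holomorphic_on_imp_differentiable_at)
  qed
  hence g_hol: "g holomorphic_on UNIV"
    by (auto simp: holomorphic_on_def intro: field_differentiable_at_within)
  define C where "C = (\<lambda>(s, t). of_real s * (2 * \<omega>1) + of_real t * (2 * \<omega>3)) ` ({0..1::real} \<times> {0..1::real})"
  have "compact C"
    unfolding C_def
    by (intro compact_continuous_image compact_Times) (auto simp: case_prod_unfold intro!: continuous_intros)
  moreover have "continuous_on C g"
    using g_hol holomorphic_on_imp_continuous_on continuous_on_subset by blast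
  ultimately have "bounded (g ` C)" by (intro compact_imp_bounded compact_continuous_image)
  then obtain B where B: "\<And>z. z \<in> C \<Longrightarrow> norm (g z) \<le> B" by (auto simp: bounded_iff)
  \<comment> \<open>Periodicity of \<open>f\<close> is available off \<open>P\<close> only, so the
    bound is obtained there first; it reaches the points of \<open>P\<close> by continuity of
    \<open>g\<close>.\<close>
  have bound_off: "norm (g z) \<le> B" if z: "z \<notin> P" for z
  proof -
    obtain s t :: real and a where st: "s \<in> {0..1}" "t \<in> {0..1}" "a \<in> L"
      "z = of_real s * (2 * \<omega>1) + of_real t * (2 * \<omega>3) + a" using reduce_to_cell .
    have "z + (- a) \<in> C" using st by (auto simp: C_def)
    moreover have "z + (- a) \<notin> P" "f (z + (- a)) = f z" using perP[OF z, of "- a"] per[OF z, of "- a"] st by auto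
    ultimately show ?thesis using B[of "z + (- a)"] z by (simp add: g_off)
  qed
  have "norm (g z) \<le> B" for z
  proof (rule Lim_norm_ubound)
    show "(g \<longlongrightarrow> g z) (at z)"
      using field_differentiable_imp_continuous_at[OF g_diff[of z]] by (simp add: isCont_def)
    show "\<forall>\<^sub>F w in at z. norm (g w) \<le> B"
      using near[of z] by eventually_elim (rule bound_off)
  qed auto
  hence "bounded (range g)" by (auto simp: bounded_iff)
  hence "g constant_on UNIV" using g_hol by (intro Liouville_theorem)
  hence "g u = g v" by (auto simp: constant_on_def)
  thus ?thesis using uv by (simp add: g_off)
qed

section \<open>Half-periods and principal parts of the shifted zeta and p-functions\<close>

abbreviation hp :: "nat \<Rightarrow> complex" where "hp \<equiv> half_period \<omega>1 \<omega>3"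

lemma int_mem_L_iff: "of_int m * \<omega>1 + of_int n * \<omega>3 \<in> L \<longleftrightarrow> even m \<and> even n"
proof
  assume "of_int m * \<omega>1 + of_int n * \<omega>3 \<in> L"
  then obtain m' n' :: int where
    "of_int m * \<omega>1 + of_int n * \<omega>3 = of_int m' * (2 * \<omega>1) + of_int n' * (2 * \<omega>3)"
    by (auto simp: int_span2_def)
  hence "of_real (of_int m) * \<omega>1 + of_real (of_int n) * \<omega>3 =
         of_real (2 * of_int m') * \<omega>1 + of_real (2 * of_int n') * \<omega>3"
    by (simp add: algebra_simps)
  from real_span_cong[OF ratio this] have "m = 2 * m'" "n = 2 * n'" by linarith+
  thus "even m \<and> even n" by simp
next
  assume "even m \<and> even n"
  then obtain m' n' where "m = 2 * m'" "n = 2 * n'" by (auto elim!: evenE)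
  hence "of_int m * \<omega>1 + of_int n * \<omega>3 = of_int m' * (2 * \<omega>1) + of_int n' * (2 * \<omega>3)" by simp
  thus "of_int m * \<omega>1 + of_int n * \<omega>3 \<in> L" unfolding int_span2_def by blast
qed

lemma L_subset_H: "L \<subseteq> H"
proof
  fix w assume "w \<in> L"
  then obtain m n :: int where "w = of_int m * (2 * \<omega>1) + of_int n * (2 * \<omega>3)"
    by (auto simp: int_span2_def)
  hence "w = of_int (2 * m) * \<omega>1 + of_int (2 * n) * \<omega>3" by simp
  thus "w \<in> H" unfolding int_span2_def by blast
qed

lemma double_mem_L_iff: "2 * w \<in> L \<longleftrightarrow> w \<in> H"
proof
  assume "2 * w \<in> L"
  then obtain m n :: int where "2 * w = of_int m * (2 * \<omega>1) + of_int n * (2 * \<omega>3)"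
    by (auto simp: int_span2_def)
  hence "2 * w = 2 * (of_int m * \<omega>1 + of_int n * \<omega>3)" by (simp add: algebra_simps)
  hence "w = of_int m * \<omega>1 + of_int n * \<omega>3" by (simp only: mult_cancel_left) simp
  thus "w \<in> H" unfolding int_span2_def by blast
next
  assume "w \<in> H"
  then obtain m n :: int where "w = of_int m * \<omega>1 + of_int n * \<omega>3"
    by (auto simp: int_span2_def)
  hence "2 * w = of_int m * (2 * \<omega>1) + of_int n * (2 * \<omega>3)" by (simp add: algebra_simps)
  thus "2 * w \<in> L" unfolding int_span2_def by blast
qed

lemma hp_in_H: "hp i \<in> H"
  using int_span2_gen1[of \<omega>1 \<omega>3] int_span2_gen2[of \<omega>3 \<omega>1]
  by (auto simp: half_period_def)

lemma double_hp_in_L: "2 * hp i \<in> L"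
  by (simp add: double_mem_L_iff hp_in_H)

lemma add_hp_not_L: "z \<notin> H \<Longrightarrow> z + hp i \<notin> L" "z \<notin> H \<Longrightarrow> z - hp i \<notin> L"
  using L_subset_H hp_in_H[of i] int_span2_add_iff[of "hp i" \<omega>1 \<omega>3 z] int_span2_diff_iff[of "hp i" \<omega>1 \<omega>3 z]
  by blast+

lemma diff_hp_in_L_iff: "z - hp i \<in> L \<longleftrightarrow> z + hp i \<in> L"
  using int_span2_diff_iff[OF double_hp_in_L[of i], of "z + hp i"] by simp

text \<open>The four half-periods represent H modulo L, a Klein four-group; the parities of the two
  coordinates decide the class. Consequently a pole at p is contributed by exactly one of four
  shifted functions.\<close>

lemma half_period_class:
  assumes "p \<in> H"
  obtains i where "i \<in> {0..3}" "\<And>j. j \<in> {0..3} \<Longrightarrow> p + hp j \<in> L \<longleftrightarrow> j = i"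
proof -
  obtain m n :: int where p: "p = of_int m * \<omega>1 + of_int n * \<omega>3"
    using assms by (auto simp: int_span2_def)
  have 0: "p + hp 0 \<in> L \<longleftrightarrow> even m \<and> even n"
    using int_mem_L_iff[of m n] by (simp add: p half_period_def)
  have 1: "p + hp 1 \<in> L \<longleftrightarrow> odd m \<and> even n"
    using int_mem_L_iff[of "m + 1" n] by (simp add: p half_period_def algebra_simps)
  have 2: "p + hp 2 \<in> L \<longleftrightarrow> odd m \<and> odd n"
    using int_mem_L_iff[of "m - 1" "n - 1"] by (simp add: p half_period_def algebra_simps)
  have 3: "p + hp 3 \<in> L \<longleftrightarrow> even m \<and> odd n"
    using int_mem_L_iff[of m "n + 1"] by (simp add: p half_period_def algebra_simps)
  define i :: nat where "i = (if even m then if even n then 0 else 3 else if even n then 1 else 2)"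
  show ?thesis
  proof (rule that[of i])
    fix j :: nat assume "j \<in> {0..3}"
    hence "j = 0 \<or> j = 1 \<or> j = 2 \<or> j = 3" by auto
    thus "p + hp j \<in> L \<longleftrightarrow> j = i" using 0 1 2 3 by (auto simp: i_def)
  qed (auto simp: i_def)
qed

lemma H_isolated: "\<exists>e>0. H \<inter> ball z e \<subseteq> {z}"
  using int_span2_isolated[OF ratio, of z] by blast

text \<open>Symmetrised, so that \<open>Z i\<close> is odd without a normalising constant.\<close>

definition Z :: "nat \<Rightarrow> complex \<Rightarrow> complex" where
  "Z i z = (wzeta (z + hp i) + wzeta (z - hp i)) / 2"

lemma Z_odd: "Z i (- z) = - Z i z"
proof -
  have "wzeta (- z + hp i) = - wzeta (z - hp i)" "wzeta (- z - hp i) = - wzeta (z + hp i)"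
    using wzeta_odd[of "z - hp i"] wzeta_odd[of "z + hp i"] by (simp_all add: algebra_simps)
  thus ?thesis by (simp add: Z_def field_simps)
qed

lemma wp_diff_hp: "z + hp i \<notin> L \<Longrightarrow> wp (z - hp i) = wp (z + hp i)"
  using wp_periodic[OF double_hp_in_L[of i], of "z - hp i"] by (simp add: diff_hp_in_L_iff add.commute)

lemma Z_deriv:
  assumes "z + hp i \<notin> L"
  shows "(Z i has_field_derivative - wp (z + hp i)) (at z)"
proof -
  have "((\<lambda>z. (wzeta (z + hp i) + wzeta (z - hp i)) / 2) has_field_derivative
          (- wp (z + hp i) * (1 + 0) + - wp (z - hp i) * (1 - 0)) / 2) (at z)"
    using assms
    by (intro DERIV_cdivide DERIV_add DERIV_diff DERIV_chain2[of wzeta] wzeta_deriv DERIV_ident DERIV_const)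
       (auto simp: diff_hp_in_L_iff)
  hence "(Z i has_field_derivative (- wp (z + hp i) * (1 + 0) + - wp (z - hp i) * (1 - 0)) / 2) (at z)"
    by (simp add: Z_def[abs_def])
  thus ?thesis using wp_diff_hp[OF assms] by simp
qed

lemma Z_add:
  assumes "a \<in> L" "z + hp i \<notin> L"
  shows "Z i (z + a) = Z i z + eta a"
proof -
  have "wzeta (z + hp i + a) = wzeta (z + hp i) + eta a" "wzeta (z - hp i + a) = wzeta (z - hp i) + eta a"
    using assms by (auto intro!: wzeta_add simp: diff_hp_in_L_iff)
  thus ?thesis by (simp add: Z_def algebra_simps field_simps)
qed

lemma wp_isCont: "z \<notin> L \<Longrightarrow> isCont wp z"
  using holomorphic_on_imp_continuous_on[OF wp_holomorphic]
  by (simp add: continuous_on_eq_continuous_at[OF open_compl_L])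

lemma wp_residue:
  assumes "a \<in> L"
  shows "((\<lambda>z. wp z - 1 / (z - a)\<^sup>2) \<longlongrightarrow> - deriv zeta_reg 0) (at a)"
proof -
  have "deriv zeta_reg holomorphic_on - (L - {0})"
    using zeta_reg_holomorphic open_compl_L0 by (rule holomorphic_deriv)
  hence "isCont (deriv zeta_reg) 0"
    using open_compl_L0 holomorphic_on_imp_continuous_on continuous_on_eq_continuous_at by blast
  hence "isCont (\<lambda>z. deriv zeta_reg (z - a)) a"
    by - (rule isCont_o2[of _ _ "deriv zeta_reg"], auto)
  hence "isCont (\<lambda>z. - deriv zeta_reg (z - a)) a" by (rule continuous_minus)
  hence "((\<lambda>z. - deriv zeta_reg (z - a)) \<longlongrightarrow> - deriv zeta_reg 0) (at a)" by (simp add: isCont_def)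
  moreover have "\<forall>\<^sub>F z in at a. - deriv zeta_reg (z - a) = wp z - 1 / (z - a)\<^sup>2"
  proof -
    obtain e where e: "e > 0" "L \<inter> ball a e \<subseteq> {a}" using int_span2_isolated[OF ratio2] by blast
    have "\<forall>\<^sub>F z in at a. z \<in> ball a e - {a}" using e by (intro eventually_at_in_open) auto
    thus ?thesis
    proof eventually_elim
      case (elim z)
      hence "z \<notin> L" using e by auto
      hence "z - a \<notin> L" using assms by (simp add: int_span2_diff_iff)
      from wp_periodic[OF assms this] DERIV_imp_deriv[OF zeta_reg_deriv[of "z - a"]] \<open>z - a \<notin> L\<close>
      show ?case by (simp add: weierstrass_p_def)
    qed
  qed
  ultimately show ?thesis by (rule Lim_transform_eventually)
qed

lemma tendsto_at_shift:
  fixes f :: "complex \<Rightarrow> complex"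
  assumes "(f \<longlongrightarrow> l) (at (p + c))"
  shows "((\<lambda>z. f (z + c)) \<longlongrightarrow> l) (at p)"
  using LIM_offset[OF assms, of c] by (simp add: add.commute)

lemma wzeta_shift_principal_part:
  "\<exists>l. ((\<lambda>z. wzeta (z + c) - of_bool (p + c \<in> L) / (z - p)) \<longlongrightarrow> l) (at p)"
proof (cases "p + c \<in> L")
  case True
  show ?thesis using True tendsto_at_shift[OF wzeta_residue[OF True]] by auto
next
  case False
  have "(wzeta \<longlongrightarrow> wzeta (p + c)) (at (p + c))"
    using wzeta_deriv[OF False] DERIV_isCont isCont_def by blast
  from tendsto_at_shift[OF this] False show ?thesis by auto
qed

lemma Z_principal_part:
  "\<exists>l. ((\<lambda>z. Z i z - of_bool (p + hp i \<in> L) / (z - p)) \<longlongrightarrow> l) (at p)"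
proof -
  obtain l where l: "((\<lambda>z. wzeta (z + hp i) - of_bool (p + hp i \<in> L) / (z - p)) \<longlongrightarrow> l) (at p)"
    using wzeta_shift_principal_part by blast
  obtain l' where l': "((\<lambda>z. wzeta (z + (- hp i)) - of_bool (p + (- hp i) \<in> L) / (z - p)) \<longlongrightarrow> l') (at p)"
    using wzeta_shift_principal_part by blast
  have "((\<lambda>z. ((wzeta (z + hp i) - of_bool (p + hp i \<in> L) / (z - p)) +
           (wzeta (z - hp i) - of_bool (p + hp i \<in> L) / (z - p))) / 2) \<longlongrightarrow> (l + l') / 2) (at p)"
    using l l' by (intro tendsto_intros) (auto simp: diff_hp_in_L_iff)
  moreover have "((wzeta (z + hp i) - of_bool (p + hp i \<in> L) / (z - p)) +
           (wzeta (z - hp i) - of_bool (p + hp i \<in> L) / (z - p))) / 2 =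
         Z i z - of_bool (p + hp i \<in> L) / (z - p)" for z
  proof -
    have "((u - q) + (v - q)) / 2 = (u + v) / 2 - q" for u v q :: complex
      by (simp add: field_simps)
    thus ?thesis by (simp only: Z_def)
  qed
  ultimately show ?thesis by (simp only:) blast
qed

lemma wp_shift_principal_part:
  "\<exists>l. ((\<lambda>z. wp (z + c) - of_bool (p + c \<in> L) / (z - p)\<^sup>2) \<longlongrightarrow> l) (at p)"
proof (cases "p + c \<in> L")
  case True
  show ?thesis using True tendsto_at_shift[OF wp_residue[OF True]] by auto
next
  case False
  have "(wp \<longlongrightarrow> wp (p + c)) (at (p + c))"
    using wp_isCont[OF False] by (simp add: isCont_def)
  from tendsto_at_shift[OF this] False show ?thesis by auto
qed

lemma tendsto_residue:
  fixes F :: "complex \<Rightarrow> complex"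
  assumes "((\<lambda>z. F z - k / (z - p)) \<longlongrightarrow> l) (at p)"
  shows "((\<lambda>z. (z - p) * F z) \<longlongrightarrow> k) (at p)"
proof -
  have "((\<lambda>z. (z - p) * (F z - k / (z - p)) + k) \<longlongrightarrow> (p - p) * l + k) (at p)"
    by (intro tendsto_intros assms)
  moreover have "\<forall>\<^sub>F z in at p. (z - p) * (F z - k / (z - p)) + k = (z - p) * F z"
    by (auto simp: eventually_at_filter field_simps)
  ultimately show ?thesis by (auto intro: Lim_transform_eventually)
qed

text \<open>The double poles cancel because the coefficient in W is the square of the common residue
  of F and G; the cross terms leave a simple pole at most.\<close>

lemma tendsto_residue_product:
  fixes F G W :: "complex \<Rightarrow> complex"
  assumes "((\<lambda>z. F z - a / (z - p)) \<longlongrightarrow> l) (at p)"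
    and "((\<lambda>z. G z - a / (z - p)) \<longlongrightarrow> m) (at p)"
    and "((\<lambda>z. W z - a\<^sup>2 / (z - p)\<^sup>2) \<longlongrightarrow> n) (at p)"
  shows "((\<lambda>z. (z - p) * (F z * G z - W z)) \<longlongrightarrow> a * (l + m)) (at p)"
proof -
  let ?f = "\<lambda>z. F z - a / (z - p)" and ?g = "\<lambda>z. G z - a / (z - p)" and ?w = "\<lambda>z. W z - a\<^sup>2 / (z - p)\<^sup>2"
  have "((\<lambda>z. (z - p) * (?f z * ?g z - ?w z) + a * (?f z + ?g z)) \<longlongrightarrow>
          (p - p) * (l * m - n) + a * (l + m)) (at p)"
    by (intro tendsto_intros assms)
  moreover have "\<forall>\<^sub>F z in at p. (z - p) * (?f z * ?g z - ?w z) + a * (?f z + ?g z) = (z - p) * (F z * G z - W z)"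
  proof -
    have "u * ((x - a / u) * (y - a / u) - (w - a\<^sup>2 / u\<^sup>2)) + a * ((x - a / u) + (y - a / u)) = u * (x * y - w)"
      if "u \<noteq> 0" for u x y w :: complex
      using that by (simp add: field_simps power2_eq_square)
    thus ?thesis by (auto simp: eventually_at_filter)
  qed
  ultimately show ?thesis by (auto intro: Lim_transform_eventually)
qed

lemma sum_class:
  fixes g :: "nat \<Rightarrow> complex"
  assumes "i \<in> {0..3}" "\<And>j. j \<in> {0..3} \<Longrightarrow> p + hp j \<in> L \<longleftrightarrow> j = i"
  shows "(\<Sum>j=0..3. g j * of_bool (p + hp j \<in> L)) = g i"
proof -
  have "(\<Sum>j=0..3. g j * of_bool (p + hp j \<in> L)) = (\<Sum>j=0..3. if j = i then g j else 0)"
    using assms(2) by (intro sum.cong) auto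
  also have "\<dots> = g i" using assms(1) by (simp add: sum.delta)
  finally show ?thesis .
qed

lemma sum_Z_principal_part:
  "\<exists>l. ((\<lambda>z. (\<Sum>i=0..3. g i * Z i z) - (\<Sum>i=0..3. g i * of_bool (p + hp i \<in> L)) / (z - p)) \<longlongrightarrow> l) (at p)"
proof -
  have "\<forall>i. \<exists>l. ((\<lambda>z. Z i z - of_bool (p + hp i \<in> L) / (z - p)) \<longlongrightarrow> l) (at p)"
    by (intro allI Z_principal_part)
  from choice[OF this] obtain l
    where l: "\<And>i. ((\<lambda>z. Z i z - of_bool (p + hp i \<in> L) / (z - p)) \<longlongrightarrow> l i) (at p)"
    by blast
  have "((\<lambda>z. \<Sum>i=0..3. g i * (Z i z - of_bool (p + hp i \<in> L) / (z - p))) \<longlongrightarrow> (\<Sum>i=0..3. g i * l i)) (at p)"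
    by (intro tendsto_intros l)
  thus ?thesis
    by (simp only: right_diff_distrib sum_subtractf sum_divide_distrib times_divide_eq_right) blast
qed

section \<open>The duplication formula\<close>

lemma Z_holomorphic: "Z i holomorphic_on - H"
proof -
  have "Z i field_differentiable at z" if "z \<notin> H" for z
    using Z_deriv[OF add_hp_not_L(1)[OF that]] field_differentiable_def by blast
  thus ?thesis by (auto simp: holomorphic_on_def intro: field_differentiable_at_within)
qed

text \<open>The logarithmic derivative of sigma(2 z) being a constant multiple of the product of the
  four sigma_i(z). Both sides have quasi-period 4 \<open>eta a\<close> and residue 1 at every point
  of H, so their difference is a constant; being odd, it is 0.\<close>

lemma wzeta_double: 
  assumes "z \<notin> H"
  shows "2 * wzeta (2 * z) = (\<Sum>i=0..3. Z i z)"
proof -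
  define f where "f = (\<lambda>z. 2 * wzeta (2 * z) - (\<Sum>i=0..3. Z i z))"
  have per: "f (z + a) = f z" if "z \<notin> H" "a \<in> L" for z a
  proof -
    have "2 * a \<in> L" using that L_subset_H double_mem_L_iff by blast
    moreover have "2 * z \<notin> L" using that by (simp add: double_mem_L_iff)
    ultimately have "wzeta (2 * z + 2 * a) = wzeta (2 * z) + eta (2 * a)" by (rule wzeta_add)
    moreover have "eta (2 * a) = 2 * eta a" using eta_add[OF that(2) that(2)] by (simp only: mult_2)
    moreover have "(\<Sum>i=0..3. Z i (z + a)) = (\<Sum>i=0..3. Z i z + eta a)"
      using that by (intro sum.cong refl Z_add) (auto simp: add_hp_not_L)
    ultimately show ?thesis by (simp add: f_def sum.distrib distrib_left)
  qed
  have lim: "((\<lambda>z. (z - p) * f z) \<longlongrightarrow> 0) (at p)" if p: "p \<in> H" for p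
  proof -
    have "2 * p \<in> L" using p by (simp add: double_mem_L_iff)
    have "filterlim (\<lambda>z. 2 * z) (at (2 * p)) (at p)"
      by (auto simp: filterlim_at eventually_at_filter intro!: tendsto_eq_intros)
    from filterlim_compose[OF wzeta_residue[OF \<open>2 * p \<in> L\<close>] this]
    have "((\<lambda>z. 2 * (wzeta (2 * z) - 1 / (2 * z - 2 * p))) \<longlongrightarrow> 2 * (eta (2 * p) + zeta_reg 0)) (at p)"
      by (intro tendsto_intros)
    moreover have "2 * (wzeta (2 * z) - 1 / (2 * z - 2 * p)) = 2 * wzeta (2 * z) - 1 / (z - p)" for z
    proof -
      have "2 * (v - 1 / (2 * u)) = 2 * v - 1 / u" for u v :: complex
        by (cases "u = 0") (simp_all add: field_simps)
      from this[of "wzeta (2 * z)" "z - p"] show ?thesis by (simp only: right_diff_distrib)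
    qed
    ultimately have 1: "((\<lambda>z. (z - p) * (2 * wzeta (2 * z))) \<longlongrightarrow> 1) (at p)"
      by (intro tendsto_residue) auto
    obtain i where i: "i \<in> {0..3}" "\<And>j. j \<in> {0..3} \<Longrightarrow> p + hp j \<in> L \<longleftrightarrow> j = i"
      using half_period_class[OF p] by blast
    obtain l where "((\<lambda>z. (\<Sum>i=0..3. 1 * Z i z) - (\<Sum>i=0..3. 1 * of_bool (p + hp i \<in> L)) / (z - p)) \<longlongrightarrow> l) (at p)"
      using sum_Z_principal_part[of "\<lambda>_. 1"] by blast
    from tendsto_residue[OF this] sum_class[OF i, of "\<lambda>_. 1"]
    have "((\<lambda>z. (z - p) * (\<Sum>i=0..3. Z i z)) \<longlongrightarrow> 1) (at p)" by simp
    from tendsto_diff[OF 1 this] show ?thesis by (simp add: f_def right_diff_distrib)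
  qed
  have hol: "f holomorphic_on - H"
  proof -
    have "(\<lambda>z. wzeta (2 * z)) holomorphic_on - H"
    proof (rule holomorphic_on_compose_gen[of "\<lambda>z. 2 * z" "- H" wzeta "- L", unfolded o_def])
      show "wzeta holomorphic_on - L"
        by (auto simp: holomorphic_on_open[OF open_compl_L] intro: wzeta_deriv)
    qed (auto intro!: holomorphic_intros simp: double_mem_L_iff)
    thus ?thesis unfolding f_def by (intro holomorphic_intros Z_holomorphic)
  qed
  have "f z = f (- z)"
    by (rule elliptic_const[of H f])
       (use assms lim hol per H_isolated L_subset_H in \<open>auto simp: int_span2_add_iff\<close>)
  moreover have "f (- z) = - f z"
    using wzeta_odd[of "2 * z"] by (simp add: f_def Z_odd sum_negf)
  ultimately have "f z = 0" by simp
  thus ?thesis by (simp add: f_def)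
qed

lemma open_compl_H: "open (- H)"
proof (rule openI)
  fix z assume "z \<in> - H"
  thus "\<exists>e>0. ball z e \<subseteq> - H" using H_isolated[of z] by auto
qed

lemma wp_double:
  assumes "z \<notin> H"
  shows "4 * wp (2 * z) = (\<Sum>i=0..3. wp (z + hp i))"
proof -
  have "2 * z \<notin> L" using assms by (simp add: double_mem_L_iff)
  hence 1: "((\<lambda>z. 2 * wzeta (2 * z)) has_field_derivative 2 * (- wp (2 * z) * (2 * 1))) (at z)"
    by (intro DERIV_cmult DERIV_chain2[of wzeta] wzeta_deriv DERIV_ident)
  have "((\<lambda>z. \<Sum>i=0..3. Z i z) has_field_derivative (\<Sum>i=0..3. - wp (z + hp i))) (at z)"
    by (intro DERIV_sum Z_deriv add_hp_not_L assms)
  hence 2: "((\<lambda>z. 2 * wzeta (2 * z)) has_field_derivative (\<Sum>i=0..3. - wp (z + hp i))) (at z)"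
    by (rule DERIV_cong_ev[OF refl _ refl, THEN iffD1, rotated])
       (use eventually_nhds_in_open[OF open_compl_H, of z] assms wzeta_double in \<open>auto elim!: eventually_mono\<close>)
  have "4 * wp (2 * z) = - (2 * (- wp (2 * z) * (2 * 1)))" by simp
  also have "\<dots> = - (\<Sum>i=0..3. - wp (z + hp i))" by (simp only: DERIV_unique[OF 1 2])
  also have "\<dots> = (\<Sum>i=0..3. wp (z + hp i))" by (simp only: sum_negf minus_minus)
  finally show ?thesis .
qed

lemma sum_wp_principal_part:
  "\<exists>l. ((\<lambda>z. (\<Sum>i=0..3. g i * wp (z + hp i)) - (\<Sum>i=0..3. g i * of_bool (p + hp i \<in> L)) / (z - p)\<^sup>2) \<longlongrightarrow> l) (at p)"
proof -
  have "\<forall>i. \<exists>l. ((\<lambda>z. wp (z + hp i) - of_bool (p + hp i \<in> L) / (z - p)\<^sup>2) \<longlongrightarrow> l) (at p)"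
    by (intro allI wp_shift_principal_part)
  from choice[OF this] obtain l
    where l: "\<And>i. ((\<lambda>z. wp (z + hp i) - of_bool (p + hp i \<in> L) / (z - p)\<^sup>2) \<longlongrightarrow> l i) (at p)"
    by blast
  have "((\<lambda>z. \<Sum>i=0..3. g i * (wp (z + hp i) - of_bool (p + hp i \<in> L) / (z - p)\<^sup>2)) \<longlongrightarrow> (\<Sum>i=0..3. g i * l i)) (at p)"
    by (intro tendsto_intros l)
  thus ?thesis
    by (simp only: right_diff_distrib sum_subtractf sum_divide_distrib times_divide_eq_right) blast
qed

lemma wzeta_isCont: "z \<notin> L \<Longrightarrow> isCont wzeta z"
  using wzeta_deriv DERIV_isCont by blast

section \<open>The identity behind the kernel\<close>

lemma wp_shift_deriv:
  assumes "z + c \<notin> L"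
  shows "((\<lambda>z. wp (z + c)) has_field_derivative deriv wp (z + c)) (at z)"
proof -
  have "(wp has_field_derivative deriv wp (z + c)) (at (z + c))"
    using wp_holomorphic open_compl_L assms by (intro holomorphic_derivI[of _ "- L"]) auto
  hence "((\<lambda>z. wp (z + c)) has_field_derivative deriv wp (z + c) * (1 + 0)) (at z)"
    by (intro DERIV_chain2[of wp] DERIV_add DERIV_ident DERIV_const)
  thus ?thesis by simp
qed

text \<open>
  Both sides are elliptic in \<open>x\<close>. The simple poles at \<open>x = \<plusminus>y\<close> cancel by the duplication formula,
  those at the half-periods because the difference of the two sides is even about each of them;
  the remaining constant is found by letting \<open>x\<close> tend to \<open>y\<close>.
\<close>

lemma kernel_identity:
  fixes \<alpha> \<beta> :: "nat \<Rightarrow> complex" and d :: complex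
  assumes d: "(\<Sum>i=0..3. \<alpha> i) = - 2 * d" and \<beta>: "\<And>i. \<beta> i = \<alpha> i + d"
    and y: "y \<notin> H" and x: "x \<notin> H" "x - y \<notin> L" "x + y \<notin> L"
  shows "((\<Sum>i=0..3. \<alpha> i * Z i x) - (\<Sum>i=0..3. \<beta> i * Z i y) + 2 * d * wzeta (x + y)) *
         ((\<Sum>i=0..3. \<alpha> i * Z i x) + (\<Sum>i=0..3. \<beta> i * Z i y) + 2 * d * wzeta (x - y)) =
         (\<Sum>i=0..3. (\<alpha> i)\<^sup>2 * wp (x + hp i)) - (\<Sum>i=0..3. (\<beta> i)\<^sup>2 * wp (y + hp i))"
proof -
  define A where "A = (\<lambda>x. \<Sum>i=0..3. \<alpha> i * Z i x)"
  define B where "B = (\<Sum>i=0..3. \<beta> i * Z i y)"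
  \<comment> \<open>For the kernel K, \<open>F\<close> and \<open>G\<close> are the sum and the
    difference of its logarithmic derivatives in x and in y, so \<open>F x * G x\<close> is the
    difference of their squares. Adding their derivatives, in which the terms with x + y and x - y
    cancel, gives H_x K = H_y K.\<close>
  define F where "F = (\<lambda>x. A x - B + 2 * d * wzeta (x + y))"
  define G where "G = (\<lambda>x. A x + B + 2 * d * wzeta (x - y))"
  define W where "W = (\<lambda>x. (\<Sum>i=0..3. (\<alpha> i)\<^sup>2 * wp (x + hp i)) - (\<Sum>i=0..3. (\<beta> i)\<^sup>2 * wp (y + hp i)))"
  define D where "D = (\<lambda>x. F x * G x - W x)"
  define P where "P = H \<union> {x. x - y \<in> L} \<union> {x. x + y \<in> L}"

  have A_odd: "A (- x) = - A x" for x by (simp add: A_def Z_odd sum_negf)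
  have FG: "F (- x) = - G x" "G (- x) = - F x" for x
    using wzeta_odd[of "x - y"] wzeta_odd[of "x + y"] by (simp_all add: F_def G_def A_odd)
  have P_minus: "- x \<in> P \<longleftrightarrow> x \<in> P" for x
  proof -
    have "- x - y = - (x + y)" "- x + y = - (x - y)" by simp_all
    hence "- x - y \<in> L \<longleftrightarrow> x + y \<in> L" "- x + y \<in> L \<longleftrightarrow> x - y \<in> L"
      by (simp_all only: int_span2_minus_iff)
    thus ?thesis by (auto simp: P_def)
  qed
  have W_even: "W (- x) = W x" if "x \<notin> H" for x
  proof -
    have "wp (- x + hp i) = wp (x + hp i)" for i
      using wp_even[of "x - hp i"] wp_diff_hp[of x i] add_hp_not_L[OF that, of i] by simp
    thus ?thesis by (simp add: W_def)
  qed
  have D_even: "D (- x) = D x" if "x \<notin> P" for x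
    using W_even[of x] that by (simp add: D_def FG P_def)
  have P_add: "x + a \<in> P \<longleftrightarrow> x \<in> P" if "a \<in> L" for x a
  proof -
    have "x + a - y = x - y + a" "x + a + y = x + y + a" by simp_all
    hence "x + a - y \<in> L \<longleftrightarrow> x - y \<in> L" "x + a + y \<in> L \<longleftrightarrow> x + y \<in> L"
      using that by (simp_all only: int_span2_add_iff)
    moreover have "a \<in> H" using that L_subset_H by blast
    ultimately show ?thesis by (simp add: P_def int_span2_add_iff)
  qed
  \<comment> \<open>Here the value of the sum of the \<alpha> i enters: the quasi-period of
    \<open>A\<close> is opposite to that of 2 d zeta, so that \<open>F\<close> and \<open>G\<close>
    are truly periodic.\<close>
  have A_add: "A (x + a) = A x - 2 * d * eta a" if "a \<in> L" "x \<notin> H" for x a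
  proof -
    have "A (x + a) = (\<Sum>i=0..3. \<alpha> i * (Z i x + eta a))"
      unfolding A_def using that by (intro sum.cong refl) (simp add: Z_add add_hp_not_L)
    also have "\<dots> = A x + (\<Sum>i=0..3. \<alpha> i) * eta a"
      by (simp add: A_def distrib_left sum.distrib sum_distrib_right)
    finally show ?thesis by (simp add: d)
  qed
  have D_per: "D (x + a) = D x" if "x \<notin> P" "a \<in> L" for x a
  proof -
    have x: "x \<notin> H" "x - y \<notin> L" "x + y \<notin> L" using that by (auto simp: P_def)
    have "x + a + y = x + y + a" "x + a - y = x - y + a" by simp_all
    hence "wzeta (x + a + y) = wzeta (x + y) + eta a" "wzeta (x + a - y) = wzeta (x - y) + eta a"
      using wzeta_add[OF that(2) x(3)] wzeta_add[OF that(2) x(2)] by (simp_all only:)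
    hence "F (x + a) = F x" "G (x + a) = G x"
      using A_add[of a x] x that by (simp_all add: F_def G_def algebra_simps)
    moreover have "wp (x + a + hp i) = wp (x + hp i)" for i
      using wp_periodic[of a "x + hp i"] that x add_hp_not_L by (simp add: add_ac)
    ultimately show ?thesis by (simp add: D_def W_def)
  qed
  have P_isolated: "\<exists>e>0. P \<inter> ball z e \<subseteq> {z}" for z
  proof -
    obtain e1 where e1: "e1 > 0" "H \<inter> ball z e1 \<subseteq> {z}" using H_isolated by blast
    obtain e2 where e2: "e2 > 0" "L \<inter> ball (z - y) e2 \<subseteq> {z - y}"
      using int_span2_isolated[OF ratio2] by blast
    obtain e3 where e3: "e3 > 0" "L \<inter> ball (z + y) e3 \<subseteq> {z + y}"
      using int_span2_isolated[OF ratio2] by blast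
    define e where "e = min e1 (min e2 e3)"
    have "P \<inter> ball z e \<subseteq> {z}"
    proof
      fix x assume x: "x \<in> P \<inter> ball z e"
      hence "x \<in> ball z e1" "x - y \<in> ball (z - y) e2" "x + y \<in> ball (z + y) e3"
        by (auto simp: e_def dist_norm)
      thus "x \<in> {z}" using x e1(2) e2(2) e3(2) by (auto simp: P_def)
    qed
    moreover have "e > 0" using e1 e2 e3 by (simp add: e_def)
    ultimately show ?thesis by blast
  qed
  have near: "\<forall>\<^sub>F x in at p. x \<notin> P" for p
  proof -
    obtain e where e: "e > 0" "P \<inter> ball p e \<subseteq> {p}" using P_isolated by blast
    have "\<forall>\<^sub>F z in at p. z \<in> ball p e - {p}" using e by (intro eventually_at_in_open) auto
    thus ?thesis by eventually_elim (use e in auto)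
  qed
  have A_deriv: "(A has_field_derivative - (\<Sum>i=0..3. \<alpha> i * wp (x + hp i))) (at x)" if "x \<notin> H" for x
  proof -
    have "(A has_field_derivative (\<Sum>i=0..3. \<alpha> i * - wp (x + hp i))) (at x)"
      unfolding A_def by (intro DERIV_sum DERIV_cmult Z_deriv add_hp_not_L that)
    thus ?thesis by (simp add: sum_negf)
  qed
  have F_deriv: "(F has_field_derivative - (\<Sum>i=0..3. \<alpha> i * wp (x + hp i)) - 2 * d * wp (x + y)) (at x)"
    if "x \<notin> H" "x + y \<notin> L" for x
  proof -
    have "(F has_field_derivative
        - (\<Sum>i=0..3. \<alpha> i * wp (x + hp i)) - 0 + 2 * d * (- wp (x + y) * (1 + 0))) (at x)"
      unfolding F_def using that
      by (intro DERIV_add DERIV_diff DERIV_cmult A_deriv DERIV_const DERIV_ident DERIV_chain2[of wzeta] wzeta_deriv)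
    thus ?thesis by simp
  qed
  have G_deriv: "(G has_field_derivative - (\<Sum>i=0..3. \<alpha> i * wp (x + hp i)) - 2 * d * wp (x - y)) (at x)"
    if "x \<notin> H" "x - y \<notin> L" for x
  proof -
    have "(G has_field_derivative
        - (\<Sum>i=0..3. \<alpha> i * wp (x + hp i)) + 0 + 2 * d * (- wp (x - y) * (1 - 0))) (at x)"
      unfolding G_def using that
      by (intro DERIV_add DERIV_diff DERIV_cmult A_deriv DERIV_const DERIV_ident DERIV_chain2[of wzeta] wzeta_deriv)
    thus ?thesis by simp
  qed
  have W_diff: "W field_differentiable (at x)" if "x \<notin> H" for x
  proof -
    have "(W has_field_derivative (\<Sum>i=0..3. (\<alpha> i)\<^sup>2 * deriv wp (x + hp i)) - 0) (at x)"
      unfolding W_def using that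
      by (intro DERIV_diff DERIV_sum DERIV_cmult wp_shift_deriv DERIV_const add_hp_not_L)
    thus ?thesis using field_differentiable_def by blast
  qed
  have W_lim: "(W \<longlongrightarrow> W p) (at p)" if "p \<notin> H" for p
    using W_diff[OF that] field_differentiable_imp_continuous_at isCont_def by blast
  have D_hol: "D holomorphic_on - P"
  proof -
    have "D field_differentiable (at x)" if "x \<notin> P" for x
      unfolding D_def using that F_deriv[of x] G_deriv[of x] W_diff[of x]
      by (intro field_differentiable_diff field_differentiable_mult)
         (auto simp: P_def field_differentiable_def)
    thus ?thesis by (auto simp: holomorphic_on_def intro: field_differentiable_at_within)
  qed

  \<comment> \<open>At x = y the difference \<open>A y - B\<close> is -d times the sum of the
    \<open>Z i y\<close>, which the duplication formula turns into -2 d zeta(2 y). This zero of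
    \<open>F\<close> meets the simple pole of \<open>G\<close>.\<close>
  have F_zero: "F (y + a) = 0" if "a \<in> L" for a
  proof -
    have y2: "2 * y \<notin> L" using y by (simp add: double_mem_L_iff)
    have "wzeta (2 * y + a) = wzeta (2 * y) + eta a" using that y2 by (rule wzeta_add)
    moreover have "y + a + y = 2 * y + a" by simp
    ultimately have "F (y + a) = (A y - 2 * d * eta a) - B + 2 * d * (wzeta (2 * y) + eta a)"
      unfolding F_def by (simp only: A_add[OF that y])
    also have "\<dots> = A y - B + d * (2 * wzeta (2 * y))" by (simp add: algebra_simps)
    also have "\<dots> = A y - B + d * (\<Sum>i=0..3. Z i y)" by (simp only: wzeta_double[OF y])
    also have "\<dots> = 0"
      by (simp add: A_def B_def \<beta> algebra_simps sum.distrib sum_distrib_left)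
    finally show ?thesis .
  qed
  have G_residue: "((\<lambda>x. (x - (y + a)) * G x) \<longlongrightarrow> 2 * d) (at (y + a))" if a: "a \<in> L" for a
  proof -
    have nH: "y + a \<notin> H" using y a L_subset_H by (auto simp: int_span2_add_iff)
    have lA: "(A \<longlongrightarrow> A (y + a)) (at (y + a))"
      using DERIV_isCont[OF A_deriv[OF nH]] by (simp add: isCont_def)
    have "y + a + - y \<in> L" using a by simp
    with wzeta_shift_principal_part[of "- y" "y + a"] obtain l
      where l: "((\<lambda>x. wzeta (x - y) - 1 / (x - (y + a))) \<longlongrightarrow> l) (at (y + a))" by auto
    have "((\<lambda>x. (x - (y + a)) * (A x + B) + 2 * d * ((x - (y + a)) * wzeta (x - y)))
           \<longlongrightarrow> (y + a - (y + a)) * (A (y + a) + B) + 2 * d * 1) (at (y + a))"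
      by (intro tendsto_intros lA tendsto_residue[OF l])
    thus ?thesis by (simp add: G_def algebra_simps)
  qed
  have lim_b: "((\<lambda>x. (x - (y + a)) * D x) \<longlongrightarrow> 0) (at (y + a))" if a: "a \<in> L" for a
  proof -
    let ?p = "y + a"
    have nH: "?p \<notin> H" using y a L_subset_H by (auto simp: int_span2_add_iff)
    have "2 * y \<notin> L" using y by (simp add: double_mem_L_iff)
    moreover have "?p + y = 2 * y + a" by simp
    ultimately have nL: "?p + y \<notin> L" using int_span2_add_iff[OF a, of "2 * y"] by (simp only:) simp
    have "(F \<longlongrightarrow> F ?p) (at ?p)"
      using DERIV_isCont[OF F_deriv[OF nH nL]] by (simp add: isCont_def)
    hence lF: "(F \<longlongrightarrow> 0) (at ?p)" by (simp add: F_zero a)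
    have "((\<lambda>x. F x * ((x - ?p) * G x) - (x - ?p) * W x) \<longlongrightarrow> 0 * (2 * d) - (?p - ?p) * W ?p) (at ?p)"
      by (intro tendsto_intros lF G_residue[OF a] W_lim[OF nH])
    thus ?thesis by (simp add: D_def algebra_simps)
  qed
  have lim_c: "((\<lambda>x. (x - (- y + a)) * D x) \<longlongrightarrow> 0) (at (- y + a))" if a: "a \<in> L" for a
  proof -
    let ?p = "- y + a"
    have "- x \<noteq> y + - a" if "x \<noteq> ?p" for x using that by (auto simp: minus_equation_iff[of x])
    hence "filterlim uminus (at (y + - a)) (at ?p)"
      unfolding filterlim_at eventually_at_filter
      by (intro conjI always_eventually tendsto_eq_intros) auto
    from filterlim_compose[OF lim_b[of "- a"] this] a
    have "((\<lambda>x. - ((- x - (y + - a)) * D (- x))) \<longlongrightarrow> - 0) (at ?p)"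
      by (intro tendsto_minus) auto
    moreover have "\<forall>\<^sub>F x in at ?p. - ((- x - (y + - a)) * D (- x)) = (x - ?p) * D x"
      using near[of ?p] by eventually_elim (simp add: D_even algebra_simps)
    ultimately show ?thesis by (auto intro: Lim_transform_eventually)
  qed
  have lim_a: "((\<lambda>x. (x - p) * D x) \<longlongrightarrow> 0) (at p)" if p: "p \<in> H" for p
  proof -
    obtain i where i: "i \<in> {0..3}" "\<And>j. j \<in> {0..3} \<Longrightarrow> p + hp j \<in> L \<longleftrightarrow> j = i"
      using half_period_class[OF p] by blast
    have "p + y \<notin> L" "p - y \<notin> L"
      using y p L_subset_H int_span2_diff_iff[OF p, of "p + y"] int_span2_diff[of p \<omega>1 \<omega>3 "p - y"] by auto
    hence lz: "((\<lambda>x. wzeta (x + y)) \<longlongrightarrow> wzeta (p + y)) (at p)" "((\<lambda>x. wzeta (x - y)) \<longlongrightarrow> wzeta (p - y)) (at p)"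
      using tendsto_at_shift[of wzeta _ p y] tendsto_at_shift[of wzeta _ p "- y"] wzeta_isCont
      by (auto simp: isCont_def)
    obtain l where "((\<lambda>x. A x - (\<Sum>i=0..3. \<alpha> i * of_bool (p + hp i \<in> L)) / (x - p)) \<longlongrightarrow> l) (at p)"
      unfolding A_def using sum_Z_principal_part[of \<alpha> p] by blast
    hence lA: "((\<lambda>x. A x - \<alpha> i / (x - p)) \<longlongrightarrow> l) (at p)" by (simp only: sum_class[OF i])
    have "((\<lambda>x. (A x - \<alpha> i / (x - p)) - B + 2 * d * wzeta (x + y)) \<longlongrightarrow> l - B + 2 * d * wzeta (p + y)) (at p)"
      by (intro tendsto_intros lA lz)
    hence lF: "((\<lambda>x. F x - \<alpha> i / (x - p)) \<longlongrightarrow> l - B + 2 * d * wzeta (p + y)) (at p)"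
      by (simp add: F_def algebra_simps)
    have "((\<lambda>x. (A x - \<alpha> i / (x - p)) + B + 2 * d * wzeta (x - y)) \<longlongrightarrow> l + B + 2 * d * wzeta (p - y)) (at p)"
      by (intro tendsto_intros lA lz)
    hence lG: "((\<lambda>x. G x - \<alpha> i / (x - p)) \<longlongrightarrow> l + B + 2 * d * wzeta (p - y)) (at p)"
      by (simp add: G_def algebra_simps)
    obtain m where "((\<lambda>x. (\<Sum>i=0..3. (\<alpha> i)\<^sup>2 * wp (x + hp i)) -
        (\<Sum>i=0..3. (\<alpha> i)\<^sup>2 * of_bool (p + hp i \<in> L)) / (x - p)\<^sup>2) \<longlongrightarrow> m) (at p)"
      using sum_wp_principal_part[of "\<lambda>i. (\<alpha> i)\<^sup>2" p] by blast
    hence "((\<lambda>x. (\<Sum>i=0..3. (\<alpha> i)\<^sup>2 * wp (x + hp i)) - (\<alpha> i)\<^sup>2 / (x - p)\<^sup>2) \<longlongrightarrow> m) (at p)"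
      by (simp only: sum_class[OF i])
    from tendsto_diff[OF this tendsto_const[of "\<Sum>i=0..3. (\<beta> i)\<^sup>2 * wp (y + hp i)"]]
    have lW: "((\<lambda>x. W x - (\<alpha> i)\<^sup>2 / (x - p)\<^sup>2) \<longlongrightarrow> m - (\<Sum>i=0..3. (\<beta> i)\<^sup>2 * wp (y + hp i))) (at p)"
      by (simp add: W_def algebra_simps)
    \<comment> \<open>At p both \<open>F\<close> and \<open>G\<close> have residue
      \<open>\<alpha> i\<close>, and \<open>W\<close> has the double pole with coefficient its
      square. So at most a simple pole is left, which the reflection about p then excludes.\<close>
    from tendsto_residue_product[OF lF lG lW] obtain \<rho>
      where \<rho>: "((\<lambda>x. (x - p) * D x) \<longlongrightarrow> \<rho>) (at p)" unfolding D_def by blast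
    have "2 * p - x \<noteq> p" if "x \<noteq> p" for x using that by (auto simp: diff_eq_eq)
    hence "filterlim (\<lambda>x. 2 * p - x) (at p) (at p)"
      unfolding filterlim_at eventually_at_filter
      by (intro conjI always_eventually tendsto_eq_intros) auto
    from tendsto_minus[OF filterlim_compose[OF \<rho> this]]
    have "((\<lambda>x. - ((2 * p - x - p) * D (2 * p - x))) \<longlongrightarrow> - \<rho>) (at p)" .
    moreover have "\<forall>\<^sub>F x in at p. - ((2 * p - x - p) * D (2 * p - x)) = (x - p) * D x"
      using near[of p]
    proof eventually_elim
      case (elim x)
      have "D (- x + 2 * p) = D (- x)"
        using elim p by (intro D_per) (auto simp: P_minus double_mem_L_iff)
      hence "D (2 * p - x) = D x" using D_even[OF elim] by simp
      moreover have "- (2 * p - x - p) = x - p" by simp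
      ultimately show ?case by (metis mult_minus_left)
    qed
    ultimately have "((\<lambda>x. (x - p) * D x) \<longlongrightarrow> - \<rho>) (at p)" by (rule Lim_transform_eventually)
    with \<rho> have "\<rho> = - \<rho>" by (intro tendsto_unique[of "at p"]) auto
    with \<rho> show ?thesis by (simp add: equal_neg_zero)
  qed
  have lim: "((\<lambda>x. (x - p) * D x) \<longlongrightarrow> 0) (at p)" if p: "p \<in> P" for p
  proof -
    consider "p \<in> H" | "p - y \<in> L" | "p + y \<in> L" using p by (auto simp: P_def)
    thus ?thesis
    proof cases
      case 2 thus ?thesis using lim_b[of "p - y"] by simp
    next
      case 3 thus ?thesis using lim_c[of "p + y"] by simp
    qed (rule lim_a)
  qed

  have xP: "x \<notin> P" using x by (simp add: P_def)
  have const: "D u = D x" if "u \<notin> P" for u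
    by (rule elliptic_const[OF P_isolated D_hol _ D_per lim that xP]) (simp_all add: P_add)
  have "(D \<longlongrightarrow> 0) (at y)"
  proof -
    let ?S = "\<Sum>i=0..3. \<alpha> i * wp (y + hp i)"
    have y2: "y + y \<notin> L" using y double_mem_L_iff[of y] by (simp only: mult_2) simp
    have "((\<lambda>x. (F x - F y) / (x - y)) \<longlongrightarrow> - ?S - 2 * d * wp (y + y)) (at y)"
      using F_deriv[OF y y2] by (simp add: has_field_derivative_iff)
    hence lF: "((\<lambda>x. F x / (x - y)) \<longlongrightarrow> - ?S - 2 * d * wp (y + y)) (at y)"
      using F_zero[of 0] by simp
    have "((\<lambda>x. F x / (x - y) * ((x - y) * G x) - W x) \<longlongrightarrow> (- ?S - 2 * d * wp (y + y)) * (2 * d) - W y) (at y)"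
      using G_residue[of 0] by (intro tendsto_diff tendsto_mult[OF lF] W_lim[OF y]) simp
    moreover have "\<forall>\<^sub>F x in at y. F x / (x - y) * ((x - y) * G x) - W x = D x"
      by (auto simp: eventually_at_filter D_def)
    \<comment> \<open>The product \<open>F x * G x\<close> tends to F'(y) times the residue 2 d of
      \<open>G\<close>. In \<open>W y\<close> the squares of the \<alpha> i cancel because of
      \<open>\<beta> i = \<alpha> i + d\<close>; the terms with d^2 are summed by the duplication
      formula for the p-function.\<close>
    moreover have "(- ?S - 2 * d * wp (y + y)) * (2 * d) - W y = 0"
    proof -
      have "W y = (\<Sum>i=0..3. - 2 * d * (\<alpha> i * wp (y + hp i)) - d\<^sup>2 * wp (y + hp i))"
        unfolding W_def sum_subtractf[symmetric]
        by (intro sum.cong refl) (simp add: \<beta> power2_eq_square algebra_simps)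
      also have "\<dots> = - 2 * d * ?S - d\<^sup>2 * (4 * wp (2 * y))"
        by (simp only: wp_double[OF y] sum_subtractf sum_distrib_left)
      finally have "W y = - 2 * d * ?S - d\<^sup>2 * (4 * wp (y + y))" by (simp only: mult_2[of y])
      thus ?thesis by (simp add: power2_eq_square algebra_simps)
    qed
    ultimately show ?thesis by (auto intro: Lim_transform_eventually)
  qed
  moreover have "\<forall>\<^sub>F u in at y. D u = D x" using near[of y] by eventually_elim (rule const)
  ultimately have "((\<lambda>_. D x) \<longlongrightarrow> 0) (at y)" by (rule Lim_transform_eventually)
  hence "D x = 0" by (simp add: tendsto_const_iff)
  thus ?thesis by (simp add: D_def F_def G_def W_def A_def B_def)
qed

end

section \<open>Second-order linear differential equations on convex domains\<close>

locale convex_domain =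
  fixes \<Omega> :: "complex set" and x :: complex
  assumes open_dom: "open \<Omega>" and convex_dom: "convex \<Omega>" and base_in_dom: "x \<in> \<Omega>"
begin

text \<open>Convexity makes this a primitive of every holomorphic function. An explicit integral
  along a segment, unlike an abstract primitive, can be estimated and is linear in its
  integrand.\<close>

definition prim :: "(complex \<Rightarrow> complex) \<Rightarrow> complex \<Rightarrow> complex" where
  "prim h z = contour_integral (linepath x z) h"

lemma segment_in_dom: "z \<in> \<Omega> \<Longrightarrow> closed_segment x z \<subseteq> \<Omega>"
  using convex_dom base_in_dom by (simp add: closed_segment_subset)

lemma prim_has_contour_integral:
  assumes "h holomorphic_on \<Omega>" "z \<in> \<Omega>"
  shows "(h has_contour_integral prim h z) (linepath x z)"
  unfolding prim_def using assms segment_in_dom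
  by (intro has_contour_integral_integral contour_integrable_continuous_linepath)
     (meson holomorphic_on_imp_continuous_on holomorphic_on_subset)

lemma prim_deriv:
  assumes "h holomorphic_on \<Omega>" "z \<in> \<Omega>"
  shows "(prim h has_field_derivative h z) (at z)"
proof -
  obtain g where g: "\<And>z. z \<in> \<Omega> \<Longrightarrow> (g has_field_derivative h z) (at z within \<Omega>)"
    using holomorphic_convex_primitive'[OF convex_dom open_dom assms(1)] by blast
  have "prim h z = g z - g x" if "z \<in> \<Omega>" for z
  proof -
    have "(h has_contour_integral (g (pathfinish (linepath x z)) - g (pathstart (linepath x z)))) (linepath x z)"
      using g segment_in_dom[OF that] by (intro contour_integral_primitive[of \<Omega>]) auto
    thus ?thesis unfolding prim_def by (simp add: contour_integral_unique)
  qed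
  moreover have "((\<lambda>z. g z - g x) has_field_derivative h z - 0) (at z)"
    using g[OF assms(2)] assms(2) by (intro DERIV_diff DERIV_const) (simp add: at_within_open[OF _ open_dom])
  ultimately show ?thesis
    using assms(2) eventually_nhds_in_open[OF open_dom assms(2)]
    by (subst DERIV_cong_ev[OF refl _ refl]) (auto elim!: eventually_mono)
qed

lemma prim_base [simp]: "prim h x = 0"
  by (simp add: prim_def)

lemma prim_holomorphic: "h holomorphic_on \<Omega> \<Longrightarrow> prim h holomorphic_on \<Omega>"
  using prim_deriv by (auto simp: holomorphic_on_open[OF open_dom])

lemma prim_cong: "(\<And>w. w \<in> \<Omega> \<Longrightarrow> h w = g w) \<Longrightarrow> z \<in> \<Omega> \<Longrightarrow> prim h z = prim g z"
  unfolding prim_def using segment_in_dom[of z] by (intro contour_integral_eq) auto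

lemma prim_add:
  assumes "h holomorphic_on \<Omega>" "g holomorphic_on \<Omega>" "z \<in> \<Omega>"
  shows "prim (\<lambda>w. h w + g w) z = prim h z + prim g z"
  using has_contour_integral_add[OF prim_has_contour_integral[OF assms(1,3)] prim_has_contour_integral[OF assms(2,3)]]
  by (simp add: prim_def contour_integral_unique)

lemma prim_cmult:
  assumes "h holomorphic_on \<Omega>" "z \<in> \<Omega>"
  shows "prim (\<lambda>w. c * h w) z = c * prim h z"
  using has_contour_integral_lmul[OF prim_has_contour_integral[OF assms], of c]
  by (simp add: prim_def contour_integral_unique)

text \<open>Each integration of a power of the distance to the base point gains a denominator;
  iterated, these are the factorials that make the Picard series converge for all
  parameters.\<close>

lemma prim_bound:
  assumes h: "h holomorphic_on \<Omega>" and z: "z \<in> \<Omega>"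
    and le: "\<And>w. w \<in> closed_segment x z \<Longrightarrow> norm (h w) \<le> B * norm (w - x) ^ n"
  shows "norm (prim h z) \<le> B * norm (z - x) ^ Suc n / real (Suc n)"
proof -
  have 1: "((\<lambda>r. h (linepath x z r) * (z - x)) has_integral prim h z) {0..1}"
    using prim_has_contour_integral[OF h z] by (simp add: has_contour_integral_linepath)
  have 2: "((\<lambda>r::real. B * norm (z - x) ^ Suc n * r ^ n) has_integral
            B * norm (z - x) ^ Suc n * (1 ^ Suc n / real (Suc n)) - B * norm (z - x) ^ Suc n * (0 ^ Suc n / real (Suc n))) {0..1}"
  proof (rule fundamental_theorem_of_calculus)
    fix r :: real
    have "((\<lambda>r::real. B * norm (z - x) ^ Suc n * (r ^ Suc n / real (Suc n))) has_field_derivative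
            B * norm (z - x) ^ Suc n * (real (Suc n) * r ^ n / real (Suc n))) (at r within {0..1})"
      using DERIV_cmult[OF DERIV_cdivide[OF DERIV_pow[of "Suc n" r "{0..1}"]],
          of "B * norm (z - x) ^ Suc n" "real (Suc n)"] by (simp del: of_nat_Suc)
    thus "((\<lambda>r::real. B * norm (z - x) ^ Suc n * (r ^ Suc n / real (Suc n))) has_vector_derivative
            B * norm (z - x) ^ Suc n * r ^ n) (at r within {0..1})"
      by (simp add: has_real_derivative_iff_has_vector_derivative del: of_nat_Suc)
  qed simp
  have "norm (prim h z) = norm (integral {0..1} (\<lambda>r. h (linepath x z r) * (z - x)))"
    by (simp only: integral_unique[OF 1])
  also have "\<dots> \<le> integral {0..1} (\<lambda>r. B * norm (z - x) ^ Suc n * r ^ n)"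
  proof (rule integral_norm_bound_integral)
    fix r :: real assume r: "r \<in> {0..1}"
    have lx: "linepath x z r - x = of_real r * (z - x)"
      by (simp add: linepath_def algebra_simps scaleR_conv_of_real)
    have "linepath x z r \<in> closed_segment x z" using r by (auto simp: linepath_in_path)
    from le[OF this] have "norm (h (linepath x z r)) \<le> B * (r * norm (z - x)) ^ n"
      using r by (simp add: lx norm_mult)
    hence "norm (h (linepath x z r)) * norm (z - x) \<le> B * (r * norm (z - x)) ^ n * norm (z - x)"
      by (rule mult_right_mono) simp
    thus "norm (h (linepath x z r) * (z - x)) \<le> B * norm (z - x) ^ Suc n * r ^ n"
      by (simp add: norm_mult power_mult_distrib mult_ac)
  qed (use 1 2 in \<open>auto simp: has_integral_integrable\<close>)
  also have "\<dots> = B * norm (z - x) ^ Suc n / real (Suc n)"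
    using integral_unique[OF 2] by simp
  finally show ?thesis .
qed

section \<open>Solutions of f'' = Q f and their uniqueness\<close>

definition solves :: "(complex \<Rightarrow> complex) \<Rightarrow> (complex \<Rightarrow> complex) \<Rightarrow> bool" where
  "solves Q f \<longleftrightarrow> f holomorphic_on \<Omega> \<and> (\<forall>z\<in>\<Omega>. deriv (deriv f) z = Q z * f z)"

lemma solvesD:
  assumes "solves Q f" "z \<in> \<Omega>"
  shows "(f has_field_derivative deriv f z) (at z)" "(deriv f has_field_derivative Q z * f z) (at z)"
proof -
  show "(f has_field_derivative deriv f z) (at z)"
    using assms open_dom by (auto simp: solves_def intro: holomorphic_derivI)
  have "(deriv f has_field_derivative deriv (deriv f) z) (at z)"
    using assms open_dom
    by (intro holomorphic_derivI[of _ \<Omega>] holomorphic_deriv) (auto simp: solves_def)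
  thus "(deriv f has_field_derivative Q z * f z) (at z)" using assms by (simp add: solves_def)
qed

lemma solvesI:
  assumes "\<And>z. z \<in> \<Omega> \<Longrightarrow> (f has_field_derivative f' z) (at z)"
    and "\<And>z. z \<in> \<Omega> \<Longrightarrow> (f' has_field_derivative Q z * f z) (at z)"
  shows "solves Q f"
proof -
  have "deriv (deriv f) z = Q z * f z" if z: "z \<in> \<Omega>" for z
  proof -
    have "\<forall>\<^sub>F w in nhds z. deriv f w = f' w"
      using eventually_nhds_in_open[OF open_dom z]
      by eventually_elim (auto intro: DERIV_imp_deriv assms)
    hence "deriv (deriv f) z = deriv f' z" by (rule deriv_cong_ev) simp
    thus ?thesis using DERIV_imp_deriv[OF assms(2)[OF z]] by simp
  qed
  moreover have "f holomorphic_on \<Omega>" using assms(1) by (auto simp: holomorphic_on_open[OF open_dom])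
  ultimately show ?thesis by (simp add: solves_def)
qed

lemma solves_lincomb:
  assumes "solves Q f" "solves Q g"
  shows "solves Q (\<lambda>z. a * f z + b * g z)"
proof (rule solvesI)
  fix z assume z: "z \<in> \<Omega>"
  show "((\<lambda>z. a * f z + b * g z) has_field_derivative a * deriv f z + b * deriv g z) (at z)"
    by (intro DERIV_add DERIV_cmult solvesD[OF assms(1)] solvesD[OF assms(2)] z)
  have "((\<lambda>z. a * deriv f z + b * deriv g z) has_field_derivative a * (Q z * f z) + b * (Q z * g z)) (at z)"
    by (intro DERIV_add DERIV_cmult solvesD[OF assms(1)] solvesD[OF assms(2)] z)
  thus "((\<lambda>z. a * deriv f z + b * deriv g z) has_field_derivative Q z * (a * f z + b * g z)) (at z)"
    by (simp add: algebra_simps)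
qed

text \<open>Differentiating the equation by the Leibniz rule expresses every Taylor coefficient at x
  through coefficients lower by at least 2, so all vanish and the identity theorem applies.\<close>

lemma solves_zero:
  assumes Q: "Q holomorphic_on \<Omega>" and f: "solves Q f" and init: "f x = 0" "deriv f x = 0" and z: "z \<in> \<Omega>"
  shows "f z = 0"
proof -
  have fh: "f holomorphic_on \<Omega>" using f by (simp add: solves_def)
  have "(deriv ^^ n) f x = 0" for n
  proof (induction n rule: less_induct)
    case (less n)
    show ?case
    proof (cases "n < 2")
      case True
      hence "n = 0 \<or> n = 1" by auto
      thus ?thesis using init by auto
    next
      case False
      then obtain m where n: "n = m + 2" by (metis add.commute le_Suc_ex not_less)
      have "(deriv ^^ n) f x = (deriv ^^ m) (deriv (deriv f)) x"
        by (simp only: n funpow_add o_apply numeral_2_eq_2 funpow.simps id_apply)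
      also have "\<dots> = (deriv ^^ m) (\<lambda>z. Q z * f z) x"
        using f by (intro higher_deriv_transform_within_open[OF _ _ open_dom base_in_dom]
            holomorphic_deriv holomorphic_intros Q fh open_dom) (auto simp: solves_def)
      also have "\<dots> = (\<Sum>i=0..m. of_nat (m choose i) * (deriv ^^ i) Q x * (deriv ^^ (m - i)) f x)"
        by (rule higher_deriv_mult[OF Q fh open_dom base_in_dom])
      also have "\<dots> = 0" using less.IH by (intro sum.neutral) (auto simp: n)
      finally show ?thesis .
    qed
  qed
  thus ?thesis
    using holomorphic_fun_eq_0_on_connected[OF fh open_dom convex_connected[OF convex_dom] _ base_in_dom z] by blast
qed

lemma solves_unique:
  assumes "Q holomorphic_on \<Omega>" "solves Q f" "solves Q g" "f x = g x" "deriv f x = deriv g x" "z \<in> \<Omega>"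
  shows "f z = g z"
proof -
  have "solves Q (\<lambda>z. 1 * f z + (- 1) * g z)" by (intro solves_lincomb assms)
  hence s: "solves Q (\<lambda>z. f z - g z)" by simp
  have "deriv (\<lambda>z. f z - g z) x = deriv f x - deriv g x"
    by (intro DERIV_imp_deriv DERIV_diff solvesD(1)[OF assms(2) base_in_dom] solvesD(1)[OF assms(3) base_in_dom])
  with solves_zero[OF assms(1) s _ _ assms(6)] assms(4,5) show ?thesis by simp
qed

subsection \<open>Picard iteration, with a polynomial parameter\<close>

text \<open>Polynomials in p with coefficients holomorphic in z, given by closure rules so that a
  short induction shows that integration in z preserves them. Holomorphy of the Picard terms in p
  then follows without differentiating an integral in a parameter. \<open>pf_cong\<close> compares
  values on \<Omega> only, because integrals see nothing else.\<close>

inductive poly_family :: "(complex \<Rightarrow> complex \<Rightarrow> complex) \<Rightarrow> bool" where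
  pf_const: "h holomorphic_on \<Omega> \<Longrightarrow> poly_family (\<lambda>p. h)"
| pf_add: "poly_family h \<Longrightarrow> poly_family g \<Longrightarrow> poly_family (\<lambda>p z. h p z + g p z)"
| pf_mult: "poly_family h \<Longrightarrow> poly_family (\<lambda>p z. p * h p z)"
| pf_cong: "poly_family h \<Longrightarrow> (\<And>p z. z \<in> \<Omega> \<Longrightarrow> g p z = h p z) \<Longrightarrow> poly_family g"

lemma poly_family_holomorphic: "poly_family h \<Longrightarrow> h p holomorphic_on \<Omega>"
proof (induction rule: poly_family.induct)
  case (pf_cong h g)
  show ?case by (rule holomorphic_transform[OF pf_cong.IH]) (use pf_cong in auto)
qed (auto intro!: holomorphic_intros)

lemma poly_family_holomorphic_param: "poly_family h \<Longrightarrow> z \<in> \<Omega> \<Longrightarrow> (\<lambda>p. h p z) holomorphic_on UNIV"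
proof (induction rule: poly_family.induct)
  case (pf_cong h g)
  show ?case by (rule holomorphic_transform[OF pf_cong.IH]) (use pf_cong in auto)
qed (auto intro!: holomorphic_intros)

lemma poly_family_prim: "poly_family h \<Longrightarrow> poly_family (\<lambda>p. prim (h p))"
proof (induction rule: poly_family.induct)
  case (pf_const h) thus ?case by (intro poly_family.pf_const prim_holomorphic)
next
  case (pf_add h g)
  show ?case
    by (rule poly_family.pf_cong[OF poly_family.pf_add[OF pf_add.IH]])
       (rule prim_add; use pf_add.hyps in \<open>auto intro: poly_family_holomorphic\<close>)
next
  case (pf_mult h)
  show ?case
    by (rule poly_family.pf_cong[OF poly_family.pf_mult[OF pf_mult.IH]])
       (rule prim_cmult; use pf_mult.hyps in \<open>auto intro: poly_family_holomorphic\<close>)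
next
  case (pf_cong h g)
  show ?case by (rule poly_family.pf_cong[OF pf_cong.IH]) (rule prim_cong; use pf_cong.hyps in auto)
qed

lemma poly_family_cmult:
  assumes "q holomorphic_on \<Omega>"
  shows "poly_family h \<Longrightarrow> poly_family (\<lambda>p z. q z * h p z)"
proof (induction rule: poly_family.induct)
  case (pf_const h) thus ?case using assms by (intro poly_family.pf_const holomorphic_intros)
next
  case (pf_add h g)
  show ?case by (rule poly_family.pf_cong[OF poly_family.pf_add[OF pf_add.IH]]) (simp add: algebra_simps)
next
  case (pf_mult h)
  show ?case by (rule poly_family.pf_cong[OF poly_family.pf_mult[OF pf_mult.IH]]) simp
next
  case (pf_cong h g)
  show ?case by (rule poly_family.pf_cong[OF pf_cong.IH]) (use pf_cong.hyps in auto)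
qed

end

text \<open>Degree two covers both later uses: the parameter p of the energy -(p / c)^2, and a
  common shift r / 2 of all exponents, which enter the potential through products of two linear
  factors.\<close>

locale quadratic_family = convex_domain +
  fixes q0 q1 q2 :: "complex \<Rightarrow> complex"
  assumes q_holomorphic: "q0 holomorphic_on \<Omega>" "q1 holomorphic_on \<Omega>" "q2 holomorphic_on \<Omega>"
begin

definition Q :: "complex \<Rightarrow> complex \<Rightarrow> complex" where
  "Q p z = q0 z + p * q1 z + p\<^sup>2 * q2 z"

lemma Q_holomorphic: "Q p holomorphic_on \<Omega>"
  unfolding Q_def[abs_def] by (intro holomorphic_intros q_holomorphic)

text \<open>These are the summands of the series, not its partial sums: the second derivative of
  each summand is Q times the previous one, and only the linear summand contributes to the initial
  values.\<close>

fun picard :: "complex \<Rightarrow> complex \<Rightarrow> nat \<Rightarrow> complex \<Rightarrow> complex \<Rightarrow> complex" where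
  "picard a b 0 p = (\<lambda>z. a + b * (z - x))"
| "picard a b (Suc n) p = prim (prim (\<lambda>w. Q p w * picard a b n p w))"

lemma picard_poly_family: "poly_family (picard a b n)"
proof (induction n)
  case 0
  have "picard a b 0 = (\<lambda>p z. a + b * (z - x))" by (simp add: fun_eq_iff)
  thus ?case by (simp only:) (intro poly_family.pf_const holomorphic_intros)
next
  case (Suc n)
  have "poly_family (\<lambda>p w. Q p w * picard a b n p w)"
  proof (rule poly_family.pf_cong)
    show "poly_family (\<lambda>p w. q0 w * picard a b n p w +
            (p * (q1 w * picard a b n p w) + p * (p * (q2 w * picard a b n p w))))"
      by (intro poly_family.pf_add poly_family.pf_mult poly_family_cmult q_holomorphic Suc.IH)
  qed (simp add: Q_def algebra_simps power2_eq_square)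
  hence "poly_family (\<lambda>p. prim (prim (\<lambda>w. Q p w * picard a b n p w)))"
    by (intro poly_family_prim)
  thus ?case by (rule poly_family.pf_cong) simp
qed

lemma picard_holomorphic: "picard a b n p holomorphic_on \<Omega>"
  using picard_poly_family by (rule poly_family_holomorphic)

text \<open>Two integrations per summand produce (2 n)!. The set K is star-shaped about x, so that
  the induction hypothesis is available on the whole segment of integration.\<close>

lemma picard_bound:
  assumes K: "K \<subseteq> \<Omega>" "\<And>z. z \<in> K \<Longrightarrow> closed_segment x z \<subseteq> K"
    and B: "\<And>w. w \<in> K \<Longrightarrow> norm (Q p w) \<le> B" "B \<ge> 0"
    and A: "\<And>w. w \<in> K \<Longrightarrow> norm (a + b * (w - x)) \<le> A"
    and z: "z \<in> K"
  shows "norm (picard a b n p z) \<le> A * B ^ n / fact (2 * n) * norm (z - x) ^ (2 * n)"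
  using z
proof (induction n arbitrary: z)
  case 0 thus ?case using A by simp
next
  case (Suc n)
  have hol: "(\<lambda>w. Q p w * picard a b n p w) holomorphic_on \<Omega>"
    by (intro holomorphic_intros Q_holomorphic picard_holomorphic)
  let ?C = "A * B ^ Suc n / fact (2 * n)"
  have 1: "norm (Q p w * picard a b n p w) \<le> ?C * norm (w - x) ^ (2 * n)" if "w \<in> K" for w
  proof -
    have "norm (Q p w * picard a b n p w) \<le> B * (A * B ^ n / fact (2 * n) * norm (w - x) ^ (2 * n))"
      unfolding norm_mult using B Suc.IH that by (intro mult_mono) auto
    thus ?thesis by (simp add: mult_ac)
  qed
  have 2: "norm (prim (\<lambda>w. Q p w * picard a b n p w) w) \<le> ?C / real (Suc (2 * n)) * norm (w - x) ^ Suc (2 * n)"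
    if w: "w \<in> K" for w
  proof -
    have "norm (prim (\<lambda>w. Q p w * picard a b n p w) w) \<le> ?C * norm (w - x) ^ Suc (2 * n) / real (Suc (2 * n))"
      using K w by (intro prim_bound hol 1) auto
    thus ?thesis by simp
  qed
  have "norm (prim (prim (\<lambda>w. Q p w * picard a b n p w)) z) \<le>
      ?C / real (Suc (2 * n)) * norm (z - x) ^ Suc (Suc (2 * n)) / real (Suc (Suc (2 * n)))"
    using K Suc.prems by (intro prim_bound prim_holomorphic hol 2) auto
  also have "\<dots> = A * B ^ Suc n / fact (2 * Suc n) * norm (z - x) ^ (2 * Suc n)"
    by (simp add: divide_simps)
  finally show ?case by simp
qed

definition picard_sum :: "complex \<Rightarrow> complex \<Rightarrow> complex \<Rightarrow> complex \<Rightarrow> complex" where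
  "picard_sum a b p z = (\<Sum>n. picard a b n p z)"

lemma Q_bounded:
  assumes "compact K" "K \<subseteq> \<Omega>"
  obtains B where "B \<ge> 0" "\<And>w p. w \<in> K \<Longrightarrow> norm p \<le> R \<Longrightarrow> norm (Q p w) \<le> B"
proof -
  have bd: "\<exists>B\<ge>0. \<forall>w\<in>K. norm (q w) \<le> B" if "q holomorphic_on \<Omega>" for q :: "complex \<Rightarrow> complex"
  proof -
    have "continuous_on K q"
      using that assms(2) holomorphic_on_imp_continuous_on holomorphic_on_subset by blast
    hence "bounded (q ` K)" using assms(1) by (intro compact_imp_bounded compact_continuous_image)
    then obtain B where "\<And>w. w \<in> K \<Longrightarrow> norm (q w) \<le> B" by (auto simp: bounded_iff)
    thus ?thesis by (intro exI[of _ "max 0 B"]) (auto simp: le_max_iff_disj)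
  qed
  obtain B0 where B0: "B0 \<ge> 0" "\<And>w. w \<in> K \<Longrightarrow> norm (q0 w) \<le> B0" using bd q_holomorphic by blast
  obtain B1 where B1: "B1 \<ge> 0" "\<And>w. w \<in> K \<Longrightarrow> norm (q1 w) \<le> B1" using bd q_holomorphic by blast
  obtain B2 where B2: "B2 \<ge> 0" "\<And>w. w \<in> K \<Longrightarrow> norm (q2 w) \<le> B2" using bd q_holomorphic by blast
  show ?thesis
  proof (rule that[of "B0 + \<bar>R\<bar> * B1 + R\<^sup>2 * B2"])
    fix w p :: complex assume w: "w \<in> K" and p: "norm p \<le> R"
    have "norm (Q p w) \<le> norm (q0 w) + norm p * norm (q1 w) + norm p ^ 2 * norm (q2 w)"
      unfolding Q_def by (intro norm_triangle_le add_mono) (auto simp: norm_mult norm_power)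
    also have "\<dots> \<le> B0 + \<bar>R\<bar> * B1 + R\<^sup>2 * B2"
      using B0 B1 B2 w p by (intro add_mono mult_mono power_mono) auto
    finally show "norm (Q p w) \<le> B0 + \<bar>R\<bar> * B1 + R\<^sup>2 * B2" .
  qed (use B0 B1 B2 in auto)
qed

lemma picard_uniform:
  assumes K: "compact K" "K \<subseteq> \<Omega>" "\<And>z. z \<in> K \<Longrightarrow> closed_segment x z \<subseteq> K"
  shows "uniform_limit (cball 0 R \<times> K) (\<lambda>n (p, z). \<Sum>i<n. picard a b i p z)
           (\<lambda>(p, z). picard_sum a b p z) sequentially"
proof -
  obtain B where B: "B \<ge> 0" "\<And>w p. w \<in> K \<Longrightarrow> norm p \<le> R \<Longrightarrow> norm (Q p w) \<le> B"
    using Q_bounded[OF K(1,2), of R] by blast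
  have "bounded K" using K(1) by (rule compact_imp_bounded)
  then obtain \<rho> where \<rho>: "\<rho> \<ge> 0" "\<And>z. z \<in> K \<Longrightarrow> norm (z - x) \<le> \<rho>"
    by (metis bounded_iff dist_norm dist_commute bounded_any_center[of K x] abs_ge_zero abs_ge_self order_trans)
  define A where "A = norm a + norm b * \<rho>"
  have A: "norm (a + b * (w - x)) \<le> A" if "w \<in> K" for w
    unfolding A_def using \<rho> that
    by (intro norm_triangle_le add_mono) (auto simp: norm_mult intro: mult_left_mono)
  have A0: "A \<ge> 0" using \<rho> by (simp add: A_def)
  define M where "M = (\<lambda>n. A * ((B * \<rho>\<^sup>2) ^ n / fact n))"
  have "norm (picard a b n p z) \<le> M n" if "p \<in> cball 0 R" "z \<in> K" for n p z
  proof -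
    have "norm (picard a b n p z) \<le> A * B ^ n / fact (2 * n) * norm (z - x) ^ (2 * n)"
      using that B A by (intro picard_bound[of K] K) auto
    \<comment> \<open>Weakening (2 n)! to n! turns the majorant into an exponential series.\<close>
    also have "\<dots> \<le> A * B ^ n / fact n * \<rho> ^ (2 * n)"
      using A0 B(1) \<rho> that by (intro mult_mono divide_left_mono power_mono fact_mono) auto
    also have "\<dots> = M n" by (simp add: M_def power_mult_distrib power_mult)
    finally show ?thesis .
  qed
  moreover have "summable M" unfolding M_def
    using summable_exp[of "B * \<rho>\<^sup>2"] by (intro summable_mult) (simp add: field_simps)
  ultimately have "uniform_limit (cball 0 R \<times> K) (\<lambda>n pz. \<Sum>i<n. picard a b i (fst pz) (snd pz))
           (\<lambda>pz. \<Sum>i. picard a b i (fst pz) (snd pz)) sequentially"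
    by (intro Weierstrass_m_test) auto
  thus ?thesis by (simp add: picard_sum_def case_prod_unfold)
qed

lemma picard_sum_holomorphic_param:
  assumes "z \<in> \<Omega>"
  shows "(\<lambda>p. picard_sum a b p z) holomorphic_on UNIV"
proof -
  have "(\<lambda>p. picard_sum a b p z) field_differentiable at p" for p
  proof -
    define R where "R = norm p + 1"
    have "uniform_limit (cball 0 R \<times> closed_segment x z) (\<lambda>n (p, z). \<Sum>i<n. picard a b i p z)
           (\<lambda>(p, z). picard_sum a b p z) sequentially"
      using segment_in_dom[OF assms] by (intro picard_uniform) (auto simp: subset_closed_segment)
    hence ul: "uniform_limit (cball 0 R) (\<lambda>n p. \<Sum>i<n. picard a b i p z) (\<lambda>p. picard_sum a b p z) sequentially"
      by (auto simp: uniform_limit_iff elim!: eventually_mono)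
    have "(\<lambda>p. \<Sum>i<n. picard a b i p z) holomorphic_on UNIV" for n
      by (intro holomorphic_intros poly_family_holomorphic_param picard_poly_family assms)
    hence "\<forall>\<^sub>F n in sequentially. continuous_on (cball 0 R) (\<lambda>p. \<Sum>i<n. picard a b i p z) \<and>
            (\<lambda>p. \<Sum>i<n. picard a b i p z) holomorphic_on ball 0 R"
      by (intro always_eventually allI conjI)
         (auto intro: holomorphic_on_subset holomorphic_on_imp_continuous_on)
    hence "(\<lambda>p. picard_sum a b p z) holomorphic_on ball 0 R"
      using holomorphic_uniform_limit[OF _ ul] by auto
    thus ?thesis by (rule holomorphic_on_imp_differentiable_at) (auto simp: R_def)
  qed
  thus ?thesis by (auto simp: holomorphic_on_def intro: field_differentiable_at_within)
qed

lemma picard_sum_limits: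
  assumes z: "z \<in> \<Omega>"
  shows "picard_sum a b p field_differentiable at z"
    and "(\<lambda>n. \<Sum>i<n. (deriv ^^ m) (picard a b i p) z) \<longlonglongrightarrow> (deriv ^^ m) (picard_sum a b p) z"
proof -
  obtain r where r: "r > 0" "cball z r \<subseteq> \<Omega>" using open_dom z open_contains_cball by blast
  \<comment> \<open>The hull is star-shaped about x, as the estimates require, and contains a ball
    around z, on which uniform convergence permits termwise differentiation.\<close>
  define K where "K = convex hull (insert x (cball z r))"
  have K: "compact K" "K \<subseteq> \<Omega>" "cball z r \<subseteq> K" "convex K" "x \<in> K"
  proof -
    show "compact K" unfolding K_def by (intro compact_convex_hull compact_insert compact_cball)
    show "K \<subseteq> \<Omega>" unfolding K_def using r base_in_dom convex_dom by (intro hull_minimal) auto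
    have "insert x (cball z r) \<subseteq> K" unfolding K_def by (rule hull_subset)
    thus "cball z r \<subseteq> K" "x \<in> K" by auto
    show "convex K" unfolding K_def by (rule convex_convex_hull)
  qed
  have "uniform_limit (cball 0 (norm p) \<times> K) (\<lambda>n (p, z). \<Sum>i<n. picard a b i p z)
           (\<lambda>(p, z). picard_sum a b p z) sequentially"
    using K by (intro picard_uniform) (auto simp: closed_segment_subset)
  hence "uniform_limit K (\<lambda>n z. \<Sum>i<n. picard a b i p z) (picard_sum a b p) sequentially"
    by (auto simp: uniform_limit_iff elim!: eventually_mono)
  hence ul: "uniform_limit (cball z r) (\<lambda>n z. \<Sum>i<n. picard a b i p z) (picard_sum a b p) sequentially"
    using K(3) by (rule uniform_limit_on_subset)
  have hol: "(\<lambda>z. \<Sum>i<n. picard a b i p z) holomorphic_on cball z r" for n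
    using r(2) by (intro holomorphic_intros holomorphic_on_subset[OF picard_holomorphic])
  have hol': "(\<lambda>z. \<Sum>i<n. picard a b i p z) holomorphic_on ball z r" for n
    using hol ball_subset_cball by (rule holomorphic_on_subset)
  have "\<forall>\<^sub>F n in sequentially. continuous_on (cball z r) (\<lambda>z. \<Sum>i<n. picard a b i p z) \<and>
            (\<lambda>z. \<Sum>i<n. picard a b i p z) holomorphic_on ball z r"
    by (intro always_eventually allI conjI holomorphic_on_imp_continuous_on hol hol')
  hence "picard_sum a b p holomorphic_on ball z r"
    using holomorphic_uniform_limit[OF _ ul] by auto
  thus "picard_sum a b p field_differentiable at z"
    using r by (auto intro: holomorphic_on_imp_differentiable_at)
  have "(\<lambda>n. (deriv ^^ m) (\<lambda>z. \<Sum>i<n. picard a b i p z) z) \<longlonglongrightarrow> (deriv ^^ m) (picard_sum a b p) z"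
  proof (rule higher_deriv_complex_uniform_limit)
    show "uniform_limit (ball z r) (\<lambda>n z. \<Sum>i<n. picard a b i p z) (picard_sum a b p) sequentially"
      using ul by (rule uniform_limit_on_subset) auto
    show "\<forall>\<^sub>F n in sequentially. (\<lambda>z. \<Sum>i<n. picard a b i p z) holomorphic_on ball z r"
      by (intro always_eventually allI hol')
  qed (use r in auto)
  moreover have "(deriv ^^ m) (\<lambda>z. \<Sum>i<n. picard a b i p z) z = (\<Sum>i<n. (deriv ^^ m) (picard a b i p) z)" for n
    using z by (intro higher_deriv_sum[of _ _ \<Omega>] picard_holomorphic open_dom) auto
  ultimately show "(\<lambda>n. \<Sum>i<n. (deriv ^^ m) (picard a b i p) z) \<longlonglongrightarrow> (deriv ^^ m) (picard_sum a b p) z"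
    by simp
qed

lemma picard_Suc_derivs:
  assumes "z \<in> \<Omega>"
  shows "deriv (picard a b (Suc n) p) z = prim (\<lambda>w. Q p w * picard a b n p w) z"
    and "deriv (deriv (picard a b (Suc n) p)) z = Q p z * picard a b n p z"
proof -
  let ?h = "\<lambda>w. Q p w * picard a b n p w"
  have h: "?h holomorphic_on \<Omega>" by (intro holomorphic_intros Q_holomorphic picard_holomorphic)
  have 1: "deriv (picard a b (Suc n) p) z = prim ?h z" if "z \<in> \<Omega>" for z
    using prim_deriv[OF prim_holomorphic[OF h] that] by (simp add: DERIV_imp_deriv)
  thus "deriv (picard a b (Suc n) p) z = prim ?h z" using assms .
  have "deriv (deriv (picard a b (Suc n) p)) z = deriv (prim ?h) z"
    using eventually_nhds_in_open[OF open_dom assms]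
    by (intro deriv_cong_ev) (auto elim!: eventually_mono simp only: 1)
  also have "\<dots> = ?h z" using prim_deriv[OF h assms] by (rule DERIV_imp_deriv)
  finally show "deriv (deriv (picard a b (Suc n) p)) z = Q p z * picard a b n p z" .
qed

lemma picard_0_derivs: "deriv (picard a b 0 p) = (\<lambda>_. b)" "deriv (deriv (picard a b 0 p)) = (\<lambda>_. 0)"
proof -
  show *: "deriv (picard a b 0 p) = (\<lambda>_. b)"
    by (auto intro!: ext DERIV_imp_deriv derivative_eq_intros)
  show "deriv (deriv (picard a b 0 p)) = (\<lambda>_. 0)" unfolding * by simp
qed

lemma picard_sum_solves: "solves (Q p) (picard_sum a b p)"
  unfolding solves_def
proof (intro conjI ballI)
  show "picard_sum a b p holomorphic_on \<Omega>"
    using picard_sum_limits(1) by (auto simp: holomorphic_on_def intro: field_differentiable_at_within)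
  fix z assume z: "z \<in> \<Omega>"
  \<comment> \<open>One more term on the left: the linear summand has second derivative 0, and each
    of the others yields Q times its predecessor, so the sum up to Suc n becomes Q times the sum up
    to n.\<close>
  have "(\<lambda>n. \<Sum>i<Suc n. deriv (deriv (picard a b i p)) z) \<longlonglongrightarrow> deriv (deriv (picard_sum a b p)) z"
    using LIMSEQ_Suc[OF picard_sum_limits(2)[OF z, where m = 2]] by (simp only: numeral_2_eq_2 funpow.simps o_apply id_apply)
  moreover have "(\<Sum>i<Suc n. deriv (deriv (picard a b i p)) z) = Q p z * (\<Sum>i<n. (deriv ^^ 0) (picard a b i p) z)" for n
    unfolding sum.lessThan_Suc_shift picard_0_derivs picard_Suc_derivs[OF z] by (simp add: sum_distrib_left)
  moreover have "(\<lambda>n. Q p z * (\<Sum>i<n. (deriv ^^ 0) (picard a b i p) z)) \<longlonglongrightarrow> Q p z * (deriv ^^ 0) (picard_sum a b p) z"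
    by (intro tendsto_intros picard_sum_limits z)
  ultimately show "deriv (deriv (picard_sum a b p)) z = Q p z * picard_sum a b p z"
    using LIMSEQ_unique by simp
qed

lemma picard_sum_init: "picard_sum a b p x = a" "deriv (picard_sum a b p) x = b"
proof -
  have "(\<lambda>n. \<Sum>i<Suc n. (deriv ^^ 0) (picard a b i p) x) \<longlonglongrightarrow> picard_sum a b p x"
    using LIMSEQ_Suc[OF picard_sum_limits(2)[OF base_in_dom, where m = 0]] by simp
  moreover have "(\<Sum>i<Suc n. (deriv ^^ 0) (picard a b i p) x) = a" for n
    unfolding sum.lessThan_Suc_shift by simp
  ultimately show "picard_sum a b p x = a" by (simp add: LIMSEQ_const_iff)
  have "(\<lambda>n. \<Sum>i<Suc n. deriv (picard a b i p) x) \<longlonglongrightarrow> deriv (picard_sum a b p) x"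
    using LIMSEQ_Suc[OF picard_sum_limits(2)[OF base_in_dom, where m = 1]] by simp
  moreover have "(\<Sum>i<Suc n. deriv (picard a b i p) x) = b" for n
    unfolding sum.lessThan_Suc_shift picard_0_derivs picard_Suc_derivs[OF base_in_dom] by simp
  ultimately show "deriv (picard_sum a b p) x = b" by (simp add: LIMSEQ_const_iff)
qed

end

context convex_domain
begin

lemma solution_exists:
  assumes "Q holomorphic_on \<Omega>"
  obtains f where "solves Q f" "f x = a" "deriv f x = b"
proof -
  interpret R: quadratic_family \<Omega> x Q "\<lambda>_. 0" "\<lambda>_. 0"
    by unfold_locales (use assms in simp_all)
  have "R.Q 0 = Q" by (simp add: fun_eq_iff R.Q_def)
  with R.picard_sum_solves[of 0 a b] show ?thesis
    by (intro that[of "R.picard_sum a b 0"]) (simp_all add: R.picard_sum_init)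
qed

end

section \<open>The discriminant of a periodic equation\<close>

definition wronskian :: "(complex \<Rightarrow> complex) \<Rightarrow> (complex \<Rightarrow> complex) \<Rightarrow> complex \<Rightarrow> complex" where
  "wronskian f g z = f z * deriv g z - deriv f z * g z"

locale periodic_domain = convex_domain +
  fixes c :: complex
  assumes shift_iff [simp]: "z + c \<in> \<Omega> \<longleftrightarrow> z \<in> \<Omega>"
begin

lemma shift_minus_iff [simp]: "z - c \<in> \<Omega> \<longleftrightarrow> z \<in> \<Omega>"
  using shift_iff[of "z - c"] by simp

definition periodic :: "(complex \<Rightarrow> complex) \<Rightarrow> bool" where
  "periodic Q \<longleftrightarrow> (\<forall>z\<in>\<Omega>. Q (z + c) = Q z)"

lemma periodic_minus: "periodic Q \<Longrightarrow> z \<in> \<Omega> \<Longrightarrow> Q (z - c) = Q z"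
  using shift_minus_iff[of z] bspec[of \<Omega> "\<lambda>z. Q (z + c) = Q z" "z - c"] by (simp add: periodic_def)

lemma wronskian_const:
  assumes "solves Q f" "solves Q g" "z \<in> \<Omega>" "w \<in> \<Omega>"
  shows "wronskian f g z = wronskian f g w"
proof -
  have "((wronskian f g) has_field_derivative 0) (at z within \<Omega>)" if z: "z \<in> \<Omega>" for z
  proof -
    have "((\<lambda>z. f z * deriv g z - deriv f z * g z) has_field_derivative
           (deriv f z * deriv g z + (Q z * g z) * f z) - ((Q z * f z) * g z + deriv g z * deriv f z)) (at z)"
      by (intro DERIV_diff DERIV_mult solvesD[OF assms(1) z] solvesD[OF assms(2) z])
    hence "((\<lambda>z. f z * deriv g z - deriv f z * g z) has_field_derivative 0) (at z)"
      by (simp add: algebra_simps)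
    thus ?thesis unfolding wronskian_def[abs_def] by (rule has_field_derivative_at_within)
  qed
  from has_field_derivative_zero_constant[OF convex_dom this] assms(3,4) show ?thesis by auto
qed

lemma solves_shift:
  assumes "solves Q f" "\<And>z. z \<in> \<Omega> \<Longrightarrow> z + a \<in> \<Omega> \<and> Q (z + a) = Q z"
  shows "solves Q (\<lambda>z. f (z + a))" and "z \<in> \<Omega> \<Longrightarrow> deriv (\<lambda>z. f (z + a)) z = deriv f (z + a)"
proof -
  have 1: "((\<lambda>z. f (z + a)) has_field_derivative deriv f (z + a)) (at z)" if z: "z \<in> \<Omega>" for z
    using DERIV_shift[of f "deriv f (z + a)" z a] solvesD(1)[OF assms(1)] assms(2)[OF z] by simp
  show "solves Q (\<lambda>z. f (z + a))"
  proof (rule solvesI[OF 1])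
    fix z assume z: "z \<in> \<Omega>"
    show "((\<lambda>z. deriv f (z + a)) has_field_derivative Q z * f (z + a)) (at z)"
      using DERIV_shift[of "deriv f" "Q (z + a) * f (z + a)" z a] solvesD(2)[OF assms(1), of "z + a"] assms(2)[OF z]
      by simp
  qed
  show "deriv (\<lambda>z. f (z + a)) z = deriv f (z + a)" if "z \<in> \<Omega>"
    using 1[OF that] by (rule DERIV_imp_deriv)
qed

lemma wronskian_shift:
  assumes "solves Q f" "solves Q g" "\<And>z. z \<in> \<Omega> \<Longrightarrow> z + a \<in> \<Omega> \<and> Q (z + a) = Q z" "z \<in> \<Omega>"
  shows "wronskian (\<lambda>z. f (z + a)) (\<lambda>z. g (z + a)) z = wronskian f g z"
proof -
  have "wronskian (\<lambda>z. f (z + a)) (\<lambda>z. g (z + a)) z = wronskian f g (z + a)"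
    using solves_shift(2)[OF assms(1,3,4)] solves_shift(2)[OF assms(2,3,4)] by (simp add: wronskian_def)
  also have "\<dots> = wronskian f g z" using assms by (intro wronskian_const) auto
  finally show ?thesis .
qed

definition two_sided :: "(complex \<Rightarrow> complex) \<Rightarrow> complex \<Rightarrow> complex" where
  "two_sided f z = f (z + c) + f (z - c)"

lemma wronskian_add_left:
  assumes "solves Q f" "solves Q f'" "z \<in> \<Omega>"
  shows "wronskian (\<lambda>z. f z + f' z) g z = wronskian f g z + wronskian f' g z"
proof -
  have "deriv (\<lambda>z. f z + f' z) z = deriv f z + deriv f' z"
    by (intro DERIV_imp_deriv DERIV_add solvesD(1)[OF assms(1,3)] solvesD(1)[OF assms(2,3)])
  thus ?thesis by (simp add: wronskian_def algebra_simps)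
qed

lemma wronskian_commute: "wronskian f g z = - wronskian g f z"
  by (simp add: wronskian_def algebra_simps)

lemma solves_two_sided:
  assumes "periodic Q" "solves Q f"
  shows "solves Q (\<lambda>z. f (z + c))" "solves Q (\<lambda>z. f (z - c))" "solves Q (two_sided f)"
proof -
  show 1: "solves Q (\<lambda>z. f (z + c))"
    using assms by (intro solves_shift) (auto simp: periodic_def)
  show 2: "solves Q (\<lambda>z. f (z - c))"
    using solves_shift(1)[OF assms(2), of "- c"] periodic_minus[OF assms(1)] by simp
  show "solves Q (two_sided f)"
    using solves_lincomb[OF 1 2, of 1 1] by (simp add: two_sided_def[abs_def])
qed

text \<open>The shift is symplectic for the Wronskian, so the sum of the shift and its inverse is self-adjoint.\<close>

lemma wronskian_two_sided:
  assumes "periodic Q" "solves Q f" "solves Q g" "z \<in> \<Omega>"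
  shows "wronskian (two_sided f) g z = wronskian (\<lambda>z. f (z + c)) g z + wronskian f (\<lambda>z. g (z + c)) z"
    and "wronskian (two_sided f) g z = wronskian f (two_sided g) z"
proof -
  note sf = solves_two_sided[OF assms(1,2)] and sg = solves_two_sided[OF assms(1,3)]
  have per: "\<And>z. z \<in> \<Omega> \<Longrightarrow> z + c \<in> \<Omega> \<and> Q (z + c) = Q z" "\<And>z. z \<in> \<Omega> \<Longrightarrow> z + (- c) \<in> \<Omega> \<and> Q (z + (- c)) = Q z"
    using assms(1) periodic_minus[OF assms(1)] by (auto simp: periodic_def)
  have a: "wronskian (\<lambda>z. f (z - c)) g z = wronskian f (\<lambda>z. g (z + c)) z"
    using wronskian_shift[OF assms(2) sg(1) per(2) assms(4)] by simp
  have b: "wronskian (\<lambda>z. f (z + c)) g z = wronskian f (\<lambda>z. g (z - c)) z"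
    using wronskian_shift[OF assms(2) sg(2) per(1) assms(4)] by simp
  have "wronskian (two_sided f) g z = wronskian (\<lambda>z. f (z + c)) g z + wronskian (\<lambda>z. f (z - c)) g z"
    unfolding two_sided_def[abs_def] by (rule wronskian_add_left[OF sf(1,2) assms(4)])
  thus 1: "wronskian (two_sided f) g z = wronskian (\<lambda>z. f (z + c)) g z + wronskian f (\<lambda>z. g (z + c)) z"
    by (simp only: a)
  have "wronskian (two_sided g) f z = wronskian (\<lambda>z. g (z + c)) f z + wronskian (\<lambda>z. g (z - c)) f z"
    unfolding two_sided_def[abs_def] by (rule wronskian_add_left[OF sg(1,2) assms(4)])
  hence "wronskian f (two_sided g) z = wronskian f (\<lambda>z. g (z + c)) z + wronskian f (\<lambda>z. g (z - c)) z"
    by (simp add: wronskian_commute[of f])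
  with 1 b show "wronskian (two_sided f) g z = wronskian f (two_sided g) z" by simp
qed

text \<open>
  The trace of the shift by \<open>c\<close> on the space of solutions, in a form that involves values of a single
  solution only; this makes its analyticity in a parameter immediate.
\<close>

definition disc :: "(complex \<Rightarrow> complex) \<Rightarrow> complex" where
  "disc Q = two_sided (SOME f. solves Q f \<and> f x = 1 \<and> deriv f x = 0) x"

lemma disc_eq:
  assumes "Q holomorphic_on \<Omega>" "solves Q f" "f x = 1" "deriv f x = 0"
  shows "disc Q = two_sided f x"
proof -
  define g where "g = (SOME f. solves Q f \<and> f x = 1 \<and> deriv f x = 0)"
  have g: "solves Q g \<and> g x = 1 \<and> deriv g x = 0"
    unfolding g_def by (rule someI[of _ f]) (use assms in auto)
  have "g z = f z" if "z \<in> \<Omega>" for z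
    by (rule solves_unique[OF assms(1) _ assms(2) _ _ that]) (use g assms in auto)
  thus ?thesis using base_in_dom by (simp add: disc_def g_def[symmetric] two_sided_def)
qed

text \<open>Cayley-Hamilton for the shift T, which has determinant 1: T + 1/T = tr T. The Wronskian
  is an alternating form on a plane, and an operator that is self-adjoint for such a form is a
  scalar.\<close>

lemma two_sided_eq_disc:
  assumes Q: "Q holomorphic_on \<Omega>" "periodic Q" and f: "solves Q f" and z: "z \<in> \<Omega>"
  shows "two_sided f z = disc Q * f z"
proof -
  obtain C where C: "solves Q C" "C x = 1" "deriv C x = 0" using solution_exists[OF Q(1)] by blast
  obtain S where S: "solves Q S" "S x = 0" "deriv S x = 1" using solution_exists[OF Q(1)] by blast
  have T: "two_sided C x = disc Q" using disc_eq[OF Q(1) C] by simp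
  \<comment> \<open>By self-adjointness and antisymmetry this Wronskian equals its own negative.
    Thus \<open>two_sided C\<close> is proportional to \<open>C\<close>; likewise for
    \<open>S\<close>, and pairing \<open>C\<close> with \<open>S\<close> shows that the two factors
    agree.\<close>
  have "wronskian (two_sided C) C x = 0"
    using wronskian_two_sided(2)[OF Q(2) C(1) C(1) base_in_dom] wronskian_commute[of C "two_sided C" x]
    by (simp add: equal_neg_zero)
  hence C': "deriv (two_sided C) x = 0" using C by (simp add: wronskian_def)
  have "wronskian (two_sided S) S x = 0"
    using wronskian_two_sided(2)[OF Q(2) S(1) S(1) base_in_dom] wronskian_commute[of S "two_sided S" x]
    by (simp add: equal_neg_zero)
  hence S0: "two_sided S x = 0" using S by (simp add: wronskian_def)
  have S': "deriv (two_sided S) x = disc Q"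
    using wronskian_two_sided(2)[OF Q(2) C(1) S(1) base_in_dom] C C' S S0 T by (simp add: wronskian_def)
  define a b where "a = f x" and "b = deriv f x"
  have lc: "solves Q (\<lambda>z. a * C z + b * S z)" by (intro solves_lincomb C S)
  have "deriv (\<lambda>z. a * C z + b * S z) x = a * deriv C x + b * deriv S x"
    by (intro DERIV_imp_deriv DERIV_add DERIV_cmult solvesD(1)[OF C(1) base_in_dom] solvesD(1)[OF S(1) base_in_dom])
  hence f_eq: "f z = a * C z + b * S z" if "z \<in> \<Omega>" for z
    using C S by (intro solves_unique[OF Q(1) f lc _ _ that]) (auto simp: a_def b_def)
  have UC: "two_sided C z = disc Q * C z" if "z \<in> \<Omega>" for z
  proof -
    have "solves Q (\<lambda>z. disc Q * C z + 0 * C z)" by (intro solves_lincomb C)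
    hence s: "solves Q (\<lambda>z. disc Q * C z)" by simp
    have "deriv (\<lambda>z. disc Q * C z) x = disc Q * deriv C x"
      by (intro DERIV_imp_deriv DERIV_cmult solvesD(1)[OF C(1) base_in_dom])
    thus ?thesis using C C' T
      by (intro solves_unique[OF Q(1) solves_two_sided(3)[OF Q(2) C(1)] s _ _ that]) auto
  qed
  have US: "two_sided S z = disc Q * S z" if "z \<in> \<Omega>" for z
  proof -
    have "solves Q (\<lambda>z. disc Q * S z + 0 * S z)" by (intro solves_lincomb S)
    hence s: "solves Q (\<lambda>z. disc Q * S z)" by simp
    have "deriv (\<lambda>z. disc Q * S z) x = disc Q * deriv S x"
      by (intro DERIV_imp_deriv DERIV_cmult solvesD(1)[OF S(1) base_in_dom])
    thus ?thesis using S S' S0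
      by (intro solves_unique[OF Q(1) solves_two_sided(3)[OF Q(2) S(1)] s _ _ that]) auto
  qed
  have "two_sided f z = a * two_sided C z + b * two_sided S z"
    unfolding two_sided_def using z by (simp add: f_eq) (simp add: algebra_simps)
  also have "\<dots> = disc Q * f z" using z by (simp add: UC US f_eq) (simp add: algebra_simps)
  finally show ?thesis .
qed

text \<open>For an alternating form w on a plane, w(T f, g) + w(f, T g) = tr T w(f, g). With the
  Wronskian as w the left-hand side is w(T f + f(z - c), g), which is \<open>disc Q\<close> times
  w(f, g).\<close>

lemma trace_eq_disc:
  assumes Q: "Q holomorphic_on \<Omega>" "periodic Q" and f: "solves Q f" and g: "solves Q g"
    and indep: "wronskian f g x \<noteq> 0"
    and shift: "\<And>z. z \<in> \<Omega> \<Longrightarrow> f (z + c) = m11 * f z + m21 * g z"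
      "\<And>z. z \<in> \<Omega> \<Longrightarrow> g (z + c) = m12 * f z + m22 * g z"
  shows "m11 + m22 = disc Q"
proof -
  have d: "deriv (\<lambda>z. h (z + c)) x = a * deriv f x + b * deriv g x"
    if "\<And>z. z \<in> \<Omega> \<Longrightarrow> h (z + c) = a * f z + b * g z" for h :: "complex \<Rightarrow> complex" and a b
  proof -
    have "deriv (\<lambda>z. h (z + c)) x = deriv (\<lambda>z. a * f z + b * g z) x"
      using that eventually_nhds_in_open[OF open_dom base_in_dom]
      by (intro deriv_cong_ev) (auto elim!: eventually_mono)
    also have "\<dots> = a * deriv f x + b * deriv g x"
      by (intro DERIV_imp_deriv DERIV_add DERIV_cmult solvesD(1)[OF f base_in_dom] solvesD(1)[OF g base_in_dom])
    finally show ?thesis .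
  qed
  have "wronskian (two_sided f) g x = disc Q * wronskian f g x"
  proof -
    have "deriv (two_sided f) x = disc Q * deriv f x"
    proof -
      have "deriv (two_sided f) x = deriv (\<lambda>z. disc Q * f z) x"
        using two_sided_eq_disc[OF Q f] eventually_nhds_in_open[OF open_dom base_in_dom]
        by (intro deriv_cong_ev) (auto elim!: eventually_mono)
      also have "\<dots> = disc Q * deriv f x"
        by (intro DERIV_imp_deriv DERIV_cmult solvesD(1)[OF f base_in_dom])
      finally show ?thesis .
    qed
    thus ?thesis using two_sided_eq_disc[OF Q f base_in_dom] by (simp add: wronskian_def algebra_simps)
  qed
  moreover have "wronskian (\<lambda>z. f (z + c)) g x = m11 * wronskian f g x"
    using shift(1)[OF base_in_dom] d[OF shift(1)] by (simp add: wronskian_def algebra_simps)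
  moreover have "wronskian f (\<lambda>z. g (z + c)) x = m22 * wronskian f g x"
    using shift(2)[OF base_in_dom] d[OF shift(2)] by (simp add: wronskian_def algebra_simps)
  ultimately have "(m11 + m22) * wronskian f g x = disc Q * wronskian f g x"
    using wronskian_two_sided(1)[OF Q(2) f g base_in_dom] by (simp add: algebra_simps)
  thus ?thesis using indep by simp
qed

text \<open>The Picard series with initial values 1 and 0 represents the discriminant as the sum of
  its values at the fixed points x + c and x - c, each of them entire in p.\<close>

lemma disc_holomorphic:
  assumes "q0 holomorphic_on \<Omega>" "q1 holomorphic_on \<Omega>" "q2 holomorphic_on \<Omega>"
  shows "(\<lambda>p. disc (\<lambda>z. q0 z + p * q1 z + p\<^sup>2 * q2 z)) holomorphic_on UNIV"
proof -
  interpret R: quadratic_family \<Omega> x q0 q1 q2 by unfold_locales (use assms in simp_all)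
  have "disc (\<lambda>z. q0 z + p * q1 z + p\<^sup>2 * q2 z) = R.picard_sum 1 0 p (x + c) + R.picard_sum 1 0 p (x - c)" for p
    using disc_eq[OF R.Q_holomorphic R.picard_sum_solves[of p 1 0]]
    by (simp add: R.picard_sum_init R.Q_def[abs_def] two_sided_def)
  thus ?thesis
    using base_in_dom by (simp only:) (intro holomorphic_intros R.picard_sum_holomorphic_param; simp)
qed

end

section \<open>Continuation of germs\<close>

text \<open>Whether the germ of the continuation at \<gamma> t agrees with h is a locally constant
  property of t, and the unit interval is connected.\<close>

lemma analytic_continuation_along_linepath_eq:
  assumes cont: "analytic_continuation_along (linepath a b) f g"
    and S: "open S" "h holomorphic_on S" "closed_segment a b \<subseteq> S"
    and fh: "\<forall>\<^sub>F z in nhds a. f z = h z"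
  shows "\<forall>\<^sub>F z in nhds b. g z = h z"
proof -
  define \<gamma> where "\<gamma> = linepath a b"
  obtain F :: "real \<Rightarrow> complex \<Rightarrow> complex" where
    F: "\<And>t. t \<in> {0..1} \<Longrightarrow> F t analytic_on {\<gamma> t}"
      "\<And>t. t \<in> {0..1} \<Longrightarrow> \<forall>\<^sub>F s in at t within {0..1}. \<forall>\<^sub>F z in nhds (\<gamma> s). F s z = F t z"
      "\<forall>\<^sub>F z in nhds (\<gamma> 0). F 0 z = f z" "\<forall>\<^sub>F z in nhds (\<gamma> 1). F 1 z = g z"
    using cont unfolding analytic_continuation_along_def \<gamma>_def by blast
  define P where "P = (\<lambda>t. \<forall>\<^sub>F z in nhds (\<gamma> t). F t z = h z)"
  have "P 0 = P 1"
  proof (rule connected_local_const[of "{0..1::real}" 0 1 P])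
    show "\<forall>t\<in>{0..1}. \<forall>\<^sub>F s in at t within {0..1}. P t = P s"
    proof
      fix t :: real assume t: "t \<in> {0..1}"
      obtain e where e: "e > 0" "F t holomorphic_on ball (\<gamma> t) e"
        using F(1)[OF t] by (auto simp: analytic_on_def)
      have "\<gamma> t \<in> S" using S(3) t by (auto simp: \<gamma>_def linepath_in_path)
      then obtain e' where e': "e' > 0" "ball (\<gamma> t) e' \<subseteq> S" using S(1) open_contains_ball by blast
      define r where "r = min e e'"
      define B where "B = ball (\<gamma> t) r"
      have r: "r > 0" using e e' by (simp add: r_def)
      have hol: "F t holomorphic_on B" "h holomorphic_on B"
      proof -
        have "B \<subseteq> ball (\<gamma> t) e" "B \<subseteq> S" using e'(2) by (auto simp: B_def r_def)
        thus "F t holomorphic_on B" "h holomorphic_on B"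
          using holomorphic_on_subset e(2) S(2) by blast+
      qed
      \<comment> \<open>By the identity theorem, agreement near one point spreads over the whole
        ball B. Since B contains both \<gamma> t and the nearby \<gamma> s, agreement is passed on
        in either direction.\<close>
      have spread: "F t z = h z" if u: "u \<in> B" "\<forall>\<^sub>F z in nhds u. F t z = h z" and z: "z \<in> B" for u z
      proof (rule holomorphic_fun_eq_on_connected[OF hol _ _ _ u(1) z])
        show "open B" "connected B" by (auto simp: B_def)
        show "(deriv ^^ n) (F t) u = (deriv ^^ n) h u" for n
          using u(2) by (rule higher_deriv_cong_ev) simp
      qed
      have "continuous (at t within {0..1}) \<gamma>"
        unfolding \<gamma>_def using continuous_linepath_at by (rule continuous_at_imp_continuous_within)
      hence "(\<gamma> \<longlongrightarrow> \<gamma> t) (at t within {0..1})" by (simp add: continuous_within)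
      hence "\<forall>\<^sub>F s in at t within {0..1}. \<gamma> s \<in> B"
        by (rule topological_tendstoD) (auto simp: B_def r)
      with F(2)[OF t] show "\<forall>\<^sub>F s in at t within {0..1}. P t = P s"
      proof eventually_elim
        case (elim s)
        have nB: "\<forall>\<^sub>F z in nhds u. z \<in> B" if "u \<in> B" for u
          using that by (intro eventually_nhds_in_open) (auto simp: B_def)
        show "P t = P s"
        proof
          assume "P t"
          hence "\<And>z. z \<in> B \<Longrightarrow> F t z = h z" using spread[of "\<gamma> t"] r by (simp add: P_def B_def)
          with nB[OF elim(2)] elim(1) show "P s"
            unfolding P_def by (auto elim: eventually_elim2)
        next
          assume "P s"
          with elim(1) have "\<forall>\<^sub>F z in nhds (\<gamma> s). F t z = h z"
            unfolding P_def by eventually_elim simp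
          hence "\<And>z. z \<in> B \<Longrightarrow> F t z = h z" using spread[OF elim(2)] by blast
          moreover have "\<forall>\<^sub>F z in nhds (\<gamma> t). z \<in> B" using r by (intro nB) (simp add: B_def)
          ultimately show "P t" unfolding P_def by (auto elim: eventually_mono)
        qed
      qed
    qed
  qed auto
  moreover have "P 0" unfolding P_def
    using F(3) fh unfolding \<gamma>_def linepath_0' by eventually_elim simp
  ultimately have "P 1" by simp
  with F(4) show ?thesis unfolding P_def \<gamma>_def linepath_1' by eventually_elim simp
qed

context convex_domain
begin

text \<open>A germ and the solution on \<Omega> with the same initial values solve the same equation
  on a small ball around x; the ball is itself a convex domain, where uniqueness identifies
  them.\<close>

lemma germ_extends:
  assumes Q: "Q holomorphic_on \<Omega>" and f: "f analytic_on {x}"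
    and eq: "\<forall>\<^sub>F z in nhds x. (deriv ^^ 2) f z = Q z * f z"
  obtains \<psi> where "solves Q \<psi>" "\<forall>\<^sub>F z in nhds x. f z = \<psi> z"
proof -
  obtain \<psi> where \<psi>: "solves Q \<psi>" "\<psi> x = f x" "deriv \<psi> x = deriv f x"
    using solution_exists[OF Q] by blast
  obtain e1 where e1: "e1 > 0" "f holomorphic_on ball x e1" using f by (auto simp: analytic_on_def)
  obtain e2 where e2: "e2 > 0" "\<And>z. z \<in> ball x e2 \<Longrightarrow> deriv (deriv f) z = Q z * f z"
    using eq by (auto simp: eventually_nhds_metric numeral_2_eq_2 dist_commute)
  obtain e3 where e3: "e3 > 0" "ball x e3 \<subseteq> \<Omega>" using open_dom base_in_dom open_contains_ball by blast
  define r where "r = min e1 (min e2 e3)"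
  have r: "r > 0" "ball x r \<subseteq> ball x e1" "ball x r \<subseteq> ball x e2" "ball x r \<subseteq> \<Omega>"
    using e1 e2 e3 by (auto simp: r_def)
  interpret B: convex_domain "ball x r" x by unfold_locales (use r in auto)
  have "B.solves Q f" unfolding B.solves_def using r(2,3) e1 e2 by (auto intro: holomorphic_on_subset)
  moreover have "B.solves Q \<psi>"
    using \<psi>(1) r(4) unfolding B.solves_def solves_def by (auto intro: holomorphic_on_subset)
  ultimately have "f z = \<psi> z" if "z \<in> ball x r" for z
    by (rule B.solves_unique[OF holomorphic_on_subset[OF Q r(4)] _ _ \<psi>(2,3)[symmetric] that])
  note eq_ball = this
  have "\<forall>\<^sub>F z in nhds x. z \<in> ball x r" using r(1) by (intro eventually_nhds_in_open) auto
  hence "\<forall>\<^sub>F z in nhds x. f z = \<psi> z" by eventually_elim (rule eq_ball)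
  with \<psi>(1) show ?thesis by (rule that)
qed

end

section \<open>The kernel transform\<close>

text \<open>By \<open>primitive_period\<close>, y - z = c \<tau> with \<tau> in [0, 1] lies in L at
  the two ends only. H contains the poles of the potentials; avoiding it at the midpoint also keeps
  z + y, twice the midpoint, off L.\<close>

locale strip = lattice \<omega>1 \<omega>3 + periodic_domain \<Omega> x c
  for \<omega>1 \<omega>3 :: complex and \<Omega> :: "complex set" and x c :: complex +
  assumes period: "c \<in> L"
    and primitive_period: "\<And>\<tau>::real. 0 < \<tau> \<Longrightarrow> \<tau> < 1 \<Longrightarrow> c * of_real \<tau> \<notin> L"
    and avoid: "\<Omega> \<inter> H = {}"
begin

lemma c_nonzero: "c \<noteq> 0"
  using primitive_period[of "1/2"] by auto

lemma not_H: "z \<in> \<Omega> \<Longrightarrow> z \<notin> H"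
  using avoid by auto

lemma segment_shift: "z \<in> \<Omega> \<Longrightarrow> \<tau> \<in> {0..1} \<Longrightarrow> z + c * of_real \<tau> \<in> \<Omega>"
proof -
  assume "z \<in> \<Omega>" "\<tau> \<in> {0..1}"
  hence "(1 - \<tau>) *\<^sub>R z + \<tau> *\<^sub>R (z + c) \<in> \<Omega>" by (intro convexD_alt[OF convex_dom]) auto
  moreover have "(1 - \<tau>) *\<^sub>R z + \<tau> *\<^sub>R (z + c) = z + c * of_real \<tau>"
    by (simp add: scaleR_conv_of_real algebra_simps)
  ultimately show ?thesis by simp
qed

lemma Z_dom: "Z i holomorphic_on \<Omega>"
  using avoid by (intro holomorphic_on_subset[OF Z_holomorphic]) auto

lemma Z_dom_deriv: "z \<in> \<Omega> \<Longrightarrow> (Z i has_field_derivative - wp (z + hp i)) (at z)"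
  by (intro Z_deriv add_hp_not_L not_H)

lemma wp_dom: "(\<lambda>z. wp (z + hp i)) holomorphic_on \<Omega>"
  using wp_shift_deriv[OF add_hp_not_L(1)[OF not_H]] by (auto simp: holomorphic_on_open[OF open_dom])

definition pot :: "(nat \<Rightarrow> complex) \<Rightarrow> complex \<Rightarrow> complex" where
  "pot \<gamma> z = (\<Sum>i=0..3. \<gamma> i * wp (z + hp i))"

lemma pot_holomorphic: "pot \<gamma> holomorphic_on \<Omega>"
  unfolding pot_def[abs_def] by (intro holomorphic_intros wp_dom)

lemma pot_periodic: "z \<in> \<Omega> \<Longrightarrow> pot \<gamma> (z + c) = pot \<gamma> z"
proof -
  assume "z \<in> \<Omega>"
  hence "wp (z + c + hp i) = wp (z + hp i)" for i
    using wp_periodic[OF period add_hp_not_L(1)[OF not_H], of z i] by (simp add: add_ac)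
  thus ?thesis by (simp add: pot_def)
qed

text \<open>\<open>S\<close> is a constant multiple of a branch of sigma(c \<tau>)^d, recovered from
  its logarithmic derivative d c zeta(c \<tau>): the poles at \<tau> = 0 and \<tau> = 1 integrate to
  the two real powers, the continuous rest to \<open>R\<close>.\<close>

lemma end_factor_exists:
  fixes d :: real
  assumes d: "d > 0"
  obtains S R :: "real \<Rightarrow> complex" where
    "continuous_on {0..1} S" "S 0 = 0" "S 1 = 0" "continuous_on {0..1} R"
    "\<And>\<tau>. \<tau> \<in> {0..1} \<Longrightarrow> S \<tau> = of_real (\<tau> powr d) * of_real ((1 - \<tau>) powr d) * exp (R \<tau>)"
    "\<And>\<tau>. 0 < \<tau> \<Longrightarrow> \<tau> < 1 \<Longrightarrow>
       (S has_vector_derivative of_real d * c * wzeta (c * of_real \<tau>) * S \<tau>) (at \<tau>)"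
proof -
  \<comment> \<open>Two forms of c zeta(c \<tau>) - 1 / \<tau> + 1 / (1 - \<tau>): the first is
    visibly regular at \<tau> = 0, the second, by quasi-periodicity, at \<tau> = 1. They agree in
    between and are glued at 1/2.\<close>
  define r1 where "r1 = (\<lambda>\<tau>::real. c * zeta_reg (c * of_real \<tau>) - 1 / (of_real \<tau> - 1))"
  define r2 where "r2 = (\<lambda>\<tau>::real. c * eta c + c * zeta_reg (c * (of_real \<tau> - 1)) - 1 / of_real \<tau>)"
  define r where "r = (\<lambda>\<tau>. if \<tau> \<le> 1/2 then r1 \<tau> else r2 \<tau>)"
  have r_eq: "r1 \<tau> = c * wzeta (c * of_real \<tau>) - 1 / of_real \<tau> + 1 / (1 - of_real \<tau>)"
    "r2 \<tau> = c * wzeta (c * of_real \<tau>) - 1 / of_real \<tau> + 1 / (1 - of_real \<tau>)" if "0 < \<tau>" "\<tau> < 1" for \<tau>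
  proof -
    have m: "1 / (1 - complex_of_real \<tau>) = - (1 / (of_real \<tau> - 1))"
      by (subst minus_divide_right) simp
    have "c * wzeta (c * of_real \<tau>) = 1 / of_real \<tau> + c * zeta_reg (c * of_real \<tau>)"
      using c_nonzero by (simp add: wzeta_def distrib_left)
    thus "r1 \<tau> = c * wzeta (c * of_real \<tau>) - 1 / of_real \<tau> + 1 / (1 - of_real \<tau>)"
      by (simp add: r1_def m)
    let ?u = "c * (of_real \<tau> - 1)"
    have "- ?u = c * of_real (1 - \<tau>)" by (simp add: algebra_simps)
    hence "?u \<notin> L" using primitive_period[of "1 - \<tau>"] that int_span2_minus_iff[of ?u] by (metis diff_gt_0_iff_gt diff_less_eq less_add_same_cancel1)
    hence "wzeta (?u + c) = wzeta ?u + eta c" by (rule wzeta_add[OF period])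
    moreover have "?u + c = c * of_real \<tau>" by (simp add: algebra_simps)
    moreover have "c * wzeta ?u = 1 / (of_real \<tau> - 1) + c * zeta_reg ?u"
      using c_nonzero by (simp add: wzeta_def distrib_left)
    ultimately have "c * wzeta (c * of_real \<tau>) = 1 / (of_real \<tau> - 1) + c * zeta_reg ?u + c * eta c"
      by (simp add: distrib_left)
    thus "r2 \<tau> = c * wzeta (c * of_real \<tau>) - 1 / of_real \<tau> + 1 / (1 - of_real \<tau>)"
      by (simp add: r2_def m)
  qed
  have zr: "continuous_on T (\<lambda>\<tau>. zeta_reg (h \<tau>))"
    if "continuous_on T h" "\<And>\<tau>. \<tau> \<in> T \<Longrightarrow> h \<tau> \<notin> L - {0}" for h :: "real \<Rightarrow> complex" and T
    using holomorphic_on_imp_continuous_on[OF zeta_reg_holomorphic] that(1)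
    by (rule continuous_on_compose2) (use that(2) in auto)
  have "continuous_on {0..1/2} r1" unfolding r1_def
  proof (intro continuous_intros zr)
    show "c * of_real \<tau> \<notin> L - {0}" if "\<tau> \<in> {0..1/2}" for \<tau> :: real
      using primitive_period[of \<tau>] that by (cases "\<tau> = 0") auto
    show "\<forall>\<tau>\<in>{0..1/2::real}. complex_of_real \<tau> - 1 \<noteq> 0"
    proof
      fix \<tau> :: real assume "\<tau> \<in> {0..1/2}"
      hence "\<tau> \<noteq> 1" by auto
      thus "complex_of_real \<tau> - 1 \<noteq> 0" by simp
    qed
  qed
  moreover have "continuous_on {1/2..1} r2" unfolding r2_def
  proof (intro continuous_intros zr)
    show "c * (of_real \<tau> - 1) \<notin> L - {0}" if "\<tau> \<in> {1/2..1}" for \<tau> :: real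
    proof (cases "\<tau> = 1")
      case False
      have "- (c * (of_real \<tau> - 1)) = c * of_real (1 - \<tau>)" by (simp add: algebra_simps)
      thus ?thesis using primitive_period[of "1 - \<tau>"] that False int_span2_minus_iff[of "c * (of_real \<tau> - 1)"]
        by auto
    qed auto
  qed auto
  ultimately have "continuous_on ({0..1/2} \<union> {1/2..1}) r"
    unfolding r_def
  proof (intro continuous_on_cases)
    have "r1 (1/2) = r2 (1/2)" using r_eq[of "1/2"] by simp
    thus "\<forall>\<tau>. \<tau> \<in> {0..1/2} \<and> \<not> \<tau> \<le> 1/2 \<or> \<tau> \<in> {1/2..1} \<and> \<tau> \<le> 1/2 \<longrightarrow> r1 \<tau> = r2 \<tau>"
      by (metis atLeastAtMost_iff order_antisym)
  qed auto
  moreover have "{0..1/2} \<union> {1/2..1} = {0..1::real}" by auto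
  ultimately have r_cont: "continuous_on {0..1} r" by simp
  define R where "R = (\<lambda>\<tau>. of_real d * integral {0..\<tau>} r)"
  define S where "S = (\<lambda>\<tau>. of_real (\<tau> powr d) * of_real ((1 - \<tau>) powr d) * exp (R \<tau>))"
  have R_deriv: "(R has_vector_derivative of_real d * r \<tau>) (at \<tau> within {0..1})" if "\<tau> \<in> {0..1}" for \<tau>
    unfolding R_def by (intro has_vector_derivative_mult_right integral_has_vector_derivative r_cont that)
  have R_cont: "continuous_on {0..1} R"
    unfolding continuous_on_eq_continuous_within
    using has_vector_derivative_continuous[OF R_deriv] by blast
  have S_cont: "continuous_on {0..1} S"
    unfolding S_def using d by (intro continuous_intros R_cont continuous_on_powr') auto
  have S_deriv: "(S has_vector_derivative of_real d * c * wzeta (c * of_real \<tau>) * S \<tau>) (at \<tau>)"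
    if \<tau>: "0 < \<tau>" "\<tau> < 1" for \<tau>
  proof -
    have "(R has_vector_derivative of_real d * r \<tau>) (at \<tau> within {0..1})"
      using \<tau> by (intro R_deriv) auto
    hence Rd: "(R has_vector_derivative of_real d * r \<tau>) (at \<tau>)"
      using \<tau> by (simp add: at_within_Icc_at)
    have e: "((\<lambda>\<tau>. exp (R \<tau>)) has_vector_derivative of_real d * r \<tau> * exp (R \<tau>)) (at \<tau>)"
      using field_vector_diff_chain_at[OF Rd DERIV_exp] by (simp add: o_def)
    have p1: "((\<lambda>\<tau>. complex_of_real (\<tau> powr d)) has_vector_derivative of_real (d / \<tau> * \<tau> powr d)) (at \<tau>)"
      using \<tau> by (intro has_vector_derivative_of_real)
         (auto intro!: derivative_eq_intros simp: powr_diff)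
    have p2: "((\<lambda>\<tau>. complex_of_real ((1 - \<tau>) powr d)) has_vector_derivative of_real (- d / (1 - \<tau>) * (1 - \<tau>) powr d)) (at \<tau>)"
      using \<tau> by (intro has_vector_derivative_of_real)
         (auto intro!: derivative_eq_intros simp: powr_diff)
    let ?P = "complex_of_real (\<tau> powr d)" and ?P' = "complex_of_real ((1 - \<tau>) powr d)"
    have "(S has_vector_derivative
             (?P * ?P') * (of_real d * r \<tau> * exp (R \<tau>)) +
             (?P * of_real (- d / (1 - \<tau>) * (1 - \<tau>) powr d) + of_real (d / \<tau> * \<tau> powr d) * ?P') * exp (R \<tau>)) (at \<tau>)"
      unfolding S_def by (intro has_vector_derivative_mult e p1 p2)
    also have "(?P * ?P') * (of_real d * r \<tau> * exp (R \<tau>)) +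
             (?P * of_real (- d / (1 - \<tau>) * (1 - \<tau>) powr d) + of_real (d / \<tau> * \<tau> powr d) * ?P') * exp (R \<tau>) =
             of_real d * (r \<tau> + 1 / of_real \<tau> - 1 / (1 - of_real \<tau>)) * S \<tau>"
      by (simp add: S_def algebra_simps)
    also have "r \<tau> + 1 / of_real \<tau> - 1 / (1 - of_real \<tau>) = c * wzeta (c * of_real \<tau>)"
      using r_eq[OF \<tau>] by (simp add: r_def)
    finally show ?thesis by (simp add: mult.assoc)
  qed
  show ?thesis
    by (rule that[OF S_cont _ _ R_cont _ S_deriv]) (use d in \<open>auto simp: S_def\<close>)
qed

lemma continuous_on_shifted:
  assumes "h holomorphic_on \<Omega>" "s \<in> {0..1}"
  shows "continuous_on (\<Omega> \<times> {0..1}) (\<lambda>(z, \<tau>). h (z + c * of_real (s * \<tau>)))"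
proof -
  have "continuous_on (\<Omega> \<times> {0..1}) (\<lambda>p. h (fst p + c * of_real (s * snd p)))"
  proof (rule continuous_on_compose2[OF holomorphic_on_imp_continuous_on[OF assms(1)]])
    show "(\<lambda>p. fst p + c * of_real (s * snd p)) ` (\<Omega> \<times> {0..1}) \<subseteq> \<Omega>"
      using assms(2) by (auto intro!: segment_shift mult_le_one simp del: of_real_mult)
  qed (intro continuous_intros)
  thus ?thesis by (simp add: case_prod_unfold)
qed

lemma integral_deriv:
  fixes S :: "real \<Rightarrow> complex"
  assumes S: "continuous_on {0..1} S"
    and F: "continuous_on (\<Omega> \<times> {0..1}) (\<lambda>(z, \<tau>). F z \<tau>)"
    and F': "continuous_on (\<Omega> \<times> {0..1}) (\<lambda>(z, \<tau>). F' z \<tau>)"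
    and deriv: "\<And>z \<tau>. z \<in> \<Omega> \<Longrightarrow> \<tau> \<in> {0..1} \<Longrightarrow> ((\<lambda>z. F z \<tau>) has_field_derivative F' z \<tau>) (at z)"
    and z: "z \<in> \<Omega>"
  shows "((\<lambda>z. integral {0..1} (\<lambda>\<tau>. S \<tau> * F z \<tau>)) has_field_derivative
            integral {0..1} (\<lambda>\<tau>. S \<tau> * F' z \<tau>)) (at z)"
    and "(\<lambda>\<tau>. S \<tau> * F z \<tau>) integrable_on {0..1}"
proof -
  have slice: "continuous_on {0..1} (G z)" if "continuous_on (\<Omega> \<times> {0..1}) (\<lambda>(z, \<tau>). G z \<tau>)" "z \<in> \<Omega>"
    for G :: "complex \<Rightarrow> real \<Rightarrow> complex" and z
    using continuous_on_compose2[OF that(1) continuous_on_Pair[OF continuous_on_const[of "{0..1}" z] continuous_on_id]]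
      that(2) by auto
  have int: "(\<lambda>\<tau>. S \<tau> * F z \<tau>) integrable_on {0..1}" if "z \<in> \<Omega>" for z
    by (intro integrable_continuous_real continuous_intros S slice[OF F that])
  thus "(\<lambda>\<tau>. S \<tau> * F z \<tau>) integrable_on {0..1}" using z .
  have "((\<lambda>z. integral (cbox 0 1) (\<lambda>\<tau>. S \<tau> * F z \<tau>)) has_field_derivative
            integral (cbox 0 1) (\<lambda>\<tau>. S \<tau> * F' z \<tau>)) (at z within \<Omega>)"
  proof (rule leibniz_rule_field_derivative)
    fix w :: complex and \<tau> :: real assume "w \<in> \<Omega>" "\<tau> \<in> cbox 0 1"
    thus "((\<lambda>z. S \<tau> * F z \<tau>) has_field_derivative S \<tau> * F' w \<tau>) (at w within \<Omega>)"
      by (intro has_field_derivative_at_within[OF DERIV_cmult[OF deriv]]) auto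
  next
    have "continuous_on (\<Omega> \<times> {0..1}) (\<lambda>p. S (snd p))"
      by (rule continuous_on_compose2[OF S continuous_on_snd[OF continuous_on_id]]) auto
    moreover have "continuous_on (\<Omega> \<times> {0..1}) (\<lambda>p. F' (fst p) (snd p))"
      using F' by (simp add: case_prod_unfold)
    ultimately have "continuous_on (\<Omega> \<times> {0..1}) (\<lambda>p. S (snd p) * F' (fst p) (snd p))"
      by (rule continuous_on_mult)
    thus "continuous_on (\<Omega> \<times> cbox 0 1) (\<lambda>(w, \<tau>). S \<tau> * F' w \<tau>)" by (simp add: case_prod_unfold)
  qed (use z int convex_dom in auto)
  thus "((\<lambda>z. integral {0..1} (\<lambda>\<tau>. S \<tau> * F z \<tau>)) has_field_derivative
            integral {0..1} (\<lambda>\<tau>. S \<tau> * F' z \<tau>)) (at z)"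
    using z by (simp add: at_within_open[OF _ open_dom])
qed

end

locale kernel = strip \<omega>1 \<omega>3 \<Omega> x c
  for \<omega>1 \<omega>3 :: complex and \<Omega> :: "complex set" and x c :: complex +
  fixes \<alpha> \<beta> :: "nat \<Rightarrow> complex" and d :: real and E :: complex
  assumes d_pos: "d > 0" and \<alpha>_sum: "(\<Sum>i=0..3. \<alpha> i) = - 2 * of_real d"
    and \<beta>_eq: "\<And>i. \<beta> i = \<alpha> i + of_real d"
begin

abbreviation dc :: complex where "dc \<equiv> of_real d"

text \<open>\<open>W\<close> governs the solution that is integrated, \<open>V\<close> the resulting
  transform; with \<alpha> i equal to -l or l + 1, the product in \<open>V\<close> is l (l +
  1).\<close>

definition V :: "complex \<Rightarrow> complex" where "V z = pot (\<lambda>i. \<alpha> i * (\<alpha> i - 1)) z - E"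
definition W :: "complex \<Rightarrow> complex" where "W z = pot (\<lambda>i. \<beta> i * (\<beta> i + 1)) z - E"

lemma VW_holomorphic: "V holomorphic_on \<Omega>" "W holomorphic_on \<Omega>"
  unfolding V_def[abs_def] W_def[abs_def] by (intro holomorphic_intros pot_holomorphic)+

lemma VW_periodic: "periodic V" "periodic W"
  by (auto simp: periodic_def V_def W_def pot_periodic)

lemma \<beta>_sum: "(\<Sum>i=0..3. \<beta> i) = 2 * dc"
  by (simp add: \<beta>_eq sum.distrib \<alpha>_sum)

definition A :: "complex \<Rightarrow> complex" where "A z = (\<Sum>i=0..3. \<alpha> i * Z i z)"
definition B :: "complex \<Rightarrow> complex" where "B z = (\<Sum>i=0..3. \<beta> i * Z i z)"
definition \<Sigma> :: "complex \<Rightarrow> complex" where "\<Sigma> z = (\<Sum>i=0..3. Z i z)"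
text \<open>Branches, vanishing at x, of the logarithms of the products of sigma_i^\<alpha>_i, of
  sigma_i^\<beta>_i and of all sigma_i. By the duplication formula, \<open>L\<Sigma>\<close> at the
  midpoint of z and y is log sigma(z + y) up to a constant.\<close>

definition LA :: "complex \<Rightarrow> complex" where "LA z = (\<Sum>i=0..3. \<alpha> i * prim (Z i) z)"
definition LB :: "complex \<Rightarrow> complex" where "LB z = (\<Sum>i=0..3. \<beta> i * prim (Z i) z)"
definition L\<Sigma> :: "complex \<Rightarrow> complex" where "L\<Sigma> z = (\<Sum>i=0..3. prim (Z i) z)"

lemma AB\<Sigma>_deriv:
  assumes "z \<in> \<Omega>"
  shows "(A has_field_derivative - pot \<alpha> z) (at z)" "(B has_field_derivative - pot \<beta> z) (at z)"
    "(\<Sigma> has_field_derivative - pot (\<lambda>_. 1) z) (at z)"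
proof -
  have "(A has_field_derivative (\<Sum>i=0..3. \<alpha> i * - wp (z + hp i))) (at z)"
    unfolding A_def[abs_def] by (intro DERIV_sum DERIV_cmult Z_dom_deriv assms)
  thus "(A has_field_derivative - pot \<alpha> z) (at z)" by (simp add: pot_def sum_negf)
  have "(B has_field_derivative (\<Sum>i=0..3. \<beta> i * - wp (z + hp i))) (at z)"
    unfolding B_def[abs_def] by (intro DERIV_sum DERIV_cmult Z_dom_deriv assms)
  thus "(B has_field_derivative - pot \<beta> z) (at z)" by (simp add: pot_def sum_negf)
  have "(\<Sigma> has_field_derivative (\<Sum>i=0..3. - wp (z + hp i))) (at z)"
    unfolding \<Sigma>_def[abs_def] by (intro DERIV_sum Z_dom_deriv assms)
  thus "(\<Sigma> has_field_derivative - pot (\<lambda>_. 1) z) (at z)" by (simp add: pot_def sum_negf)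
qed

lemma L_deriv:
  assumes "z \<in> \<Omega>"
  shows "(LA has_field_derivative A z) (at z)" "(LB has_field_derivative B z) (at z)"
    "(L\<Sigma> has_field_derivative \<Sigma> z) (at z)"
  unfolding LA_def[abs_def] LB_def[abs_def] L\<Sigma>_def[abs_def] A_def B_def \<Sigma>_def
  by (intro DERIV_sum DERIV_cmult prim_deriv Z_dom assms)+

lemma holomorphic_all:
  "A holomorphic_on \<Omega>" "B holomorphic_on \<Omega>" "\<Sigma> holomorphic_on \<Omega>"
  "LA holomorphic_on \<Omega>" "LB holomorphic_on \<Omega>" "L\<Sigma> holomorphic_on \<Omega>"
  unfolding holomorphic_on_open[OF open_dom] using AB\<Sigma>_deriv L_deriv by blast+

text \<open>
  \<open>exp (\<kappa> z \<tau>)\<close> is the part of the kernel at \<open>(z, y)\<close>, \<open>y = z + c \<tau>\<close>, that is regular up to the ends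
  of the path; the factor singular at \<open>y = z\<close> and \<open>y = z + c\<close> depends on \<open>\<tau>\<close> only.
\<close>

definition \<kappa> :: "complex \<Rightarrow> complex \<Rightarrow> complex" where
  "\<kappa> z t = LA z - LB (z + c * t) + dc * L\<Sigma> (z + c * t / 2)"

text \<open>As y = z + c t moves along with z, this z-derivative of \<open>\<kappa>\<close> is the
  sum of the logarithmic derivatives of the kernel in both variables, that is, the first factor in
  \<open>kernel_identity\<close>.\<close>

definition D :: "complex \<Rightarrow> complex \<Rightarrow> complex" where
  "D z t = A z - B (z + c * t) + dc * \<Sigma> (z + c * t / 2)"

definition D' :: "complex \<Rightarrow> complex \<Rightarrow> complex" where
  "D' z t = - pot \<alpha> z + pot \<beta> (z + c * t) - dc * pot (\<lambda>_. 1) (z + c * t / 2)"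

lemma segment_half: "z \<in> \<Omega> \<Longrightarrow> \<tau> \<in> {0..1} \<Longrightarrow> z + c * of_real \<tau> / 2 \<in> \<Omega>"
  using segment_shift[of z "\<tau> / 2"] by simp

lemma \<kappa>_deriv:
  assumes "z \<in> \<Omega>" "z + c * t \<in> \<Omega>" "z + c * t / 2 \<in> \<Omega>"
  shows "((\<lambda>z. \<kappa> z t) has_field_derivative D z t) (at z)"
proof -
  have "((\<lambda>z. \<kappa> z t) has_field_derivative
          A z - B (z + c * t) * (1 + 0) + dc * (\<Sigma> (z + c * t / 2) * (1 + 0))) (at z)"
    unfolding \<kappa>_def
    by (intro DERIV_add DERIV_diff DERIV_cmult L_deriv DERIV_chain2[of LB] DERIV_chain2[of L\<Sigma>]
        DERIV_ident DERIV_const assms)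
  thus ?thesis by (simp add: D_def)
qed

lemma D_deriv:
  assumes "z \<in> \<Omega>" "z + c * t \<in> \<Omega>" "z + c * t / 2 \<in> \<Omega>"
  shows "((\<lambda>z. D z t) has_field_derivative D' z t) (at z)"
proof -
  have "((\<lambda>z. D z t) has_field_derivative
          - pot \<alpha> z - (- pot \<beta> (z + c * t)) * (1 + 0) + dc * (- pot (\<lambda>_. 1) (z + c * t / 2) * (1 + 0))) (at z)"
    unfolding D_def
    by (intro DERIV_add DERIV_diff DERIV_cmult AB\<Sigma>_deriv DERIV_chain2[of B] DERIV_chain2[of \<Sigma>]
        DERIV_ident DERIV_const assms)
  thus ?thesis by (simp add: D'_def)
qed

lemma \<kappa>_path_deriv:
  assumes "z + c * t \<in> \<Omega>" "z + c * t / 2 \<in> \<Omega>"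
  shows "(\<kappa> z has_field_derivative c * (- B (z + c * t) + dc * \<Sigma> (z + c * t / 2) / 2)) (at t)"
proof -
  have "(\<kappa> z has_field_derivative
          0 - B (z + c * t) * (0 + c * 1) + dc * (\<Sigma> (z + c * t / 2) * (0 + c * 1 / 2))) (at t)"
    unfolding \<kappa>_def[abs_def]
    by (intro DERIV_add DERIV_diff DERIV_cmult DERIV_cdivide L_deriv DERIV_chain2[of LB] DERIV_chain2[of L\<Sigma>]
        DERIV_ident DERIV_const assms)
  thus ?thesis by (simp add: algebra_simps)
qed

lemma D_path_deriv:
  assumes "z + c * t \<in> \<Omega>" "z + c * t / 2 \<in> \<Omega>"
  shows "(D z has_field_derivative c * (pot \<beta> (z + c * t) - dc * pot (\<lambda>_. 1) (z + c * t / 2) / 2)) (at t)"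
proof -
  have "(D z has_field_derivative
          0 - (- pot \<beta> (z + c * t)) * (0 + c * 1) + dc * (- pot (\<lambda>_. 1) (z + c * t / 2) * (0 + c * 1 / 2))) (at t)"
    unfolding D_def[abs_def]
    by (intro DERIV_add DERIV_diff DERIV_cmult DERIV_cdivide AB\<Sigma>_deriv DERIV_chain2[of B] DERIV_chain2[of \<Sigma>]
        DERIV_ident DERIV_const assms)
  thus ?thesis by (simp add: algebra_simps)
qed

text \<open>The left-hand side is the coefficient of f in the defect of the equation for the
  transform, the right-hand side its coefficient in 2 / c times the \<tau>-derivative of S
  exp(\<kappa>) D f, both divided by S exp(\<kappa>). The coefficients of f' are 2 D on either
  side.\<close>

lemma kernel_equation:
  assumes z: "z \<in> \<Omega>" and \<tau>: "0 < \<tau>" "\<tau> < 1"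
  defines "t \<equiv> complex_of_real \<tau>"
  shows "D' z t + (D z t)\<^sup>2 + W (z + c * t) - V z =
         2 * dc * wzeta (c * t) * D z t +
         2 * (- B (z + c * t) + dc * \<Sigma> (z + c * t / 2) / 2) * D z t +
         2 * (pot \<beta> (z + c * t) - dc * pot (\<lambda>_. 1) (z + c * t / 2) / 2)"
proof -
  let ?y = "z + c * t" and ?m = "z + c * t / 2"
  have dom: "?y \<in> \<Omega>" "?m \<in> \<Omega>"
    using segment_shift[OF z, of \<tau>] segment_half[OF z, of \<tau>] \<tau> by (auto simp: t_def)
  have ct: "c * t \<notin> L" using primitive_period[OF \<tau>] by (simp add: t_def)
  have zy: "z + ?y = 2 * ?m" "z - ?y = - (c * t)" by (simp_all add: algebra_simps)
  have "z + ?y \<notin> L" unfolding zy using not_H[OF dom(2)] by (simp only: double_mem_L_iff) simp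
  moreover have "z - ?y \<notin> L" unfolding zy using ct by simp
  ultimately have k1: "(A z - B ?y + 2 * dc * wzeta (z + ?y)) * (A z + B ?y + 2 * dc * wzeta (z - ?y)) =
      pot (\<lambda>i. (\<alpha> i)\<^sup>2) z - pot (\<lambda>i. (\<beta> i)\<^sup>2) ?y"
    unfolding A_def B_def pot_def using \<alpha>_sum
    by (intro kernel_identity \<beta>_eq not_H dom z) auto
  have k2: "2 * dc * wzeta (z + ?y) = dc * \<Sigma> ?m"
  proof -
    have "2 * wzeta (2 * ?m) = \<Sigma> ?m" unfolding \<Sigma>_def by (rule wzeta_double[OF not_H[OF dom(2)]])
    thus ?thesis unfolding zy(1) by simp
  qed
  have k3: "wzeta (z - ?y) = - wzeta (c * t)" unfolding zy by (rule wzeta_odd)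
  have key: "D z t * (A z + B ?y - 2 * dc * wzeta (c * t)) =
      pot (\<lambda>i. (\<alpha> i)\<^sup>2) z - pot (\<lambda>i. (\<beta> i)\<^sup>2) ?y"
    using k1 unfolding k2 k3 D_def by simp
  have V: "V z = pot (\<lambda>i. (\<alpha> i)\<^sup>2) z - pot \<alpha> z - E"
    by (simp add: V_def pot_def algebra_simps power2_eq_square sum_subtractf)
  have W: "W ?y = pot (\<lambda>i. (\<beta> i)\<^sup>2) ?y + pot \<beta> ?y - E"
    by (simp add: W_def pot_def algebra_simps power2_eq_square sum.distrib)
  have "(D z t)\<^sup>2 - 2 * dc * wzeta (c * t) * D z t - 2 * (- B ?y + dc * \<Sigma> ?m / 2) * D z t =
        D z t * (A z + B ?y - 2 * dc * wzeta (c * t))"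
    by (simp add: D_def power2_eq_square algebra_simps)
  hence "(D z t)\<^sup>2 - 2 * dc * wzeta (c * t) * D z t - 2 * (- B ?y + dc * \<Sigma> ?m / 2) * D z t =
        V z - W ?y - D' z t + 2 * (pot \<beta> ?y - dc * pot (\<lambda>_. 1) ?m / 2)"
    unfolding key by (simp add: V W D'_def)
  thus ?thesis by algebra
qed

end

section \<open>Invariance of the kernel under the shift of both variables, and the transform\<close>

context strip
begin

lemma continuous_on_dom:
  assumes "h holomorphic_on \<Omega>"
  shows "continuous_on (\<Omega> \<times> {0..1::real}) (\<lambda>p. h (fst p))"
    and "continuous_on (\<Omega> \<times> {0..1}) (\<lambda>p. h (fst p + c * of_real (snd p)))"
    and "continuous_on (\<Omega> \<times> {0..1}) (\<lambda>p. h (fst p + c * of_real (snd p) / 2))"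
  using continuous_on_shifted[OF assms, of 0] continuous_on_shifted[OF assms, of 1]
    continuous_on_shifted[OF assms, of "1/2"]
  by (simp_all add: case_prod_unfold)

lemma prim_Z_shift:
  obtains a where "\<And>z. z \<in> \<Omega> \<Longrightarrow> prim (Z i) (z + c) = prim (Z i) z + eta c * z + a"
proof -
  have "((\<lambda>z. prim (Z i) (z + c) - prim (Z i) z - eta c * z) has_field_derivative 0) (at z within \<Omega>)"
    if z: "z \<in> \<Omega>" for z
  proof -
    have "((\<lambda>z. prim (Z i) (z + c) - prim (Z i) z - eta c * z) has_field_derivative
            Z i (z + c) * (1 + 0) - Z i z - eta c * 1) (at z)"
      using z by (intro DERIV_diff DERIV_cmult DERIV_chain2[of "prim (Z i)"] prim_deriv Z_dom
          DERIV_add DERIV_ident DERIV_const) auto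
    moreover have "Z i (z + c) * (1 + 0) - Z i z - eta c * 1 = 0"
      using Z_add[OF period add_hp_not_L(1)[OF not_H[OF z]], of i] by simp
    ultimately show ?thesis by (simp add: has_field_derivative_at_within)
  qed
  from has_field_derivative_zero_constant[OF convex_dom this] obtain a
    where a: "\<And>z. z \<in> \<Omega> \<Longrightarrow> prim (Z i) (z + c) - prim (Z i) z - eta c * z = a" by blast
  show ?thesis
  proof (rule that[of a])
    fix z assume "z \<in> \<Omega>"
    thus "prim (Z i) (z + c) = prim (Z i) z + eta c * z + a" using a[of z] by (simp add: algebra_simps)
  qed
qed

end

context kernel
begin

text \<open>The multiples of \<open>eta c\<close> cancel: -2 d z from \<open>LA\<close>, -2 d (z + c
  t) from \<open>LB\<close> and 4 d (z + c t / 2) from the midpoint. The additive constants cancel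
  because of \<open>\<beta> i = \<alpha> i + d\<close>.\<close>

lemma \<kappa>_shift:
  assumes "z \<in> \<Omega>" "z + c * t \<in> \<Omega>" "z + c * t / 2 \<in> \<Omega>"
  shows "\<kappa> (z + c) t = \<kappa> z t"
proof -
  have "\<forall>i. \<exists>a. \<forall>z\<in>\<Omega>. prim (Z i) (z + c) = prim (Z i) z + eta c * z + a"
    using prim_Z_shift by meson
  from choice[OF this] obtain a where
    a: "\<And>i z. z \<in> \<Omega> \<Longrightarrow> prim (Z i) (z + c) = prim (Z i) z + eta c * z + a i" by blast
  have LA: "LA (z + c) = LA z + (\<Sum>i=0..3. \<alpha> i) * (eta c * z) + (\<Sum>i=0..3. \<alpha> i * a i)" if "z \<in> \<Omega>" for z
    using that by (simp add: LA_def a distrib_left sum.distrib sum_distrib_right)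
  have LB: "LB (z + c) = LB z + (\<Sum>i=0..3. \<beta> i) * (eta c * z) + (\<Sum>i=0..3. \<beta> i * a i)" if "z \<in> \<Omega>" for z
    using that by (simp add: LB_def a distrib_left sum.distrib sum_distrib_right)
  have LS: "L\<Sigma> (z + c) = L\<Sigma> z + 4 * (eta c * z) + (\<Sum>i=0..3. a i)" if "z \<in> \<Omega>" for z
    using that by (simp add: L\<Sigma>_def a sum.distrib)
  have \<beta>a: "(\<Sum>i=0..3. \<beta> i * a i) = (\<Sum>i=0..3. \<alpha> i * a i) + dc * (\<Sum>i=0..3. a i)"
    by (simp add: \<beta>_eq distrib_right sum.distrib sum_distrib_left)
  have "z + c + c * t = z + c * t + c" "z + c + c * t / 2 = z + c * t / 2 + c" by simp_all
  thus ?thesis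
    unfolding \<kappa>_def by (simp only: LA[OF assms(1)] LB[OF assms(2)] LS[OF assms(3)] \<alpha>_sum \<beta>_sum \<beta>a)
      (simp add: algebra_simps)
qed

lemma continuous_kernel_parts:
  "continuous_on (\<Omega> \<times> {0..1}) (\<lambda>p. \<kappa> (fst p) (of_real (snd p)))"
  "continuous_on (\<Omega> \<times> {0..1}) (\<lambda>p. D (fst p) (of_real (snd p)))"
  "continuous_on (\<Omega> \<times> {0..1}) (\<lambda>p. D' (fst p) (of_real (snd p)))"
  unfolding \<kappa>_def D_def D'_def
  by (intro continuous_on_add continuous_on_diff continuous_on_mult continuous_on_minus continuous_on_const
      continuous_on_dom holomorphic_all pot_holomorphic)+

text \<open>
  Differentiating under the integral at fixed \<open>\<tau>\<close> never hits the singular end factor \<open>S\<close>, and by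
  the kernel identity the defect of the equation is a total \<open>\<tau>\<close>-derivative vanishing at both ends.
\<close>

lemma transform_solves:
  fixes S :: "real \<Rightarrow> complex"
  assumes S: "continuous_on {0..1} S" "S 0 = 0" "S 1 = 0"
    and S_deriv: "\<And>\<tau>. 0 < \<tau> \<Longrightarrow> \<tau> < 1 \<Longrightarrow>
       (S has_vector_derivative dc * c * wzeta (c * of_real \<tau>) * S \<tau>) (at \<tau>)"
    and f: "solves W f"
  shows "solves V (\<lambda>z. integral {0..1} (\<lambda>\<tau>. S \<tau> * (exp (\<kappa> z (of_real \<tau>)) * f (z + c * of_real \<tau>))))"
proof (rule solvesI)
  define N where "N = (\<lambda>z (\<tau>::real). exp (\<kappa> z (of_real \<tau>)) * f (z + c * of_real \<tau>))"
  define N1 where "N1 = (\<lambda>z (\<tau>::real). exp (\<kappa> z (of_real \<tau>)) *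
     (D z (of_real \<tau>) * f (z + c * of_real \<tau>) + deriv f (z + c * of_real \<tau>)))"
  define N2 where "N2 = (\<lambda>z (\<tau>::real). exp (\<kappa> z (of_real \<tau>)) *
     ((D' z (of_real \<tau>) + (D z (of_real \<tau>))\<^sup>2 + W (z + c * of_real \<tau>)) * f (z + c * of_real \<tau>) +
      2 * D z (of_real \<tau>) * deriv f (z + c * of_real \<tau>)))"
  have fh: "f holomorphic_on \<Omega>" "deriv f holomorphic_on \<Omega>"
    using f open_dom by (auto simp: solves_def intro: holomorphic_deriv)
  have N_cont: "continuous_on (\<Omega> \<times> {0..1}) (\<lambda>(z, \<tau>). N z \<tau>)"
    "continuous_on (\<Omega> \<times> {0..1}) (\<lambda>(z, \<tau>). N1 z \<tau>)"
    "continuous_on (\<Omega> \<times> {0..1}) (\<lambda>(z, \<tau>). N2 z \<tau>)"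
    unfolding N_def N1_def N2_def case_prod_unfold
    by (intro continuous_on_add continuous_on_mult continuous_on_const continuous_on_exp continuous_on_power
        continuous_kernel_parts continuous_on_dom fh VW_holomorphic)+
  have f_deriv: "((\<lambda>z. f (z + a)) has_field_derivative deriv f (z + a)) (at z)"
    "((\<lambda>z. deriv f (z + a)) has_field_derivative W (z + a) * f (z + a)) (at z)"
    if "z + a \<in> \<Omega>" for z a
    using DERIV_shift[of f _ z a] DERIV_shift[of "deriv f" _ z a] solvesD[OF f that] by auto
  have dom: "z + c * of_real \<tau> \<in> \<Omega>" "z + c * of_real \<tau> / 2 \<in> \<Omega>" if "z \<in> \<Omega>" "\<tau> \<in> {0..1}" for z \<tau>
    using segment_shift[OF that] segment_half[OF that] by auto
  have N_deriv: "((\<lambda>z. N z \<tau>) has_field_derivative N1 z \<tau>) (at z)" if z: "z \<in> \<Omega>" "\<tau> \<in> {0..1}" for z \<tau>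
  proof -
    have "((\<lambda>z. N z \<tau>) has_field_derivative
       exp (\<kappa> z (of_real \<tau>)) * D z (of_real \<tau>) * f (z + c * of_real \<tau>) +
       deriv f (z + c * of_real \<tau>) * exp (\<kappa> z (of_real \<tau>))) (at z)"
      unfolding N_def
      by (intro DERIV_mult DERIV_chain2[OF DERIV_exp] \<kappa>_deriv f_deriv dom z)
    thus ?thesis by (simp add: N1_def algebra_simps)
  qed
  have N1_deriv: "((\<lambda>z. N1 z \<tau>) has_field_derivative N2 z \<tau>) (at z)" if z: "z \<in> \<Omega>" "\<tau> \<in> {0..1}" for z \<tau>
  proof -
    have "((\<lambda>z. N1 z \<tau>) has_field_derivative
       exp (\<kappa> z (of_real \<tau>)) * D z (of_real \<tau>) *
         (D z (of_real \<tau>) * f (z + c * of_real \<tau>) + deriv f (z + c * of_real \<tau>)) +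
       ((D' z (of_real \<tau>) * f (z + c * of_real \<tau>) + deriv f (z + c * of_real \<tau>) * D z (of_real \<tau>)) +
         W (z + c * of_real \<tau>) * f (z + c * of_real \<tau>)) * exp (\<kappa> z (of_real \<tau>))) (at z)"
      unfolding N1_def
      by (intro DERIV_mult DERIV_add DERIV_chain2[OF DERIV_exp] \<kappa>_deriv D_deriv f_deriv dom z)
    thus ?thesis by (simp add: N2_def algebra_simps power2_eq_square)
  qed
  fix z assume z: "z \<in> \<Omega>"
  show "((\<lambda>z. integral {0..1} (\<lambda>\<tau>. S \<tau> * (exp (\<kappa> z (of_real \<tau>)) * f (z + c * of_real \<tau>))))
          has_field_derivative integral {0..1} (\<lambda>\<tau>. S \<tau> * N1 z \<tau>)) (at z)"
    using integral_deriv(1)[OF S(1) N_cont(1,2) N_deriv z] by (simp add: N_def)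
  have "((\<lambda>z. integral {0..1} (\<lambda>\<tau>. S \<tau> * N1 z \<tau>)) has_field_derivative
           integral {0..1} (\<lambda>\<tau>. S \<tau> * N2 z \<tau>)) (at z)"
    by (rule integral_deriv(1)[OF S(1) N_cont(2,3) N1_deriv z])
  moreover have "integral {0..1} (\<lambda>\<tau>. S \<tau> * N2 z \<tau>) = V z * integral {0..1} (\<lambda>\<tau>. S \<tau> * N z \<tau>)"
  proof -
    \<comment> \<open>With K_xx - K_yy = (V(x) - W(y)) K and f'' = W f, the defect (d_x + d_y)^2 (K
      f) - V K f equals 2 d_y ((K_x + K_y) f). Along the path d_y is 1 / c times the
      \<tau>-derivative, and K_x + K_y is S exp(\<kappa>) D; hence the primitive 2 / c S G.\<close>
    define G where "G = (\<lambda>t. exp (\<kappa> z t) * D z t * f (z + c * t))"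
    have "((\<lambda>\<tau>. S \<tau> * N2 z \<tau> - V z * (S \<tau> * N z \<tau>)) has_integral
            2 / c * (S 1 * G (of_real 1)) - 2 / c * (S 0 * G (of_real 0))) {0..1}"
    \<comment> \<open>For d < 1 the factor \<open>S\<close> need not be differentiable at the ends;
      continuity there is enough for this version.\<close>
    proof (rule fundamental_theorem_of_calculus_interior_strong[of "{}"])
      fix \<tau> :: real assume "\<tau> \<in> {0<..<1} - {}"
      hence \<tau>: "0 < \<tau>" "\<tau> < 1" "\<tau> \<in> {0..1}" by auto
      let ?t = "complex_of_real \<tau>"
      let ?y = "z + c * ?t" and ?m = "z + c * ?t / 2"
      have f_path: "((\<lambda>t. f (z + c * t)) has_field_derivative deriv f ?y * (0 + c * 1)) (at ?t)"
        by (intro DERIV_chain2[of f] solvesD(1)[OF f] DERIV_add DERIV_cmult DERIV_ident DERIV_const dom z \<tau>)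
      have "(G has_field_derivative
              (exp (\<kappa> z ?t) * (c * (- B ?y + dc * \<Sigma> ?m / 2)) * D z ?t +
               c * (pot \<beta> ?y - dc * pot (\<lambda>_. 1) ?m / 2) * exp (\<kappa> z ?t)) * f ?y +
              deriv f ?y * (0 + c * 1) * (exp (\<kappa> z ?t) * D z ?t)) (at ?t)"
        unfolding G_def
        by (intro DERIV_mult DERIV_chain2[OF DERIV_exp] \<kappa>_path_deriv D_path_deriv f_path dom z \<tau>)
      from has_vector_derivative_mult_right[OF has_vector_derivative_mult[OF S_deriv[OF \<tau>(1,2)]
          has_vector_derivative_real_field[OF this]], of "2 / c"]
      have "((\<lambda>\<tau>. 2 / c * (S \<tau> * G (of_real \<tau>))) has_vector_derivative
              2 / c * (S \<tau> * ((exp (\<kappa> z ?t) * (c * (- B ?y + dc * \<Sigma> ?m / 2)) * D z ?t +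
               c * (pot \<beta> ?y - dc * pot (\<lambda>_. 1) ?m / 2) * exp (\<kappa> z ?t)) * f ?y +
              deriv f ?y * (0 + c * 1) * (exp (\<kappa> z ?t) * D z ?t)) +
              dc * c * wzeta (c * ?t) * S \<tau> * G ?t)) (at \<tau>)" .
      also have "2 / c * (S \<tau> * ((exp (\<kappa> z ?t) * (c * (- B ?y + dc * \<Sigma> ?m / 2)) * D z ?t +
               c * (pot \<beta> ?y - dc * pot (\<lambda>_. 1) ?m / 2) * exp (\<kappa> z ?t)) * f ?y +
              deriv f ?y * (0 + c * 1) * (exp (\<kappa> z ?t) * D z ?t)) +
              dc * c * wzeta (c * ?t) * S \<tau> * G ?t) =
            S \<tau> * exp (\<kappa> z ?t) * ((2 * dc * wzeta (c * ?t) * D z ?t +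
               2 * (- B ?y + dc * \<Sigma> ?m / 2) * D z ?t +
               2 * (pot \<beta> ?y - dc * pot (\<lambda>_. 1) ?m / 2)) * f ?y + 2 * D z ?t * deriv f ?y)"
        using c_nonzero by (simp add: G_def field_simps)
      also have "\<dots> = S \<tau> * exp (\<kappa> z ?t) * ((D' z ?t + (D z ?t)\<^sup>2 + W ?y - V z) * f ?y + 2 * D z ?t * deriv f ?y)"
        by (simp only: kernel_equation[OF z \<tau>(1,2)])
      also have "\<dots> = S \<tau> * N2 z \<tau> - V z * (S \<tau> * N z \<tau>)"
        by (simp add: N2_def N_def algebra_simps)
      finally show "((\<lambda>\<tau>. 2 / c * (S \<tau> * G (of_real \<tau>))) has_vector_derivative
          S \<tau> * N2 z \<tau> - V z * (S \<tau> * N z \<tau>)) (at \<tau>)" .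
    next
      have slice: "continuous_on {0..1} (\<lambda>\<tau>. h z \<tau>)"
        if "continuous_on (\<Omega> \<times> {0..1}) (\<lambda>p. h (fst p) (snd p))" for h :: "complex \<Rightarrow> real \<Rightarrow> complex"
        using continuous_on_compose2[OF that continuous_on_Pair[OF continuous_on_const[of "{0..1}" z] continuous_on_id]]
          z by auto
      show "continuous_on {0..1} (\<lambda>\<tau>. 2 / c * (S \<tau> * G (of_real \<tau>)))"
        unfolding G_def
        by (intro continuous_on_mult continuous_on_const continuous_on_exp S(1)
            slice[of "\<lambda>z \<tau>. \<kappa> z (of_real \<tau>)"] slice[of "\<lambda>z \<tau>. D z (of_real \<tau>)"]
            slice[of "\<lambda>z \<tau>. f (z + c * of_real \<tau>)"] continuous_kernel_parts continuous_on_dom fh)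
    qed simp_all
    hence "((\<lambda>\<tau>. S \<tau> * N2 z \<tau> - V z * (S \<tau> * N z \<tau>)) has_integral 0) {0..1}"
      by (simp add: S)
    hence "integral {0..1} (\<lambda>\<tau>. S \<tau> * N2 z \<tau> - V z * (S \<tau> * N z \<tau>)) = 0" by (rule integral_unique)
    moreover have "(\<lambda>\<tau>. S \<tau> * N z \<tau>) integrable_on {0..1}"
      by (rule integral_deriv(2)[OF S(1) N_cont(1,2) N_deriv z])
    moreover have "(\<lambda>\<tau>. S \<tau> * N2 z \<tau>) integrable_on {0..1}"
    proof (rule integrable_continuous_real[OF continuous_on_mult[OF S(1)]])
      show "continuous_on {0..1} (N2 z)"
        using continuous_on_compose2[OF N_cont(3) continuous_on_Pair[OF continuous_on_const[of "{0..1}" z] continuous_on_id]]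
          z by auto
    qed
    ultimately show ?thesis
      by (subst (asm) integral_diff) (auto intro: integrable_on_mult_right)
  qed
  ultimately show "((\<lambda>z. integral {0..1} (\<lambda>\<tau>. S \<tau> * N1 z \<tau>)) has_field_derivative
     V z * integral {0..1} (\<lambda>\<tau>. S \<tau> * (exp (\<kappa> z (of_real \<tau>)) * f (z + c * of_real \<tau>)))) (at z)"
    by (simp add: N_def)
qed

text \<open>Invariance of the kernel makes the transform commute with the shift and its inverse.
  Their sum is the scalar \<open>disc W\<close> on the source and \<open>disc V\<close> on the
  target, so a single nonzero value of the transform forces the scalars to agree.\<close>

lemma transform_disc:
  fixes S :: "real \<Rightarrow> complex"
  assumes S: "continuous_on {0..1} S" "S 0 = 0" "S 1 = 0"
    and S_deriv: "\<And>\<tau>. 0 < \<tau> \<Longrightarrow> \<tau> < 1 \<Longrightarrow>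
       (S has_vector_derivative dc * c * wzeta (c * of_real \<tau>) * S \<tau>) (at \<tau>)"
    and f: "solves W f"
    and nz: "integral {0..1} (\<lambda>\<tau>. S \<tau> * (exp (\<kappa> x (of_real \<tau>)) * f (x + c * of_real \<tau>))) \<noteq> 0"
  shows "disc V = disc W"
proof -
  define g where "g = (\<lambda>z. integral {0..1} (\<lambda>\<tau>. S \<tau> * (exp (\<kappa> z (of_real \<tau>)) * f (z + c * of_real \<tau>))))"
  have g: "solves V g" unfolding g_def by (rule transform_solves[OF S S_deriv f])
  have fh: "f holomorphic_on \<Omega>" using f by (simp add: solves_def)
  have dom: "z + c * of_real \<tau> \<in> \<Omega>" "z + c * of_real \<tau> / 2 \<in> \<Omega>" if "z \<in> \<Omega>" "\<tau> \<in> {0..1}" for z \<tau>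
    using segment_shift[OF that] segment_half[OF that] by auto
  have int: "(\<lambda>\<tau>. S \<tau> * (exp (\<kappa> z (of_real \<tau>)) * f (z + c * of_real \<tau>))) integrable_on {0..1}"
    if z: "z \<in> \<Omega>" for z
  proof (rule integrable_continuous_real[OF continuous_on_mult[OF S(1)]])
    have "continuous_on (\<Omega> \<times> {0..1}) (\<lambda>p. exp (\<kappa> (fst p) (of_real (snd p))) * f (fst p + c * of_real (snd p)))"
      by (intro continuous_on_mult continuous_on_exp continuous_kernel_parts continuous_on_dom fh)
    from continuous_on_compose2[OF this continuous_on_Pair[OF continuous_on_const[of "{0..1}" z] continuous_on_id]] z
    show "continuous_on {0..1} (\<lambda>\<tau>. exp (\<kappa> z (of_real \<tau>)) * f (z + c * of_real \<tau>))" by auto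
  qed
  have \<kappa>: "\<kappa> (x + c) (of_real \<tau>) = \<kappa> x (of_real \<tau>)" "\<kappa> (x - c) (of_real \<tau>) = \<kappa> x (of_real \<tau>)"
    if "\<tau> \<in> {0..1}" for \<tau>
  proof -
    show "\<kappa> (x + c) (of_real \<tau>) = \<kappa> x (of_real \<tau>)"
      using base_in_dom that by (intro \<kappa>_shift dom) auto
    have xc: "x - c \<in> \<Omega>" using base_in_dom by simp
    have "\<kappa> (x - c + c) (of_real \<tau>) = \<kappa> (x - c) (of_real \<tau>)"
      by (intro \<kappa>_shift dom xc that)
    thus "\<kappa> (x - c) (of_real \<tau>) = \<kappa> x (of_real \<tau>)" by simp
  qed
  have "two_sided g x = integral {0..1} (\<lambda>\<tau>.
      S \<tau> * (exp (\<kappa> (x + c) (of_real \<tau>)) * f (x + c + c * of_real \<tau>)) +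
      S \<tau> * (exp (\<kappa> (x - c) (of_real \<tau>)) * f (x - c + c * of_real \<tau>)))"
    unfolding two_sided_def g_def using base_in_dom by (intro integral_add[symmetric] int) auto
  also have "\<dots> = integral {0..1} (\<lambda>\<tau>. disc W * (S \<tau> * (exp (\<kappa> x (of_real \<tau>)) * f (x + c * of_real \<tau>))))"
  proof (rule integral_cong)
    fix \<tau> :: real assume \<tau>: "\<tau> \<in> {0..1}"
    have "two_sided f (x + c * of_real \<tau>) = disc W * f (x + c * of_real \<tau>)"
      by (intro two_sided_eq_disc VW_holomorphic VW_periodic f dom base_in_dom \<tau>)
    moreover have "x + c + c * of_real \<tau> = x + c * of_real \<tau> + c" "x - c + c * of_real \<tau> = x + c * of_real \<tau> - c"
      by simp_all
    ultimately have "f (x + c + c * of_real \<tau>) + f (x - c + c * of_real \<tau>) = disc W * f (x + c * of_real \<tau>)"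
      by (simp only: two_sided_def)
    hence "S \<tau> * exp (\<kappa> x (of_real \<tau>)) * (f (x + c + c * of_real \<tau>) + f (x - c + c * of_real \<tau>)) =
           S \<tau> * exp (\<kappa> x (of_real \<tau>)) * (disc W * f (x + c * of_real \<tau>))" by (simp only:)
    thus "S \<tau> * (exp (\<kappa> (x + c) (of_real \<tau>)) * f (x + c + c * of_real \<tau>)) +
      S \<tau> * (exp (\<kappa> (x - c) (of_real \<tau>)) * f (x - c + c * of_real \<tau>)) =
      disc W * (S \<tau> * (exp (\<kappa> x (of_real \<tau>)) * f (x + c * of_real \<tau>)))"
      unfolding \<kappa>[OF \<tau>] by (simp only: distrib_left mult_ac)
  qed
  also have "\<dots> = disc W * g x" by (simp add: g_def)
  finally have "disc V * g x = disc W * g x"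
    using two_sided_eq_disc[OF VW_holomorphic(1) VW_periodic(1) g base_in_dom] by simp
  thus ?thesis using nz by (simp add: g_def)
qed

end

section \<open>Large negative energies\<close>

text \<open>Factoring the operator into first-order parts, \<psi> = exp(-\<mu> t) \<phi> and
  \<omega> = exp(\<mu> t) (\<phi>' - \<mu> \<phi>) satisfy \<psi>' = exp(-2 \<mu> t) \<omega> and
  \<omega>' = exp(2 \<mu> t) q \<psi>. The initial values select the growing solution, for which
  \<omega> starts at 0.\<close>

lemma exponential_growth_bound:
  fixes \<phi> \<phi>1 q :: "real \<Rightarrow> complex" and \<mu> B :: real
  assumes \<mu>: "\<mu> > 0" "B \<ge> 0" "B \<le> \<mu>"
    and \<phi>: "\<And>t. t \<in> {0..1} \<Longrightarrow> (\<phi> has_vector_derivative \<phi>1 t) (at t)"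
    and \<phi>1: "\<And>t. t \<in> {0..1} \<Longrightarrow> (\<phi>1 has_vector_derivative (of_real (\<mu>\<^sup>2) + q t) * \<phi> t) (at t)"
    and q: "\<And>t. t \<in> {0..1} \<Longrightarrow> norm (q t) \<le> B"
    and init: "\<phi> 0 = 1" "\<phi>1 0 = of_real \<mu>"
    and t: "t \<in> {0..1}"
  shows "norm (of_real (exp (- \<mu> * t)) * \<phi> t - 1) \<le> B / \<mu>"
proof -
  define \<psi> where "\<psi> = (\<lambda>t. of_real (exp (- \<mu> * t)) * \<phi> t)"
  define \<omega> where "\<omega> = (\<lambda>t. of_real (exp (\<mu> * t)) * (\<phi>1 t - of_real \<mu> * \<phi> t))"
  have \<psi>_deriv: "(\<psi> has_vector_derivative of_real (exp (- 2 * \<mu> * t)) * \<omega> t) (at t)" if t: "t \<in> {0..1}" for t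
  proof -
    have e: "((\<lambda>t. complex_of_real (exp (- \<mu> * t))) has_vector_derivative of_real (exp (- \<mu> * t) * (- \<mu>))) (at t)"
      by (intro has_vector_derivative_of_real) (auto intro!: derivative_eq_intros)
    have "(\<psi> has_vector_derivative of_real (exp (- \<mu> * t)) * \<phi>1 t + of_real (exp (- \<mu> * t) * (- \<mu>)) * \<phi> t) (at t)"
      unfolding \<psi>_def by (intro has_vector_derivative_mult e \<phi> t)
    moreover have "exp (- \<mu> * t) = exp (- 2 * \<mu> * t) * exp (\<mu> * t)" by (simp flip: exp_add)
    hence "complex_of_real (exp (- \<mu> * t)) = of_real (exp (- 2 * \<mu> * t)) * of_real (exp (\<mu> * t))"
      by (simp only: of_real_mult)
    ultimately show ?thesis by (simp add: \<omega>_def algebra_simps)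
  qed
  have \<omega>_deriv: "(\<omega> has_vector_derivative of_real (exp (2 * \<mu> * t)) * (q t * \<psi> t)) (at t)" if t: "t \<in> {0..1}" for t
  proof -
    have e: "((\<lambda>t. complex_of_real (exp (\<mu> * t))) has_vector_derivative of_real (exp (\<mu> * t) * \<mu>)) (at t)"
      by (intro has_vector_derivative_of_real) (auto intro!: derivative_eq_intros)
    have "(\<omega> has_vector_derivative
        of_real (exp (\<mu> * t)) * ((of_real (\<mu>\<^sup>2) + q t) * \<phi> t - of_real \<mu> * \<phi>1 t) +
        of_real (exp (\<mu> * t) * \<mu>) * (\<phi>1 t - of_real \<mu> * \<phi> t)) (at t)"
      unfolding \<omega>_def
      by (intro has_vector_derivative_mult has_vector_derivative_diff has_vector_derivative_mult_right e \<phi> \<phi>1 t)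
    moreover have "exp (\<mu> * t) = exp (2 * \<mu> * t) * exp (- \<mu> * t)" by (simp flip: exp_add)
    hence "complex_of_real (exp (\<mu> * t)) = of_real (exp (2 * \<mu> * t)) * of_real (exp (- \<mu> * t))"
      by (simp only: of_real_mult)
    ultimately show ?thesis by (simp add: \<psi>_def algebra_simps power2_eq_square)
  qed
  have cont: "continuous_on {0..1} \<psi>" "continuous_on {0..1} \<omega>"
    using has_vector_derivative_continuous[OF \<psi>_deriv] has_vector_derivative_continuous[OF \<omega>_deriv]
    by (auto intro!: continuous_at_imp_continuous_on)
  \<comment> \<open>The estimates of \<open>\<omega>\<close> and then \<open>\<psi>\<close> are made
    in terms of the still unknown maximum of |\<psi>|, which is bounded by its own half plus 1 at
    the end.\<close>
  obtain t0 where t0: "t0 \<in> {0..1}" "\<And>t. t \<in> {0..1} \<Longrightarrow> norm (\<psi> t) \<le> norm (\<psi> t0)"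
    using continuous_attains_sup[OF _ _ continuous_on_norm[OF cont(1)]] by fastforce
  define m where "m = norm (\<psi> t0)"
  define K where "K = B * m / (2 * \<mu>)"
  have K0: "K \<ge> 0" using \<mu> by (simp add: K_def m_def)
  have init': "\<psi> 0 = 1" "\<omega> 0 = 0" by (simp_all add: \<psi>_def \<omega>_def init)
  have \<omega>_bound: "norm (\<omega> t) \<le> K * exp (2 * \<mu> * t)" if t: "t \<in> {0..1}" for t
  proof (cases "t = 0")
    case False
    have "norm (\<omega> t - \<omega> 0) \<le> K * exp (2 * \<mu> * t) - K * exp (2 * \<mu> * 0)"
    proof (rule differentiable_bound_general)
      fix s assume s: "0 < s" "s < t"
      show "(\<omega> has_vector_derivative of_real (exp (2 * \<mu> * s)) * (q s * \<psi> s)) (at s)"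
        using s t by (intro \<omega>_deriv) auto
      have "((\<lambda>s. K * exp (2 * \<mu> * s)) has_real_derivative K * (exp (2 * \<mu> * s) * (2 * \<mu>))) (at s)"
        by (auto intro!: derivative_eq_intros)
      thus "((\<lambda>s. K * exp (2 * \<mu> * s)) has_vector_derivative K * (exp (2 * \<mu> * s) * (2 * \<mu>))) (at s)"
        by (simp add: has_real_derivative_iff_has_vector_derivative)
      have "norm (q s) * norm (\<psi> s) \<le> B * m"
        unfolding m_def using s t \<mu> by (intro mult_mono q t0) auto
      hence "exp (2 * \<mu> * s) * (norm (q s) * norm (\<psi> s)) \<le> exp (2 * \<mu> * s) * (B * m)"
        by (intro mult_left_mono) auto
      also have "\<dots> = K * (exp (2 * \<mu> * s) * (2 * \<mu>))" using \<mu> by (simp add: K_def)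
      finally show "norm (of_real (exp (2 * \<mu> * s)) * (q s * \<psi> s)) \<le> K * (exp (2 * \<mu> * s) * (2 * \<mu>))"
        by (simp add: norm_mult)
    qed (use t False in \<open>auto intro!: continuous_intros continuous_on_subset[OF cont(2)]\<close>)
    thus ?thesis using K0 by (simp add: init')
  qed (use K0 in \<open>simp add: init'\<close>)
  have \<psi>_bound: "norm (\<psi> t - 1) \<le> K" if t: "t \<in> {0..1}" for t
  proof (cases "t = 0")
    case False
    have "norm (\<psi> t - \<psi> 0) \<le> K * t - K * 0"
    proof (rule differentiable_bound_general)
      fix s assume s: "0 < s" "s < t"
      hence s': "s \<in> {0..1}" using t by auto
      show "(\<psi> has_vector_derivative of_real (exp (- 2 * \<mu> * s)) * \<omega> s) (at s)" by (rule \<psi>_deriv[OF s'])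
      show "((\<lambda>s. K * s) has_vector_derivative K) (at s)"
        by (auto simp: has_real_derivative_iff_has_vector_derivative[symmetric] intro!: derivative_eq_intros)
      have "norm (of_real (exp (- 2 * \<mu> * s)) * \<omega> s) = exp (- 2 * \<mu> * s) * norm (\<omega> s)"
        by (simp add: norm_mult)
      also have "\<dots> \<le> exp (- 2 * \<mu> * s) * (K * exp (2 * \<mu> * s))"
        by (intro mult_left_mono \<omega>_bound s') auto
      also have "\<dots> = K" by (simp add: exp_minus field_simps)
      finally show "norm (of_real (exp (- 2 * \<mu> * s)) * \<omega> s) \<le> K" .
    qed (use t False in \<open>auto intro!: continuous_intros continuous_on_subset[OF cont(1)]\<close>)
    hence "norm (\<psi> t - 1) \<le> K * t" by (simp add: init')
    also have "\<dots> \<le> K * 1" using t K0 by (intro mult_left_mono) auto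
    finally show ?thesis by simp
  qed (use K0 in \<open>simp add: init'\<close>)
  \<comment> \<open>From B \<le> \<mu> comes K \<le> m / 2, hence m \<le> 1 + m / 2 and m \<le> 2;
    reinserted into \<open>K\<close> this gives the bound B / \<mu>.\<close>
  have "m \<le> norm (\<psi> t0 - 1) + 1" unfolding m_def using norm_triangle_ineq[of "\<psi> t0 - 1" 1] by simp
  also have "\<dots> \<le> K + 1" using \<psi>_bound[OF t0(1)] by simp
  also have "K \<le> \<mu> * m / (2 * \<mu>)"
    unfolding K_def using \<mu> by (intro divide_right_mono mult_right_mono) (auto simp: m_def)
  also have "\<mu> * m / (2 * \<mu>) = m / 2" using \<mu> by simp
  finally have "m \<le> 2" by simp
  hence "K \<le> B * 2 / (2 * \<mu>)"
    unfolding K_def using \<mu> by (intro divide_right_mono mult_left_mono) auto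
  hence "K \<le> B / \<mu>" by simp
  with \<psi>_bound[OF t] show ?thesis by (simp add: \<psi>_def)
qed

text \<open>Laplace's method: a short interval just left of 1 contributes at least a multiple of
  exp(\<mu> (1 - \<delta> / 2)), everything left of 1 - \<delta> at most a multiple of exp(\<mu> (1
  - \<delta>)). The short interval stays away from 1, where (1 - t)^d vanishes. The threshold does
  not depend on \<psi>, which will vary with \<mu>.\<close>

lemma laplace_integral_nonzero:
  fixes h :: "real \<Rightarrow> complex" and d C :: real
  assumes d: "d > 0" and h: "continuous_on {0..1} h" "h 1 \<noteq> 0" and C: "C \<ge> 0"
  shows "\<exists>\<Lambda>>0. \<forall>\<mu>\<ge>\<Lambda>. \<forall>\<psi>. continuous_on {0..1} \<psi> \<longrightarrow> (\<forall>t\<in>{0..1}. norm (\<psi> t - 1) \<le> C / \<mu>) \<longrightarrow>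
       integral {0..1} (\<lambda>t. of_real (t powr d) * of_real ((1 - t) powr d) * h t *
         (of_real (exp (\<mu> * t)) * \<psi> t)) \<noteq> 0"
proof -
  \<comment> \<open>Normalised to \<open>k 1 = 1\<close>, so that near 1 the integrand has positive
    real part and no cancellation can occur there.\<close>
  define k where "k = (\<lambda>t. of_real (t powr d) * h t / h 1)"
  have k_cont: "continuous_on {0..1} k"
    unfolding k_def using d h by (intro continuous_intros continuous_on_powr') auto
  have k1: "k 1 = 1" using h by (simp add: k_def)
  have "bounded (k ` {0..1})" using k_cont by (intro compact_imp_bounded compact_continuous_image) auto
  then obtain M where "\<forall>t\<in>{0..1}. norm (k t) \<le> M" by (auto simp: bounded_iff)
  hence M: "norm (k t) \<le> M" if "t \<in> {0..1}" for t using that by blast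
  have M1: "M \<ge> 1" using M[of 1] k1 by simp
  have "\<exists>\<delta>>0. \<forall>t\<in>{0..1}. dist t 1 < \<delta> \<longrightarrow> dist (k t) (k 1) < 1/4"
    using k_cont[unfolded continuous_on_iff, rule_format, of 1 "1/4"] by simp
  then obtain \<delta>' where \<delta>': "\<delta>' > 0" "\<And>t. t \<in> {0..1} \<Longrightarrow> dist t 1 < \<delta>' \<Longrightarrow> dist (k t) (k 1) < 1/4" by blast
  define \<delta> where "\<delta> = min (1/2) (\<delta>' / 2)"
  have \<delta>: "\<delta> > 0" "\<delta> \<le> 1/2" "\<delta> < \<delta>'" using \<delta>' by (auto simp: \<delta>_def)
  have k_near: "norm (k t - 1) \<le> 1/4" if "t \<in> {1 - \<delta>..1}" for t
    using \<delta>'(2)[of t] that \<delta> k1 by (simp add: dist_norm)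
  \<comment> \<open>On [1 - \<delta>/2, 1 - \<delta>/4] the real part of k \<psi> is at least 1/4
    and (1 - t)^d at least (\<delta>/4)^d; the last factor is the length of that interval.\<close>
  define c0 where "c0 = 1/4 * (\<delta> / 4) powr d * (\<delta> / 4)"
  have c0: "c0 > 0" using \<delta> by (simp add: c0_def)
  \<comment> \<open>The term 4 C forces |\<psi> - 1| \<le> 1/4; the last one gives c0 exp(\<mu>
    \<delta> / 2) > 2 M by exp s \<ge> 1 + s.\<close>
  define \<Lambda> where "\<Lambda> = 1 + 4 * C + 4 * M / (c0 * \<delta>)"
  have \<Lambda>: "\<Lambda> > 0" "\<Lambda> \<ge> 4 * C" using C M1 c0 \<delta> by (auto simp: \<Lambda>_def intro!: add_pos_nonneg)
  show ?thesis
  proof (intro exI conjI allI impI)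
    show "\<Lambda> > 0" by (rule \<Lambda>(1))
    fix \<mu> :: real and \<psi> :: "real \<Rightarrow> complex"
    assume \<mu>: "\<mu> \<ge> \<Lambda>" and \<psi>_cont: "continuous_on {0..1} \<psi>"
      and \<psi>: "\<forall>t\<in>{0..1}. norm (\<psi> t - 1) \<le> C / \<mu>"
    have \<mu>0: "\<mu> > 0" using \<mu> \<Lambda> by linarith
    have C\<mu>: "C / \<mu> \<le> 1/4" using \<mu> \<Lambda> \<mu>0 by (simp add: field_simps)
    have \<psi>1: "norm (\<psi> t - 1) \<le> 1/4" if "t \<in> {0..1}" for t using bspec[OF \<psi> that] C\<mu> by linarith
    have \<psi>2: "norm (\<psi> t) \<le> 2" if "t \<in> {0..1}" for t
      using \<psi>1[OF that] norm_triangle_ineq[of "\<psi> t - 1" 1] by simp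
    define G where "G = (\<lambda>t. of_real ((1 - t) powr d * exp (\<mu> * t)) * (k t * \<psi> t))"
    have G_cont: "continuous_on {0..1} G"
      unfolding G_def using d k_cont \<psi>_cont by (intro continuous_intros continuous_on_powr') auto
    \<comment> \<open>The added constant bounds |G| left of 1 - \<delta>, which makes
      \<open>F\<close> nonnegative throughout; its integral may then be bounded below by the one
      over the short interval.\<close>
    define F where "F = (\<lambda>t. Re (G t) + 2 * M * exp (\<mu> * (1 - \<delta>)))"
    have near: "Re (k t * \<psi> t) \<ge> 1/4" if t: "t \<in> {1 - \<delta>..1}" for t
    proof -
      have t': "t \<in> {0..1}" using t \<delta> by auto
      have "norm (k t * \<psi> t - 1) = norm ((k t - 1) * \<psi> t + (\<psi> t - 1))" by (simp add: algebra_simps)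
      also have "\<dots> \<le> norm (k t - 1) * norm (\<psi> t) + norm (\<psi> t - 1)"
        by (metis norm_triangle_ineq norm_mult)
      also have "\<dots> \<le> 1/4 * 2 + 1/4"
        using k_near[OF t] \<psi>1[OF t'] \<psi>2[OF t'] by (intro add_mono mult_mono) auto
      finally have "norm (k t * \<psi> t - 1) \<le> 3/4" by simp
      with abs_Re_le_cmod[of "k t * \<psi> t - 1"] show ?thesis by simp
    qed
    have F_nonneg: "F t \<ge> 0" if t: "t \<in> {0..1}" for t
    proof (cases "t \<ge> 1 - \<delta>")
      case True
      have "Re (G t) = (1 - t) powr d * exp (\<mu> * t) * Re (k t * \<psi> t)" by (simp add: G_def Re_complex_of_real)
      also have "\<dots> \<ge> 0" using near[of t] True t by (intro mult_nonneg_nonneg) auto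
      finally show ?thesis using M1 by (simp add: F_def)
    next
      case False
      have "norm (k t * \<psi> t) \<le> M * 2" unfolding norm_mult using M[OF t] \<psi>2[OF t] M1 by (intro mult_mono) auto
      moreover have "(1 - t) powr d * exp (\<mu> * t) \<le> 1 * exp (\<mu> * (1 - \<delta>))"
        using t False \<mu>0 d by (intro mult_mono powr_le1) auto
      ultimately have "norm (G t) \<le> 1 * exp (\<mu> * (1 - \<delta>)) * (M * 2)"
        unfolding G_def norm_mult[of "of_real _"] norm_of_real by (intro mult_mono) auto
      hence "norm (G t) \<le> 2 * M * exp (\<mu> * (1 - \<delta>))" by (simp only: mult_ac mult_1)
      thus ?thesis using abs_Re_le_cmod[of "G t"] unfolding F_def by linarith
    qed
    have F_low: "F t \<ge> (\<delta> / 4) powr d * exp (\<mu> * (1 - \<delta> / 2)) * (1/4)" if t: "t \<in> {1 - \<delta>/2..1 - \<delta>/4}" for t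
    proof -
      have "(\<delta> / 4) powr d * exp (\<mu> * (1 - \<delta> / 2)) * (1/4) \<le> (1 - t) powr d * exp (\<mu> * t) * Re (k t * \<psi> t)"
        using t \<delta> d \<mu>0 near[of t] by (intro mult_mono powr_mono2) auto
      also have "\<dots> = Re (G t)" by (simp add: G_def Re_complex_of_real)
      also have "\<dots> \<le> F t" using M1 by (simp add: F_def)
      finally show ?thesis .
    qed
    have F_cont: "continuous_on {0..1} F" unfolding F_def by (intro continuous_intros G_cont)
    have "G integrable_on {0..1}" by (rule integrable_continuous_real[OF G_cont])
    hence Re_int: "((\<lambda>t. Re (G t)) has_integral Re (integral {0..1} G)) {0..1}"
      using has_integral_linear[OF integrable_integral bounded_linear_Re] by (simp add: o_def)
    have "c0 * exp (\<mu> * (1 - \<delta> / 2)) = integral {1 - \<delta>/2..1 - \<delta>/4} (\<lambda>_. (\<delta> / 4) powr d * exp (\<mu> * (1 - \<delta> / 2)) * (1/4))"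
      using \<delta> by (simp add: c0_def content_real)
    also have "\<dots> \<le> integral {1 - \<delta>/2..1 - \<delta>/4} F"
      using \<delta> F_low by (intro integral_le integrable_const_ivl integrable_continuous_real continuous_on_subset[OF F_cont]) auto
    also have "\<dots> \<le> integral {0..1} F"
      using \<delta> F_nonneg
      by (intro integral_subset_le integrable_continuous_real continuous_on_subset[OF F_cont]) auto
    also have "\<dots> = integral {0..1} (\<lambda>t. Re (G t)) + 2 * M * exp (\<mu> * (1 - \<delta>))"
      unfolding F_def using has_integral_integrable[OF Re_int] by (subst integral_add) auto
    also have "integral {0..1} (\<lambda>t. Re (G t)) = Re (integral {0..1} G)"
      using Re_int by (rule integral_unique)
    finally have ineq: "c0 * exp (\<mu> * (1 - \<delta> / 2)) \<le> Re (integral {0..1} G) + 2 * M * exp (\<mu> * (1 - \<delta>))" .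
    have "4 * M / (c0 * \<delta>) < \<mu>" using \<mu> C by (simp add: \<Lambda>_def)
    hence "2 * M < c0 * (\<mu> * \<delta> / 2)" using c0 \<delta> by (simp add: field_simps)
    also have "\<dots> \<le> c0 * exp (\<mu> * \<delta> / 2)"
      using c0 exp_ge_add_one_self[of "\<mu> * \<delta> / 2"] by (intro mult_left_mono) linarith+
    finally have "2 * M * exp (\<mu> * (1 - \<delta>)) < c0 * exp (\<mu> * \<delta> / 2) * exp (\<mu> * (1 - \<delta>))"
      by (intro mult_strict_right_mono) auto
    also have "\<dots> = c0 * exp (\<mu> * (1 - \<delta> / 2))"
      by (simp add: mult.assoc algebra_simps flip: exp_add)
    finally have "integral {0..1} G \<noteq> 0" using ineq by auto
    moreover have "integral {0..1} (\<lambda>t. of_real (t powr d) * of_real ((1 - t) powr d) * h t *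
         (of_real (exp (\<mu> * t)) * \<psi> t)) = integral {0..1} (\<lambda>t. h 1 * G t)"
      using h(2) by (intro integral_cong) (simp add: G_def k_def)
    ultimately show "integral {0..1} (\<lambda>t. of_real (t powr d) * of_real ((1 - t) powr d) * h t *
         (of_real (exp (\<mu> * t)) * \<psi> t)) \<noteq> 0"
      using h(2) by simp
  qed
qed

lemma entire_zero_on_ray:
  fixes F :: "complex \<Rightarrow> complex" and \<Lambda> :: real
  assumes "F holomorphic_on UNIV" "\<And>r::real. r > \<Lambda> \<Longrightarrow> F (of_real r) = 0"
  shows "F p = 0"
proof (rule analytic_continuation[of F UNIV "of_real ` {\<Lambda><..}" "of_real (\<Lambda> + 1)"])
  show "complex_of_real (\<Lambda> + 1) islimpt complex_of_real ` {\<Lambda><..}"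
    unfolding islimpt_sequential
  proof (intro exI conjI allI)
    show "complex_of_real (\<Lambda> + 1 + 1 / real (Suc n)) \<in> complex_of_real ` {\<Lambda><..} - {of_real (\<Lambda> + 1)}" for n
    proof -
      have "1 / real (Suc n) > 0" by simp
      hence "\<Lambda> + 1 + 1 / real (Suc n) > \<Lambda>" "\<Lambda> + 1 + 1 / real (Suc n) \<noteq> \<Lambda> + 1" by linarith+
      thus ?thesis by (simp only: of_real_eq_iff Diff_iff singleton_iff) blast
    qed
    have "(\<lambda>n. \<Lambda> + 1 + 1 / real (Suc n)) \<longlonglongrightarrow> \<Lambda> + 1 + 0"
      by (intro tendsto_intros LIMSEQ_Suc[OF lim_1_over_n])
    thus "(\<lambda>n. complex_of_real (\<Lambda> + 1 + 1 / real (Suc n))) \<longlonglongrightarrow> complex_of_real (\<Lambda> + 1)"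
      by (intro tendsto_of_real) simp
  qed
qed (use assms in auto)

section \<open>Equality of the discriminants\<close>

context strip
begin

text \<open>For E = -(\<mu> / c)^2 the equation along y = x + c \<tau> reads \<phi>'' = (\<mu>^2 +
  bounded) \<phi>. Its growing solution is close to exp(\<mu> \<tau>), so Laplace's method shows
  that the transform is nonzero at x.\<close>

lemma disc_eq_large:
  fixes \<alpha> :: "nat \<Rightarrow> complex" and d :: real
  assumes d: "d > 0" and \<alpha>: "(\<Sum>i=0..3. \<alpha> i) = - 2 * of_real d"
  obtains \<Lambda> where "\<And>\<mu>::real. \<mu> > \<Lambda> \<Longrightarrow>
    disc (\<lambda>z. pot (\<lambda>i. \<alpha> i * (\<alpha> i - 1)) z + (of_real \<mu> / c)\<^sup>2) =
    disc (\<lambda>z. pot (\<lambda>i. (\<alpha> i + of_real d) * (\<alpha> i + of_real d + 1)) z + (of_real \<mu> / c)\<^sup>2)"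
proof -
  define \<beta> where "\<beta> = (\<lambda>i. \<alpha> i + complex_of_real d)"
  define b where "b = (\<lambda>i. \<beta> i * (\<beta> i + 1))"
  obtain S R :: "real \<Rightarrow> complex" where S: "continuous_on {0..1} S" "S 0 = 0" "S 1 = 0"
    and R: "continuous_on {0..1} R"
    and SR: "\<And>t. t \<in> {0..1} \<Longrightarrow> S t = of_real (t powr d) * of_real ((1 - t) powr d) * exp (R t)"
    and S_deriv: "\<And>t. 0 < t \<Longrightarrow> t < 1 \<Longrightarrow>
       (S has_vector_derivative of_real d * c * wzeta (c * of_real t) * S t) (at t)"
    using end_factor_exists[OF d] by blast
  \<comment> \<open>The energy 0 is arbitrary: only \<open>\<kappa>\<close> is taken from this
    instance, and it does not involve the energy. Thus \<open>h\<close>, and with it the threshold,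
    is fixed before \<mu> is chosen.\<close>
  interpret K0: kernel \<omega>1 \<omega>3 \<Omega> x c \<alpha> \<beta> d 0
    by unfold_locales (use d \<alpha> in \<open>auto simp: \<beta>_def\<close>)
  have slice: "continuous_on {0..1} (\<lambda>t. h x t)"
    if "continuous_on (\<Omega> \<times> {0..1}) (\<lambda>p. h (fst p) (snd p))" for h :: "complex \<Rightarrow> real \<Rightarrow> complex"
    using continuous_on_compose2[OF that continuous_on_Pair[OF continuous_on_const[of "{0..1}" x] continuous_on_id]]
      base_in_dom by auto
  define h where "h = (\<lambda>t. exp (R t) * exp (K0.\<kappa> x (complex_of_real t)))"
  have h: "continuous_on {0..1} h" "h 1 \<noteq> 0"
    unfolding h_def
    by (intro continuous_on_mult continuous_on_exp R slice[of "\<lambda>z t. K0.\<kappa> z (of_real t)"] K0.continuous_kernel_parts)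
       simp
  have path: "x + c * of_real t \<in> \<Omega>" if "t \<in> {0..1}" for t
    using segment_shift[OF base_in_dom that] .
  have "continuous_on {0..1} (\<lambda>t. c\<^sup>2 * pot b (x + c * of_real t))"
    by (intro continuous_on_mult continuous_on_const slice[of "\<lambda>z t. pot b (z + c * of_real t)"]
        continuous_on_dom pot_holomorphic)
  hence "bounded ((\<lambda>t. c\<^sup>2 * pot b (x + c * of_real t)) ` {0..1})"
    by (intro compact_imp_bounded compact_continuous_image) auto
  then obtain B0 where "\<forall>t\<in>{0..1}. norm (c\<^sup>2 * pot b (x + c * of_real t)) \<le> B0"
    by (auto simp: bounded_iff)
  hence B: "norm (c\<^sup>2 * pot b (x + c * of_real t)) \<le> max 0 B0" if "t \<in> {0..1}" for t
    using that by fastforce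
  obtain \<Lambda> where \<Lambda>: "\<Lambda> > 0"
    "\<forall>\<mu>\<ge>\<Lambda>. \<forall>\<psi>. continuous_on {0..1} \<psi> \<longrightarrow> (\<forall>t\<in>{0..1}. norm (\<psi> t - 1) \<le> max 0 B0 / \<mu>) \<longrightarrow>
       integral {0..1} (\<lambda>t. of_real (t powr d) * of_real ((1 - t) powr d) * h t *
         (of_real (exp (\<mu> * t)) * \<psi> t)) \<noteq> 0"
    using laplace_integral_nonzero[OF d h max.cobounded1[of 0 B0]] by blast
  show ?thesis
  proof (rule that[of "max \<Lambda> B0"])
    fix \<mu> :: real assume "\<mu> > max \<Lambda> B0"
    hence \<mu>: "\<mu> > 0" "\<mu> \<ge> \<Lambda>" "max 0 B0 \<le> \<mu>" using \<Lambda>(1) by auto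
    interpret K: kernel \<omega>1 \<omega>3 \<Omega> x c \<alpha> \<beta> d "- (of_real \<mu> / c)\<^sup>2"
      by unfold_locales (use d \<alpha> in \<open>auto simp: \<beta>_def\<close>)
    \<comment> \<open>The slope \<mu> / c in y is the slope \<mu> in \<tau>, the initial value of
      the growing exponential.\<close>
    obtain f where f: "solves K.W f" "f x = 1" "deriv f x = of_real \<mu> / c"
      using solution_exists[OF K.VW_holomorphic(2)] by blast
    have W: "K.W z = pot b z + (of_real \<mu> / c)\<^sup>2" for z by (simp add: K.W_def b_def)
    define \<phi> where "\<phi> = (\<lambda>t. f (x + c * complex_of_real t))"
    define \<phi>1 where "\<phi>1 = (\<lambda>t. c * deriv f (x + c * complex_of_real t))"
    have line: "((\<lambda>w. x + c * w) has_field_derivative c) (at w)" for w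
      by (auto intro!: derivative_eq_intros)
    have \<phi>: "(\<phi> has_vector_derivative \<phi>1 t) (at t)" if t: "t \<in> {0..1}" for t
    proof -
      have "((\<lambda>w. f (x + c * w)) has_field_derivative deriv f (x + c * of_real t) * c) (at (of_real t))"
        by (rule DERIV_chain2[OF solvesD(1)[OF f(1) path[OF t]] line])
      from has_vector_derivative_real_field[OF this] show ?thesis by (simp add: \<phi>_def \<phi>1_def mult.commute)
    qed
    have \<phi>1: "(\<phi>1 has_vector_derivative (of_real (\<mu>\<^sup>2) + c\<^sup>2 * pot b (x + c * of_real t)) * \<phi> t) (at t)"
      if t: "t \<in> {0..1}" for t
    proof -
      have "((\<lambda>w. c * deriv f (x + c * w)) has_field_derivative
              c * (K.W (x + c * of_real t) * f (x + c * of_real t) * c)) (at (of_real t))"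
        by (rule DERIV_cmult[OF DERIV_chain2[OF solvesD(2)[OF f(1) path[OF t]] line]])
      moreover have "c * (K.W (x + c * of_real t) * f (x + c * of_real t) * c) =
          (of_real (\<mu>\<^sup>2) + c\<^sup>2 * pot b (x + c * of_real t)) * \<phi> t"
        unfolding W \<phi>_def using c_nonzero by (simp add: power2_eq_square field_simps)
      ultimately show ?thesis
        using has_vector_derivative_real_field[of "\<lambda>w. c * deriv f (x + c * w)"] by (simp add: \<phi>1_def)
    qed
    define \<psi> where "\<psi> = (\<lambda>t. of_real (exp (- \<mu> * t)) * \<phi> t)"
    have "continuous_on {0..1} \<phi>"
      using has_vector_derivative_continuous[OF \<phi>] by (auto intro!: continuous_at_imp_continuous_on)
    hence \<psi>_cont: "continuous_on {0..1} \<psi>" unfolding \<psi>_def by (intro continuous_intros)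
    have \<psi>: "norm (\<psi> t - 1) \<le> max 0 B0 / \<mu>" if "t \<in> {0..1}" for t
      unfolding \<psi>_def
      by (rule exponential_growth_bound[OF \<mu>(1) _ \<mu>(3) \<phi> \<phi>1 B _ _ that])
         (use f c_nonzero in \<open>auto simp: \<phi>_def \<phi>1_def\<close>)
    have "integral {0..1} (\<lambda>t. S t * (exp (K.\<kappa> x (of_real t)) * f (x + c * of_real t))) =
          integral {0..1} (\<lambda>t. of_real (t powr d) * of_real ((1 - t) powr d) * h t *
            (of_real (exp (\<mu> * t)) * \<psi> t))"
    proof (rule integral_cong)
      fix t :: real assume t: "t \<in> {0..1}"
      have "exp (\<mu> * t) * exp (- \<mu> * t) = 1" by (simp flip: exp_add)
      hence "complex_of_real (exp (\<mu> * t)) * complex_of_real (exp (- \<mu> * t)) = 1"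
        by (simp only: of_real_mult[symmetric] of_real_1)
      hence "complex_of_real (exp (\<mu> * t)) * \<psi> t = \<phi> t"
        by (simp only: \<psi>_def mult.assoc[symmetric] mult_1_left)
      thus "S t * (exp (K.\<kappa> x (of_real t)) * f (x + c * of_real t)) =
         of_real (t powr d) * of_real ((1 - t) powr d) * h t * (of_real (exp (\<mu> * t)) * \<psi> t)"
        by (simp add: SR[OF t] h_def \<phi>_def)
    qed
    also have "\<dots> \<noteq> 0" using \<Lambda>(2) \<mu>(2) \<psi>_cont \<psi> by blast
    finally have "disc K.V = disc K.W" by (intro K.transform_disc[OF S S_deriv f(1)])
    moreover have "K.V = (\<lambda>z. pot (\<lambda>i. \<alpha> i * (\<alpha> i - 1)) z + (of_real \<mu> / c)\<^sup>2)"
      by (simp add: fun_eq_iff K.V_def)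
    moreover have "K.W = (\<lambda>z. pot (\<lambda>i. (\<alpha> i + of_real d) * (\<alpha> i + of_real d + 1)) z + (of_real \<mu> / c)\<^sup>2)"
      by (rule ext) (use W in \<open>simp only: b_def \<beta>_def\<close>)
    ultimately show "disc (\<lambda>z. pot (\<lambda>i. \<alpha> i * (\<alpha> i - 1)) z + (of_real \<mu> / c)\<^sup>2) =
       disc (\<lambda>z. pot (\<lambda>i. (\<alpha> i + of_real d) * (\<alpha> i + of_real d + 1)) z + (of_real \<mu> / c)\<^sup>2)"
      by simp
  qed
qed

text \<open>With E = -(p / c)^2 both discriminants are entire in p and agree on a real ray of p.
  Every E is reached, by p = i c sqrt E.\<close>

lemma disc_eq_real:
  fixes \<alpha> :: "nat \<Rightarrow> complex" and d :: real
  assumes d: "d > 0" and \<alpha>: "(\<Sum>i=0..3. \<alpha> i) = - 2 * of_real d"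
  shows "disc (\<lambda>z. pot (\<lambda>i. \<alpha> i * (\<alpha> i - 1)) z - E) =
         disc (\<lambda>z. pot (\<lambda>i. (\<alpha> i + of_real d) * (\<alpha> i + of_real d + 1)) z - E)"
proof -
  let ?a = "\<lambda>i. \<alpha> i * (\<alpha> i - 1)" and ?b = "\<lambda>i. (\<alpha> i + of_real d) * (\<alpha> i + of_real d + 1)"
  define F where "F = (\<lambda>p. disc (\<lambda>z. pot ?a z + p * 0 + p\<^sup>2 * (1 / c\<^sup>2)) - disc (\<lambda>z. pot ?b z + p * 0 + p\<^sup>2 * (1 / c\<^sup>2)))"
  obtain \<Lambda> where \<Lambda>: "\<And>\<mu>::real. \<mu> > \<Lambda> \<Longrightarrow>
    disc (\<lambda>z. pot ?a z + (of_real \<mu> / c)\<^sup>2) = disc (\<lambda>z. pot ?b z + (of_real \<mu> / c)\<^sup>2)"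
    using disc_eq_large[OF d \<alpha>] by blast
  have "F (\<i> * c * csqrt E) = 0"
  proof (rule entire_zero_on_ray[where F = F and \<Lambda> = \<Lambda>])
    show "F holomorphic_on UNIV"
      unfolding F_def by (intro holomorphic_on_diff disc_holomorphic pot_holomorphic holomorphic_on_const)
    show "F (of_real r) = 0" if "r > \<Lambda>" for r :: real
      using \<Lambda>[OF that] by (simp add: F_def power_divide)
  qed
  moreover have "(\<i> * c * csqrt E)\<^sup>2 * (1 / c\<^sup>2) = - E"
    using c_nonzero by (simp add: power_mult_distrib)
  ultimately show ?thesis by (simp add: F_def)
qed

lemma disc_eq_reflection:
  fixes \<alpha> :: "nat \<Rightarrow> complex" and d :: complex
  assumes \<alpha>: "(\<Sum>i=0..3. \<alpha> i) = - 2 * d"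
  shows "disc (\<lambda>z. pot (\<lambda>i. \<alpha> i * (\<alpha> i - 1)) z - E) =
         disc (\<lambda>z. pot (\<lambda>i. (\<alpha> i + d) * (\<alpha> i + d + 1)) z - E)"
proof -
  \<comment> \<open>The midpoints of the exponents \<open>\<alpha> i\<close> and
    \<open>\<alpha> i + d\<close>; they sum to 0. Hence the numbers u_i - r/2 sum to -2 r for every
    r, which is the condition under which \<open>disc_eq_real\<close> applies for r > 0.\<close>
  define u where "u = (\<lambda>i. \<alpha> i + d / 2)"
  let ?q = "\<lambda>r z. pot (\<lambda>i. u i * (u i - 1)) z - E + r * pot (\<lambda>i. 1/2 - u i) z + r\<^sup>2 * pot (\<lambda>i. 1/4) z"
  let ?q' = "\<lambda>r z. pot (\<lambda>i. u i * (u i + 1)) z - E + r * pot (\<lambda>i. 1/2 + u i) z + r\<^sup>2 * pot (\<lambda>i. 1/4) z"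
  have q: "?q r = (\<lambda>z. pot (\<lambda>i. (u i - r / 2) * (u i - r / 2 - 1)) z - E)" for r
  proof
    fix z
    have "pot (\<lambda>i. u i * (u i - 1)) z + r * pot (\<lambda>i. 1/2 - u i) z + r\<^sup>2 * pot (\<lambda>i. 1/4) z =
          pot (\<lambda>i. u i * (u i - 1) + r * (1/2 - u i) + r\<^sup>2 * (1/4)) z"
      unfolding pot_def sum_distrib_left sum.distrib[symmetric] by (intro sum.cong refl) (simp add: algebra_simps)
    also have "(\<lambda>i. u i * (u i - 1) + r * (1/2 - u i) + r\<^sup>2 * (1/4)) = (\<lambda>i. (u i - r / 2) * (u i - r / 2 - 1))"
      by (simp add: fun_eq_iff field_simps power2_eq_square)
    finally show "?q r z = pot (\<lambda>i. (u i - r / 2) * (u i - r / 2 - 1)) z - E"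
      by (simp only: diff_add_eq)
  qed
  have q': "?q' r = (\<lambda>z. pot (\<lambda>i. (u i + r / 2) * (u i + r / 2 + 1)) z - E)" for r
  proof
    fix z
    have "pot (\<lambda>i. u i * (u i + 1)) z + r * pot (\<lambda>i. 1/2 + u i) z + r\<^sup>2 * pot (\<lambda>i. 1/4) z =
          pot (\<lambda>i. u i * (u i + 1) + r * (1/2 + u i) + r\<^sup>2 * (1/4)) z"
      unfolding pot_def sum_distrib_left sum.distrib[symmetric] by (intro sum.cong refl) (simp add: algebra_simps)
    also have "(\<lambda>i. u i * (u i + 1) + r * (1/2 + u i) + r\<^sup>2 * (1/4)) = (\<lambda>i. (u i + r / 2) * (u i + r / 2 + 1))"
      by (simp add: fun_eq_iff field_simps power2_eq_square)
    finally show "?q' r z = pot (\<lambda>i. (u i + r / 2) * (u i + r / 2 + 1)) z - E"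
      by (simp only: diff_add_eq)
  qed
  define F where "F = (\<lambda>r. disc (?q r) - disc (?q' r))"
  have "F d = 0"
  proof (rule entire_zero_on_ray[where F = F and \<Lambda> = 0])
    show "F holomorphic_on UNIV"
      unfolding F_def by (intro holomorphic_on_diff disc_holomorphic pot_holomorphic holomorphic_on_const)
    fix r :: real assume r: "r > 0"
    have "(\<Sum>i=0..3. u i - of_real r / 2) = - 2 * of_real r"
      by (simp add: u_def sum_subtractf sum.distrib \<alpha>)
    from disc_eq_real[OF r this, of E] show "F (of_real r) = 0"
      unfolding F_def q q' by (simp add: algebra_simps)
  qed
  moreover have "u i - d / 2 = \<alpha> i" "u i + d / 2 = \<alpha> i + d" for i
    by (simp_all add: u_def)
  ultimately show ?thesis unfolding F_def q q' by simp
qed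

section \<open>Monodromy matrices\<close>

text \<open>The germs of the basis extend to solutions on the whole strip, which contains the path
  of continuation. Continuing along it therefore means evaluating the extension, and M is the matrix
  of the shift acting on solutions on the strip.\<close>

lemma trace_monodromy_eq_disc:
  assumes M: "monodromy_matrix \<omega>1 \<omega>3 m E k x f M" and c: "c = 2 * half_period \<omega>1 \<omega>3 k"
  shows "trace M = disc (\<lambda>z. pot (\<lambda>i. m i * (m i + 1)) z - E)"
proof -
  define Q where "Q = (\<lambda>z. pot (\<lambda>i. m i * (m i + 1)) z - E)"
  have Q: "Q holomorphic_on \<Omega>" "periodic Q"
    unfolding Q_def by (intro holomorphic_intros pot_holomorphic) (simp add: periodic_def pot_periodic)
  from M have basis: "solution_basis \<omega>1 \<omega>3 m E x f" by (simp add: monodromy_matrix_def)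
  from M obtain g :: "2 \<Rightarrow> complex \<Rightarrow> complex" where
    g: "\<And>j. analytic_continuation_along (linepath x (x + c)) (f j) (g j)"
      "\<forall>\<^sub>F z in nhds x. (\<chi> j. g j (z + c)) = (\<chi> j. f j z) v* M"
    unfolding monodromy_matrix_def c by blast
  have "\<forall>j. \<exists>\<psi>. solves Q \<psi> \<and> (\<forall>\<^sub>F z in nhds x. f j z = \<psi> z)"
  proof
    fix j
    from basis have loc: "local_solution \<omega>1 \<omega>3 m E x (f j)" by (simp add: solution_basis_def)
    hence "\<forall>\<^sub>F z in nhds x. heun_op \<omega>1 \<omega>3 m (f j) z = E * f j z" by (simp add: local_solution_def)
    hence "\<forall>\<^sub>F z in nhds x. (deriv ^^ 2) (f j) z = Q z * f j z"
    proof eventually_elim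
      case (elim z)
      hence "- (deriv ^^ 2) (f j) z + pot (\<lambda>i. m i * (m i + 1)) z * f j z = E * f j z"
        by (simp only: heun_op_def pot_def)
      thus ?case unfolding Q_def by algebra
    qed
    with germ_extends[OF Q(1), of "f j"] loc show "\<exists>\<psi>. solves Q \<psi> \<and> (\<forall>\<^sub>F z in nhds x. f j z = \<psi> z)"
      unfolding local_solution_def by metis
  qed
  from choice[OF this] obtain \<psi> where
    \<psi>: "\<And>j. solves Q (\<psi> j)" "\<And>j. \<forall>\<^sub>F z in nhds x. f j z = \<psi> j z" by blast
  have \<psi>_eq: "\<psi> j (z + c) = M $ 1 $ j * \<psi> 1 z + M $ 2 $ j * \<psi> 2 z" if z: "z \<in> \<Omega>" for j z
  proof -
    have "\<forall>\<^sub>F z in nhds (x + c). g j z = \<psi> j z"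
    proof (rule analytic_continuation_along_linepath_eq[OF g(1) open_dom _ _ \<psi>(2)])
      show "\<psi> j holomorphic_on \<Omega>" using \<psi>(1) by (simp add: solves_def)
      show "closed_segment x (x + c) \<subseteq> \<Omega>" using base_in_dom by (intro segment_in_dom) simp
    qed
    moreover have "filterlim (\<lambda>z. z + c) (nhds (x + c)) (nhds x)"
      by (intro tendsto_intros filterlim_ident)
    ultimately have "\<forall>\<^sub>F z in nhds x. g j (z + c) = \<psi> j (z + c)"
      by (rule eventually_compose_filterlim)
    with g(2) \<psi>(2)[of 1] \<psi>(2)[of 2]
    have ev: "\<forall>\<^sub>F z in nhds x. \<psi> j (z + c) = M $ 1 $ j * \<psi> 1 z + M $ 2 $ j * \<psi> 2 z"
    proof eventually_elim
      case (elim z)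
      have "g j (z + c) = ((\<chi> j. f j z) v* M) $ j" using elim(1) by (metis vec_lambda_beta)
      also have "\<dots> = M $ 1 $ j * f 1 z + M $ 2 $ j * f 2 z"
        by (simp add: vector_matrix_mult_def sum_2 mult.commute)
      finally show ?case using elim by simp
    qed
    show ?thesis
    proof (rule solves_unique[OF Q(1) solves_two_sided(1)[OF Q(2) \<psi>(1)] solves_lincomb[OF \<psi>(1) \<psi>(1)] _ _ z])
      show "\<psi> j (x + c) = M $ 1 $ j * \<psi> 1 x + M $ 2 $ j * \<psi> 2 x"
        using ev by (rule eventually_nhds_x_imp_x)
      show "deriv (\<lambda>z. \<psi> j (z + c)) x = deriv (\<lambda>z. M $ 1 $ j * \<psi> 1 z + M $ 2 $ j * \<psi> 2 z) x"
        using ev by (intro deriv_cong_ev) auto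
    qed
  qed
  have "wronskian (\<psi> 1) (\<psi> 2) x \<noteq> 0"
  proof
    assume W: "wronskian (\<psi> 1) (\<psi> 2) x = 0"
    have indep: "a = 0 \<and> b = 0"
      if "a * \<psi> 1 x + b * \<psi> 2 x = 0" "a * deriv (\<psi> 1) x + b * deriv (\<psi> 2) x = 0" for a b
    proof -
      have s: "solves Q (\<lambda>z. a * \<psi> 1 z + b * \<psi> 2 z)" by (intro solves_lincomb \<psi>)
      have "deriv (\<lambda>z. a * \<psi> 1 z + b * \<psi> 2 z) x = a * deriv (\<psi> 1) x + b * deriv (\<psi> 2) x"
        by (intro DERIV_imp_deriv DERIV_add DERIV_cmult solvesD(1)[OF \<psi>(1) base_in_dom])
      with that have zero: "a * \<psi> 1 z + b * \<psi> 2 z = 0" if "z \<in> \<Omega>" for z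
        using solves_zero[OF Q(1) s _ _ that] by simp
      define e where "e = (\<lambda>j::2. if j = 1 then a else b)"
      have "\<forall>\<^sub>F z in nhds x. (\<Sum>j\<in>UNIV. e j * f j z) = 0"
        using \<psi>(2)[of 1] \<psi>(2)[of 2] eventually_nhds_in_open[OF open_dom base_in_dom]
        by eventually_elim (simp add: sum_2 e_def zero)
      hence "\<forall>j. e j = 0" using basis unfolding solution_basis_def by blast
      hence "e 1 = 0" "e 2 = 0" by blast+
      thus ?thesis by (simp add: e_def)
    qed
    \<comment> \<open>If the Wronskian vanishes, (\<psi>_2, -\<psi>_1) and the same pair of
      derivatives at x are coefficients of linear relations, hence zero. All initial data then
      vanish, and even the coefficients (1, 0) give a relation.\<close>
    have "\<psi> 2 x = 0 \<and> - \<psi> 1 x = 0" using W by (intro indep) (simp_all add: wronskian_def mult.commute)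
    moreover have "deriv (\<psi> 2) x = 0 \<and> - deriv (\<psi> 1) x = 0"
      using W by (intro indep) (simp_all add: wronskian_def mult.commute)
    ultimately have "(1::complex) = 0 \<and> (0::complex) = 0" by (intro indep) simp_all
    thus False by simp
  qed
  from trace_eq_disc[OF Q \<psi>(1) \<psi>(1) this \<psi>_eq \<psi>_eq]
  show ?thesis by (simp add: trace_def sum_2 Q_def)
qed

end

text \<open>The segment is compact and H closed, so they have a positive distance e. Translating by
  multiples of c, which lie in H, carries this to the whole line, and the strip of half-width e
  around it is convex and invariant.\<close>

lemma (in lattice) strip_exists:
  assumes k: "k \<in> {1, 3}" and seg: "closed_segment x (x + 2 * hp k) \<inter> H = {}"
  obtains \<Omega> where "strip \<omega>1 \<omega>3 \<Omega> x (2 * hp k)"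
proof -
  define c where "c = 2 * hp k"
  have \<omega>: "\<omega>1 \<noteq> 0" "\<omega>3 \<noteq> 0" using ratio by auto
  have hk: "hp k = \<omega>1 \<or> hp k = \<omega>3" using k by (auto simp: half_period_def)
  have c0: "c \<noteq> 0" using hk \<omega> by (auto simp: c_def)
  have cL: "c \<in> L" unfolding c_def by (rule double_hp_in_L)
  have multiple: "of_int n * c \<in> H" for n :: int
  proof -
    have "of_int n * c = of_int (2 * n) * \<omega>1 + of_int 0 * \<omega>3 \<or> of_int n * c = of_int 0 * \<omega>1 + of_int (2 * n) * \<omega>3"
      using hk by (auto simp: c_def)
    thus ?thesis unfolding int_span2_def by blast
  qed
  have prim: "c * of_real \<tau> \<notin> L" if \<tau>: "0 < \<tau>" "\<tau> < 1" for \<tau> :: real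
  proof
    assume "c * of_real \<tau> \<in> L"
    then obtain m n :: int where mn: "c * of_real \<tau> = of_int m * (2 * \<omega>1) + of_int n * (2 * \<omega>3)"
      by (auto simp: int_span2_def)
    from hk show False
    proof
      assume "hp k = \<omega>1"
      hence "of_real \<tau> * (2 * \<omega>1) + of_real 0 * (2 * \<omega>3) =
             of_real (of_int m) * (2 * \<omega>1) + of_real (of_int n) * (2 * \<omega>3)"
        using mn by (simp add: c_def mult_ac)
      from real_span_cong(1)[OF ratio2 this] \<tau> have "0 < m" "m < 1" by simp_all
      thus False by simp
    next
      assume "hp k = \<omega>3"
      hence "of_real 0 * (2 * \<omega>1) + of_real \<tau> * (2 * \<omega>3) =
             of_real (of_int m) * (2 * \<omega>1) + of_real (of_int n) * (2 * \<omega>3)"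
        using mn by (simp add: c_def mult_ac)
      from real_span_cong(2)[OF ratio2 this] \<tau> have "0 < n" "n < 1" by simp_all
      thus False by simp
    qed
  qed
  have "closed H" using open_compl_H by (simp add: closed_open)
  then obtain e where e: "e > 0" "\<And>p q. p \<in> closed_segment x (x + c) \<Longrightarrow> q \<in> H \<Longrightarrow> e \<le> dist p q"
    using separate_compact_closed[OF compact_segment _ seg] by (auto simp: c_def)
  \<comment> \<open>The map (z - x) / c sends the line to the real axis and scales lengths by 1 /
    |c|, so this is the set of points at distance less than e from the line.\<close>
  define \<Omega> where "\<Omega> = {z. \<bar>Im ((z - x) / c)\<bar> < e / norm c}"
  have "convex_domain \<Omega> x"
  proof
    show "open \<Omega>" unfolding \<Omega>_def
      by (intro open_Collect_less continuous_intros) (use c0 in auto)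
    show "x \<in> \<Omega>" using e c0 by (simp add: \<Omega>_def)
    show "convex \<Omega>"
    proof (rule convexI)
      fix z w and s t :: real assume zw: "z \<in> \<Omega>" "w \<in> \<Omega>" and st: "0 \<le> s" "0 \<le> t" "s + t = 1"
      have "s *\<^sub>R z + t *\<^sub>R w - x = s *\<^sub>R (z - x) + t *\<^sub>R (w - x)"
        using st(3) by (simp add: algebra_simps flip: scaleR_add_left)
      hence "(s *\<^sub>R z + t *\<^sub>R w - x) / c = s *\<^sub>R ((z - x) / c) + t *\<^sub>R ((w - x) / c)"
        by (simp add: add_divide_distrib scaleR_conv_of_real)
      hence im: "Im ((s *\<^sub>R z + t *\<^sub>R w - x) / c) = s *\<^sub>R Im ((z - x) / c) + t *\<^sub>R Im ((w - x) / c)"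
        by simp
      have "convex {- (e / norm c)<..<e / norm c}" by (rule convex_real_interval)
      moreover have "Im ((z - x) / c) \<in> {- (e / norm c)<..<e / norm c}" "Im ((w - x) / c) \<in> {- (e / norm c)<..<e / norm c}"
        using zw by (auto simp: \<Omega>_def abs_less_iff)
      ultimately have "s *\<^sub>R Im ((z - x) / c) + t *\<^sub>R Im ((w - x) / c) \<in> {- (e / norm c)<..<e / norm c}"
        using st by (intro convexD)
      thus "s *\<^sub>R z + t *\<^sub>R w \<in> \<Omega>" unfolding \<Omega>_def mem_Collect_eq im by (auto simp: abs_less_iff)
    qed
  qed
  moreover have "z + c \<in> \<Omega> \<longleftrightarrow> z \<in> \<Omega>" for z
  proof -
    have "(z + c - x) / c = (z - x) / c + 1" using c0 by (simp add: field_simps)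
    thus ?thesis by (simp add: \<Omega>_def)
  qed
  moreover have "\<Omega> \<inter> H = {}"
  proof (rule ccontr)
    assume "\<Omega> \<inter> H \<noteq> {}"
    then obtain z where z: "z \<in> \<Omega>" "z \<in> H" by blast
    define w where "w = (z - x) / c"
    \<comment> \<open>Subtracting n c keeps z in H and moves the foot of its perpendicular into the
      segment, where it is \<open>p\<close>.\<close>
    define n where "n = \<lfloor>Re w\<rfloor>"
    define p where "p = x + of_real (frac (Re w)) * c"
    have zw: "z = x + w * c" using c0 by (simp add: w_def)
    have "p \<in> closed_segment x (x + c)"
      unfolding closed_segment_def p_def using frac_lt_1[of "Re w"]
      by (intro CollectI exI[of _ "frac (Re w)"]) (auto simp: scaleR_conv_of_real algebra_simps)
    moreover have "z - of_int n * c \<in> H" using z(2) multiple by (intro int_span2_diff)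
    ultimately have "e \<le> dist p (z - of_int n * c)" by (rule e(2))
    also have "p - (z - of_int n * c) = - (\<i> * of_real (Im w) * c)"
    proof -
      have "of_real (frac (Re w)) + of_int n - w = - (\<i> * of_real (Im w))"
        by (simp add: complex_eq_iff frac_def n_def)
      hence "(of_real (frac (Re w)) + of_int n - w) * c = - (\<i> * of_real (Im w)) * c" by (simp only:)
      thus ?thesis by (simp add: p_def zw algebra_simps)
    qed
    hence "dist p (z - of_int n * c) = \<bar>Im w\<bar> * norm c" by (simp add: dist_norm norm_mult)
    also have "\<dots> < e / norm c * norm c"
      using z(1) c0 by (intro mult_strict_right_mono) (auto simp: \<Omega>_def w_def)
    also have "\<dots> = e" using c0 by simp
    finally show False by simp
  qed
  ultimately have "strip \<omega>1 \<omega>3 \<Omega> x c"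
    using cL prim by (intro strip.intro lattice_axioms periodic_domain.intro periodic_domain_axioms.intro strip_axioms.intro) auto
  thus ?thesis using that by (simp add: c_def)
qed

theorem theorem6p3:
  fixes \<omega>1 \<omega>3 E x d :: complex
    and l \<alpha> :: "nat \<Rightarrow> complex"
    and k :: nat
    and f g :: "2 \<Rightarrow> complex \<Rightarrow> complex"
    and M N :: "complex^2^2"
  assumes "Im (\<omega>3 / \<omega>1) \<noteq> 0"
    and "k \<in> {1, 3}"
    and "\<And>i. i \<in> {0..3} \<Longrightarrow> \<alpha> i \<in> {- l i, l i + 1}"
    and "d = - (\<Sum>i=0..3. \<alpha> i / 2)"
    and "closed_segment x (x + 2 * half_period \<omega>1 \<omega>3 k) \<inter> int_span2 \<omega>1 \<omega>3 = {}"
    and "monodromy_matrix \<omega>1 \<omega>3 l E k x f M"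
    and "monodromy_matrix \<omega>1 \<omega>3 (\<lambda>i. \<alpha> i + d) E k x g N"
  shows "trace M = trace N"
proof -
  interpret lattice \<omega>1 \<omega>3 by unfold_locales (rule assms(1))
  obtain \<Omega> where "strip \<omega>1 \<omega>3 \<Omega> x (2 * half_period \<omega>1 \<omega>3 k)"
    using strip_exists[OF assms(2,5)] by blast
  then interpret strip \<omega>1 \<omega>3 \<Omega> x "2 * half_period \<omega>1 \<omega>3 k" .
  \<comment> \<open>Both -l and l + 1 are roots of t (t - 1) = l (l + 1), so the choice of \<alpha>
    i does not affect the potential.\<close>
  have "pot (\<lambda>i. l i * (l i + 1)) z = pot (\<lambda>i. \<alpha> i * (\<alpha> i - 1)) z" for z
    unfolding pot_def
  proof (intro sum.cong refl)
    fix i :: nat assume "i \<in> {0..3}"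
    with assms(3)[of i] have "l i * (l i + 1) = \<alpha> i * (\<alpha> i - 1)" by (auto simp: algebra_simps)
    thus "l i * (l i + 1) * wp (z + hp i) = \<alpha> i * (\<alpha> i - 1) * wp (z + hp i)" by simp
  qed
  hence "trace M = disc (\<lambda>z. pot (\<lambda>i. \<alpha> i * (\<alpha> i - 1)) z - E)"
    using trace_monodromy_eq_disc[OF assms(6) refl] by simp
  also have "\<dots> = disc (\<lambda>z. pot (\<lambda>i. (\<alpha> i + d) * (\<alpha> i + d + 1)) z - E)"
    by (rule disc_eq_reflection) (simp add: assms(4) sum_divide_distrib[symmetric])
  also have "\<dots> = trace N" by (rule trace_monodromy_eq_disc[OF assms(7) refl, symmetric])
  finally show ?thesis .
qed

end
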